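(* Let $d\ge 1$ and $p=1-q\in(0,1)$. There exists $C>0$ such that for all integers $L\ge 1$ and every ergodic boundary condition, the mixing time $T_{\rm mix}$ of the East-like process with parameter $q$ in $\Lambda=[1,L]^d\cap\mathbb Z^d$ with that boundary condition satisfies $$C^{-1}L\le T_{\rm mix}\le C L.$$
   Context: Let $\mathcal B=\{e_1,\dots,e_d\}$ be the canonical basis of $\mathbb Z^d$. For $\Lambda\subset\mathbb Z^d$ let $\partial_E\Lambda=\{y\in\mathbb Z^d\setminus\Lambda:\ y+e\in\Lambda\text{ for some }e\in\mathcal B\}$. A boundary condition is a (fixed in time) configuration $\sigma\in\{0,1\}^{\partial_E\Lambda}$. The East-like process in $\Lambda$ with parameter $q$ and boundary condition $\sigma$ is the continuous time Markov chain on $\Omega_\Lambda=\{0,1\}^\Lambda$ with generator $$\mathcal L^\sigma_\Lambda f(\eta)=\sum_{x\in\Lambda}c_x^{\Lambda,\sigma}(\eta)\bigl[\eta(x)q+(1-\eta(x))p\bigr]\bigl[f(\eta^x)-f(\eta)\bigr],$$ where $\eta^x$ is $\eta$ flipped at $x$ and $c_x^{\Lambda,\sigma}(\eta)$ is the indicator that there exists $e\in\mathcal B$ with $(\sigma\cdot\eta)(x-e)=0$, $\sigma\cdot\eta$ being equal to $\sigma$ on $\partial_E\Lambda$ and to $\eta$ on $\Lambda$. The boundary condition is ergodic if the chain is ergodic; for $\Lambda=[1,L]^d$ this holds if and only if $\sigma(a-e)=0$ for some $e\in\mathcal B$, where $a=(1,\dots,1)$. The reversible measure is $\pi=\pi_\Lambda$,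 the product Bernoulli($p$) measure on $\Omega_\Lambda$. With $\mathbb P^\Lambda_\eta$ the law of the chain started at $\eta$ and $\|\cdot\|_{\rm TV}$ total variation distance, $$T_{\rm mix}=\inf\Bigl\{t>0:\ \max_{\eta\in\Omega_\Lambda}\|\mathbb P^\Lambda_\eta(\eta_t\in\cdot)-\pi\|_{\rm TV}\le 1/4\Bigr\}.$$ *)

theory Defs
  imports "HOL-Analysis.Analysis" "HOL-Probability.Probability"
begin

text \<open>
  The lattice \<open>\<int>\<^sup>d\<close> is the type \<^typ>\<open>int ^ 'd\<close> with \<open>d = CARD('d) \<ge> 1\<close>. The spin values 0 and 1
  are the truth values \<^term>\<open>False\<close> and \<^term>\<open>True\<close>. Configurations on a region are
  extensional functions (\<^term>\<open>undefined\<close> outside the region).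
\<close>

type_synonym 'd site = "int ^ 'd"
type_synonym 'd config = "'d site \<Rightarrow> bool"

definition canonical_basis :: "('d::finite) site set" where
  "canonical_basis = range (\<lambda>i. axis i 1)"

definition east_boundary :: "('d::finite) site set \<Rightarrow> 'd site set" where
  "east_boundary \<Lambda> = {y. y \<notin> \<Lambda> \<and> (\<exists>e\<in>canonical_basis. y + e \<in> \<Lambda>)}"

definition configs :: "('d::finite) site set \<Rightarrow> 'd config set" where
  "configs \<Lambda> = \<Lambda> \<rightarrow>\<^sub>E UNIV"

definition lattice_box :: "nat \<Rightarrow> ('d::finite) site set" where
  "lattice_box L = {x. \<forall>i. 1 \<le> x $ i \<and> x $ i \<le> int L}"

definition glue :: "('d::finite) site set \<Rightarrow> 'd config \<Rightarrow> 'd config \<Rightarrow> 'd config" where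
  "glue \<Lambda> \<sigma> \<eta> y = (if y \<in> \<Lambda> then \<eta> y else \<sigma> y)"

definition flip :: "('d::finite) config \<Rightarrow> 'd site \<Rightarrow> 'd config" where
  "flip \<eta> x = \<eta>(x := \<not> \<eta> x)"

definition constraint :: "('d::finite) site set \<Rightarrow> 'd config \<Rightarrow> 'd site \<Rightarrow> 'd config \<Rightarrow> real" where
  "constraint \<Lambda> \<sigma> x \<eta> = of_bool (\<exists>e\<in>canonical_basis. \<not> glue \<Lambda> \<sigma> \<eta> (x - e))"

definition generator ::
  "real \<Rightarrow> ('d::finite) site set \<Rightarrow> 'd config \<Rightarrow> ('d config \<Rightarrow> real) \<Rightarrow> 'd config \<Rightarrow> real" where
  "generator q \<Lambda> \<sigma> f \<eta> =
     (\<Sum>x\<in>\<Lambda>. constraint \<Lambda> \<sigma> x \<eta>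
            * (of_bool (\<eta> x) * q + (1 - of_bool (\<eta> x)) * (1 - q))
            * (f (flip \<eta> x) - f \<eta>))"

text \<open>
  For finite \<open>\<Lambda>\<close> the state space is finite, and the semigroup of the chain is the exponential of
  \<open>t\<close> times the generator, given by its power series (which converges absolutely, since the
  generator is bounded in the supremum norm).
\<close>

definition semigroup_at ::
  "real \<Rightarrow> ('d::finite) site set \<Rightarrow> 'd config \<Rightarrow> real \<Rightarrow> ('d config \<Rightarrow> real) \<Rightarrow> 'd config \<Rightarrow> real" where
  "semigroup_at q \<Lambda> \<sigma> t f \<eta> = (\<Sum>n. t ^ n / fact n * (generator q \<Lambda> \<sigma> ^^ n) f \<eta>)"

text \<open>The probability that the chain started at \<open>\<eta>\<close> is in \<open>A\<close> at time \<open>t\<close>.\<close>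

definition law ::
  "real \<Rightarrow> ('d::finite) site set \<Rightarrow> 'd config \<Rightarrow> real \<Rightarrow> 'd config \<Rightarrow> 'd config set \<Rightarrow> real" where
  "law q \<Lambda> \<sigma> t \<eta> A = semigroup_at q \<Lambda> \<sigma> t (indicator A) \<eta>"

definition reversible_measure :: "real \<Rightarrow> ('d::finite) site set \<Rightarrow> 'd config pmf" where
  "reversible_measure q \<Lambda> = Pi_pmf \<Lambda> undefined (\<lambda>_. bernoulli_pmf (1 - q))"

text \<open>
  A continuous-time Markov chain on a finite state space is ergodic iff it is irreducible: every
  state can be reached from every other one with positive probability.
\<close>

definition ergodic_boundary :: "real \<Rightarrow> ('d::finite) site set \<Rightarrow> 'd config \<Rightarrow> bool" where
  "ergodic_boundary q \<Lambda> \<sigma> \<longleftrightarrow>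
     (\<forall>\<eta>\<in>configs \<Lambda>. \<forall>\<xi>\<in>configs \<Lambda>. \<exists>t>0. law q \<Lambda> \<sigma> t \<eta> {\<xi>} > 0)"

text \<open>Total variation distance of two probability distributions on a finite set \<open>\<Omega>\<close>.\<close>

definition tv_dist :: "'a set \<Rightarrow> ('a set \<Rightarrow> real) \<Rightarrow> ('a set \<Rightarrow> real) \<Rightarrow> real" where
  "tv_dist \<Omega> \<mu> \<nu> = (MAX A\<in>Pow \<Omega>. \<bar>\<mu> A - \<nu> A\<bar>)"

text \<open>
  The infimum is taken in the reals; it is meaningful for ergodic boundary conditions, where the
  set of admissible times is nonempty by convergence to equilibrium.
\<close>

definition mixing_time :: "real \<Rightarrow> ('d::finite) site set \<Rightarrow> 'd config \<Rightarrow> real" where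
  "mixing_time q \<Lambda> \<sigma> =
     Inf {t. t > 0 \<and>
             (MAX \<eta>\<in>configs \<Lambda>. tv_dist (configs \<Lambda>) (law q \<Lambda> \<sigma> t \<eta>)
                (measure_pmf.prob (reversible_measure q \<Lambda>))) \<le> 1 / 4}"

end

theory Submission
  imports Defs "HOL-Real_Asymp.Real_Asymp"
begin

text \<open>
  Upper bound. Let \<open>V y\<close> be the indicator that \<open>y\<close> is in state 0 and \<open>H \<theta> y t = exp (t (L - \<theta> V y)) 1\<close>, where
  \<open>L\<close> is the generator. The process is oriented: the spins on a straight line \<open>S = {y + k e. 1 \<le> k \<le> n}\<close>
  have no influence on the other sites below its endpoint \<open>x\<close>. Hence the average \<open>M\<close> of \<open>(H \<theta> x t)\<^sup>2\<close> over
  the spins in \<open>S\<close> satisfies \<open>\<partial>M/\<partial>t \<le> (L - 2 \<theta>' V y) M\<close>, where \<open>\<theta>' > 0\<close> comes from the spectral gap of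
  the one-dimensional East chain on \<open>S\<close>, driven by a zero at \<open>y\<close>; that gap is bounded below uniformly in \<open>n\<close>
  by the bisection method of Cancrini, Martinelli, Roberto and Toninelli. By the maximum principle
  \<open>(H \<theta> x t)\<^sup>2 \<le> min p q ^ (- n) * sup (H (2 \<theta>') y t)\<close>. Going from the zero on the boundary to \<open>x\<close> along
  at most \<open>d\<close> lines gives \<open>H \<theta> x t \<le> K ^ L exp (- c t)\<close> for every initial configuration. Resampling the sites
  one by one in a linear extension of the coordinatewise order bounds the total variation distance at time
  \<open>t\<close> by a sum of \<open>L ^ d\<close> square roots of such terms.

  Lower bound. The corner spin relaxes exactly like \<open>exp (- t)\<close>, so the mixing time is at least \<open>ln 2\<close>;
  for large \<open>L\<close>, started from all ones, zeros need a time of order \<open>L\<close> to reach a segment of length \<open>L / 2\<close>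
  far from the boundary.
\<close>

subsection \<open>Averaging over Bernoulli spins\<close>

text \<open>By Feynman-Kac, \<open>H \<theta> y t\<close> is the expectation of
  \<open>exp (- \<theta> s)\<close>, where s is the time that y has spent in state 0 up to time t;
  its decay says that y is zero often enough to drive its neighbours. The obstacle is the initial
  configuration: the spectral gap controls mean squares under the Bernoulli measure, while the
  process may start anywhere, and returning from an average to a single configuration costs a factor
  exponential in the number of averaged spins. Applied to the whole box this would cost the
  exponential of the volume. The orientation allows averaging over one line only, so that at most d
  lines lose a factor \<open>K ^ L\<close> in all, which a time of order L absorbs. Squaring serves
  two purposes: it produces the Dirichlet form on the line, and it keeps the contribution of the
  other sites below the generator applied to the average. Every line lowers both the decay rate and
  the killing parameter, but there are at most d of them. What must not deteriorate with L is the
  gap on a line, hence the need for a bound uniform in the length.\<close>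

locale bernoulli_parameter =
  fixes p :: real
  assumes p_pos: "0 < p" and p_less_1: "p < 1"
begin

text \<open>Conditional expectation given all spins except the one at \<open>z\<close>, kept as a
  function of the whole configuration. Composing these operators averages over a product measure
  site by site, so measures enter only in the comparison with \<open>Pi_pmf\<close>.\<close>

definition av :: "'a \<Rightarrow> (('a \<Rightarrow> bool) \<Rightarrow> real) \<Rightarrow> ('a \<Rightarrow> bool) \<Rightarrow> real" where
  "av z f \<eta> = p * f (\<eta>(z := True)) + (1 - p) * f (\<eta>(z := False))"

definition avs :: "'a list \<Rightarrow> (('a \<Rightarrow> bool) \<Rightarrow> real) \<Rightarrow> ('a \<Rightarrow> bool) \<Rightarrow> real" where
  "avs zs f = foldr av zs f"

lemma avs_simps [simp]: "avs [] f = f" "avs (z # zs) f = av z (avs zs f)"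
  by (simp_all add: avs_def)

lemma avs_append: "avs (xs @ ys) f = avs xs (avs ys f)"
  by (simp add: avs_def)

lemma av_const [simp]: "av z (\<lambda>_. c) = (\<lambda>_. c)"
  by (auto simp: av_def fun_eq_iff algebra_simps)

lemma av_add: "av z (\<lambda>\<xi>. f \<xi> + g \<xi>) = (\<lambda>\<xi>. av z f \<xi> + av z g \<xi>)"
  by (auto simp: av_def fun_eq_iff algebra_simps)

lemma av_cmult: "av z (\<lambda>\<xi>. c * f \<xi>) = (\<lambda>\<xi>. c * av z f \<xi>)"
  by (auto simp: av_def fun_eq_iff algebra_simps)

lemma av_commute: "av z (av w f) = av w (av z f)"
  by (cases "z = w") (auto simp: av_def fun_eq_iff algebra_simps fun_upd_twist)

lemma av_upd [simp]: "av z f (\<eta>(z := b)) = av z f \<eta>"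
  by (simp add: av_def)

lemma av_indep_mult:
  assumes "\<And>\<xi> b. g (\<xi>(z := b)) = g \<xi>"
  shows "av z (\<lambda>\<xi>. g \<xi> * f \<xi>) = (\<lambda>\<xi>. g \<xi> * av z f \<xi>)"
  by (auto simp: av_def fun_eq_iff algebra_simps assms)

lemma av_indep:
  assumes "\<And>\<xi> b. g (\<xi>(z := b)) = g \<xi>"
  shows "av z g = g"
  by (auto simp: av_def fun_eq_iff algebra_simps assms)

lemma av_idem [simp]: "av z (av z f) = av z f"
  by (rule av_indep) simp

lemma avs_const [simp]: "avs zs (\<lambda>_. c) = (\<lambda>_. c)"
  by (induction zs) auto

lemma avs_add: "avs zs (\<lambda>\<xi>. f \<xi> + g \<xi>) = (\<lambda>\<xi>. avs zs f \<xi> + avs zs g \<xi>)"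
  by (induction zs) (auto simp: av_add)

lemma avs_cmult: "avs zs (\<lambda>\<xi>. c * f \<xi>) = (\<lambda>\<xi>. c * avs zs f \<xi>)"
  by (induction zs) (auto simp: av_cmult)

lemma avs_diff: "avs zs (\<lambda>\<xi>. f \<xi> - g \<xi>) = (\<lambda>\<xi>. avs zs f \<xi> - avs zs g \<xi>)"
  using avs_add[of zs f "\<lambda>\<xi>. (-1) * g \<xi>"] unfolding avs_cmult by simp

lemma avs_sum: "avs zs (\<lambda>\<xi>. \<Sum>i\<in>I. f i \<xi>) = (\<lambda>\<xi>. \<Sum>i\<in>I. avs zs (f i) \<xi>)"
  by (induction I rule: infinite_finite_induct) (auto simp: avs_add)

lemma avs_av_commute: "avs zs (av z f) = av z (avs zs f)"
  by (induction zs) (auto simp: av_commute)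

lemma avs_commute: "avs xs (avs ys f) = avs ys (avs xs f)"
  by (induction xs) (auto simp: avs_av_commute)

lemma avs_indep_mult:
  assumes "\<And>z \<xi> b. z \<in> set zs \<Longrightarrow> g (\<xi>(z := b)) = g \<xi>"
  shows "avs zs (\<lambda>\<xi>. g \<xi> * f \<xi>) = (\<lambda>\<xi>. g \<xi> * avs zs f \<xi>)"
  using assms by (induction zs) (auto simp: av_indep_mult)

lemma avs_indep:
  assumes "\<And>z \<xi> b. z \<in> set zs \<Longrightarrow> g (\<xi>(z := b)) = g \<xi>"
  shows "avs zs g = g"
  using avs_indep_mult[of zs g "\<lambda>_. 1"] assms by simp

lemma avs_upd: "z \<in> set zs \<Longrightarrow> avs zs f (\<eta>(z := b)) = avs zs f \<eta>"
proof (induction zs arbitrary: \<eta>)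
  case (Cons w zs)
  show ?case
  proof (cases "z = w")
    case False
    then have "z \<in> set zs" using Cons.prems by simp
    then have "avs zs f (\<eta>(w := c, z := b)) = avs zs f (\<eta>(w := c))" for c
      by (rule Cons.IH)
    then show ?thesis unfolding avs_simps av_def fun_upd_twist[OF False] by (simp only:)
  next
    case True
    then show ?thesis by (simp only: avs_simps av_upd)
  qed
qed simp

lemma avs_absorb: "z \<in> set zs \<Longrightarrow> avs zs (av z f) = avs zs f"
  unfolding avs_av_commute by (rule av_indep) (rule avs_upd)

lemma avs_idem: "avs zs (avs zs f) = avs zs f"
  by (rule avs_indep) (rule avs_upd)

lemma avs_indep_other:
  assumes "\<And>\<xi> b. f (\<xi>(z := b)) = f \<xi>"
  shows "avs zs f (\<xi>(z := b)) = avs zs f \<xi>"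
  using assms
proof (induction zs arbitrary: \<xi>)
  case (Cons w zs)
  have "avs zs f (\<xi>(w := c, z := b)) = avs zs f (\<xi>(w := c))" for c
    by (rule Cons.IH) (rule Cons.prems)
  then show ?case
    by (cases "z = w") (simp_all only: avs_simps av_def fun_upd_upd fun_upd_twist[of z w] not_False_eq_True)
qed simp

lemma avs_mono:
  assumes "\<And>\<xi>. (\<And>k. k \<notin> set zs \<Longrightarrow> \<xi> k = \<eta> k) \<Longrightarrow> f \<xi> \<le> g \<xi>"
  shows "avs zs f \<eta> \<le> avs zs g \<eta>"
  using assms
proof (induction zs arbitrary: \<eta>)
  case (Cons z zs)
  have "avs zs f (\<eta>(z := b)) \<le> avs zs g (\<eta>(z := b))" for b
    by (rule Cons.IH) (auto intro!: Cons.prems)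
  then show ?case
    using p_pos p_less_1 by (auto simp: av_def intro!: add_mono mult_left_mono)
qed auto

lemma avs_cong:
  assumes "\<And>\<xi>. (\<And>k. k \<notin> set zs \<Longrightarrow> \<xi> k = \<eta> k) \<Longrightarrow> f \<xi> = g \<xi>"
  shows "avs zs f \<eta> = avs zs g \<eta>"
  by (rule antisym; rule avs_mono; simp add: assms)

lemma avs_nonneg: "(\<And>\<xi>. 0 \<le> f \<xi>) \<Longrightarrow> 0 \<le> avs zs f \<eta>"
  using avs_mono[of zs \<eta> "\<lambda>_. 0" f] by simp

text \<open>Resampling a site reproduces the spin already there with probability at least
  \<open>min p (1 - p)\<close>. This is the passage from an average over a line back to one
  configuration.\<close>

lemma avs_ge_point:
  assumes "\<And>\<xi>. 0 \<le> f \<xi>"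
  shows "min p (1 - p) ^ length zs * f \<eta> \<le> avs zs f \<eta>"
proof (induction zs arbitrary: \<eta>)
  case (Cons z zs)
  let ?k = "min p (1 - p)"
  have k: "0 \<le> ?k" using p_pos p_less_1 by auto
  have nn: "0 \<le> avs zs f \<xi>" for \<xi> by (rule avs_nonneg) (rule assms)
  have "?k * avs zs f \<eta> \<le> av z (avs zs f) \<eta>"
  proof (cases "\<eta> z")
    case True
    then have "\<eta> = \<eta>(z := True)" by (simp add: fun_upd_idem)
    then have "?k * avs zs f \<eta> \<le> p * avs zs f (\<eta>(z := True))"
      using nn by (metis min.cobounded1 mult_right_mono)
    then show ?thesis unfolding av_def using nn p_less_1 by (smt (verit) mult_nonneg_nonneg)
  next
    case False
    then have "\<eta> = \<eta>(z := False)" by (simp add: fun_upd_idem)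
    then have "?k * avs zs f \<eta> \<le> (1 - p) * avs zs f (\<eta>(z := False))"
      using nn by (metis min.cobounded2 mult_right_mono)
    then show ?thesis unfolding av_def using nn p_pos by (smt (verit) mult_nonneg_nonneg)
  qed
  moreover have "?k * (?k ^ length zs * f \<eta>) \<le> ?k * avs zs f \<eta>"
    by (rule mult_left_mono[OF Cons.IH k])
  ultimately show ?case by (simp add: mult.assoc)
qed simp

section \<open>Conditional variances and two-block inequalities\<close>

definition var :: "'a list \<Rightarrow> (('a \<Rightarrow> bool) \<Rightarrow> real) \<Rightarrow> ('a \<Rightarrow> bool) \<Rightarrow> real" where
  "var zs f \<eta> = avs zs (\<lambda>\<xi>. (f \<xi>)\<^sup>2) \<eta> - (avs zs f \<eta>)\<^sup>2"

lemma var_eq: "var zs f \<eta> = avs zs (\<lambda>\<xi>. (f \<xi> - avs zs f \<eta>)\<^sup>2) \<eta>"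
proof -
  let ?m = "avs zs f \<eta>"
  have "(\<lambda>\<xi>. (f \<xi> - ?m)\<^sup>2) = (\<lambda>\<xi>. ((f \<xi>)\<^sup>2 - (2 * ?m) * f \<xi>) + ?m\<^sup>2)"
    by (auto simp: fun_eq_iff power2_eq_square algebra_simps)
  then show ?thesis
    unfolding var_def by (simp add: avs_add avs_diff avs_cmult power2_eq_square)
qed

lemma var_nonneg: "0 \<le> var zs f \<eta>"
  unfolding var_eq by (rule avs_nonneg) simp

lemma var_upd: "z \<in> set zs \<Longrightarrow> var zs f (\<eta>(z := b)) = var zs f \<eta>"
  by (simp add: var_def avs_upd)

lemma avs_square_le: "(avs zs f \<eta>)\<^sup>2 \<le> avs zs (\<lambda>\<xi>. (f \<xi>)\<^sup>2) \<eta>"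
  using var_nonneg[of zs f \<eta>] by (simp add: var_def)

text \<open>Law of total variance; the difference of the two sides is the variance over
  \<open>xs\<close> of \<open>avs ys f\<close>.\<close>

lemma avs_var_le: "avs xs (var ys f) \<eta> \<le> var (xs @ ys) f \<eta>"
  unfolding var_def avs_append avs_diff using avs_square_le[of xs "avs ys f" \<eta>] by simp

text \<open>
  The sum of the orthogonal projection onto the constants and of multiplication by \<open>1 - h\<close> has norm
  \<open>1 + r\<close>, the cosine of the angle between the two ranges being \<open>r\<close>.
\<close>

lemma two_projections:
  assumes h: "\<And>\<xi>. h \<xi> = 0 \<or> h \<xi> = 1" and r: "0 < r"
    and eps: "avs zs (\<lambda>\<xi>. 1 - h \<xi>) \<eta> = r\<^sup>2"
  shows "(avs zs f \<eta>)\<^sup>2 \<le> avs zs (\<lambda>\<xi>. (r + h \<xi>) * (f \<xi>)\<^sup>2) \<eta>"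
proof -
  let ?m = "avs zs f \<eta>"
  let ?w = "\<lambda>\<xi>. r + h \<xi>"
  have w: "0 < ?w \<xi>" for \<xi> using h[of \<xi>] r by auto
  have hh: "avs zs h \<eta> = 1 - r\<^sup>2" using eps by (simp add: avs_diff)
  have inv: "(\<lambda>\<xi>. 1 / ?w \<xi>) = (\<lambda>\<xi>. 1 / r * (1 - h \<xi>) + 1 / (1 + r) * h \<xi>)"
  proof
    fix \<xi> show "1 / ?w \<xi> = 1 / r * (1 - h \<xi>) + 1 / (1 + r) * h \<xi>"
      using h[of \<xi>] r by (auto simp: add.commute)
  qed
  \<comment> \<open>This identity is why \<open>r\<close> is the square root of the probability of
    \<open>h = 0\<close>. The claim is then the Cauchy-Schwarz inequality with weights
    \<open>?w\<close> and \<open>1 / ?w\<close>, obtained below by expanding a square.\<close>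
  have one: "avs zs (\<lambda>\<xi>. 1 / ?w \<xi>) \<eta> = 1"
  proof -
    have "avs zs (\<lambda>\<xi>. 1 / ?w \<xi>) \<eta> = 1 / r * r\<^sup>2 + 1 / (1 + r) * (1 - r\<^sup>2)"
      unfolding inv avs_add avs_cmult eps hh ..
    also have "\<dots> = 1" using r by (simp add: field_simps power2_eq_square)
    finally show ?thesis .
  qed
  have "0 \<le> avs zs (\<lambda>\<xi>. ?w \<xi> * (f \<xi> - ?m / ?w \<xi>)\<^sup>2) \<eta>"
    by (rule avs_nonneg) (use w in \<open>auto intro!: mult_nonneg_nonneg simp: less_imp_le\<close>)
  also have "(\<lambda>\<xi>. ?w \<xi> * (f \<xi> - ?m / ?w \<xi>)\<^sup>2)
      = (\<lambda>\<xi>. (?w \<xi> * (f \<xi>)\<^sup>2 - (2 * ?m) * f \<xi>) + ?m\<^sup>2 * (1 / ?w \<xi>))"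
  proof
    fix \<xi>
    have "v * (x - y / v)\<^sup>2 = (v * x\<^sup>2 - (2 * y) * x) + y\<^sup>2 * (1 / v)" if "0 < v" for v x y :: real
      using that by (simp add: field_simps power2_eq_square)
    then show "?w \<xi> * (f \<xi> - ?m / ?w \<xi>)\<^sup>2
        = (?w \<xi> * (f \<xi>)\<^sup>2 - (2 * ?m) * f \<xi>) + ?m\<^sup>2 * (1 / ?w \<xi>)"
      using w[of \<xi>] by blast
  qed
  also have "avs zs \<dots> \<eta> = avs zs (\<lambda>\<xi>. ?w \<xi> * (f \<xi>)\<^sup>2) \<eta> - ?m\<^sup>2"
    unfolding avs_add avs_diff avs_cmult one by (simp add: power2_eq_square)
  finally show ?thesis by simp
qed

text \<open>A constant has no variance, but its mass on the event \<open>h = 1\<close> is still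
  seen; together the two terms control the whole second moment.\<close>

lemma second_moment_le:
  assumes h: "\<And>\<xi>. h \<xi> = 0 \<or> h \<xi> = 1" and r: "0 < r"
    and eps: "avs zs (\<lambda>\<xi>. 1 - h \<xi>) \<eta> = r\<^sup>2"
  shows "(1 - r) * avs zs (\<lambda>\<xi>. (f \<xi>)\<^sup>2) \<eta> \<le> var zs f \<eta> + avs zs (\<lambda>\<xi>. h \<xi> * (f \<xi>)\<^sup>2) \<eta>"
proof -
  have "(avs zs f \<eta>)\<^sup>2 \<le> r * avs zs (\<lambda>\<xi>. (f \<xi>)\<^sup>2) \<eta> + avs zs (\<lambda>\<xi>. h \<xi> * (f \<xi>)\<^sup>2) \<eta>"
    using two_projections[OF assms] by (simp add: distrib_right avs_add avs_cmult)
  then show ?thesis by (simp add: var_def algebra_simps)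
qed

text \<open>The total variance is the averaged variance over \<open>xs\<close> plus the variance
  over \<open>ys\<close> of the \<open>xs\<close>-average. In the latter, \<open>f\<close> may be
  replaced by its fluctuation \<open>F\<close> over \<open>ys\<close>, and
  \<open>two_projections\<close> gives it the weight \<open>r + h\<close>. Total variance moves the
  part with \<open>r\<close> to the left-hand side; the part with \<open>h\<close> sees the block
  \<open>ys\<close> only when \<open>h = 1\<close>.\<close>

lemma two_block:
  assumes h: "\<And>\<xi>. h \<xi> = 0 \<or> h \<xi> = 1" and r: "0 < r"
    and eps: "\<And>\<xi>. avs xs (\<lambda>\<xi>. 1 - h \<xi>) \<xi> = r\<^sup>2"
    and indep: "\<And>z \<xi> b. z \<in> set ys \<Longrightarrow> h (\<xi>(z := b)) = h \<xi>"
  shows "(1 - r) * var (xs @ ys) f \<eta> \<le> avs ys (var xs f) \<eta> + avs xs (\<lambda>\<xi>. h \<xi> * var ys f \<xi>) \<eta>"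
proof -
  define F where "F = (\<lambda>\<xi>. f \<xi> - avs ys f \<xi>)"
  define W where "W = var ys f"
  have FW: "avs ys (\<lambda>\<xi>. (F \<xi>)\<^sup>2) = W"
  proof
    fix \<xi> show "avs ys (\<lambda>\<xi>. (F \<xi>)\<^sup>2) \<xi> = W \<xi>"
    proof -
      have eq: "(\<lambda>\<xi>. (F \<xi>)\<^sup>2)
          = (\<lambda>\<xi>. ((f \<xi>)\<^sup>2 - 2 * (avs ys f \<xi> * f \<xi>)) + (avs ys f \<xi> * avs ys f \<xi>))"
        by (auto simp: F_def fun_eq_iff power2_eq_square algebra_simps)
      have "avs ys (\<lambda>\<xi>. avs ys f \<xi> * g \<xi>) = (\<lambda>\<xi>. avs ys f \<xi> * avs ys g \<xi>)" for g
        by (rule avs_indep_mult) (rule avs_upd)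
      then show ?thesis unfolding eq avs_add avs_diff avs_cmult
        by (simp add: W_def var_def avs_idem power2_eq_square)
    qed
  qed
  have "avs ys (\<lambda>\<xi>. (avs xs F \<xi>)\<^sup>2) \<eta> \<le> avs ys (avs xs (\<lambda>\<xi>. (r + h \<xi>) * (F \<xi>)\<^sup>2)) \<eta>"
    by (rule avs_mono) (rule two_projections[OF h r eps])
  also have "\<dots> = avs xs (\<lambda>\<xi>. (r + h \<xi>) * avs ys (\<lambda>\<xi>. (F \<xi>)\<^sup>2) \<xi>) \<eta>"
    by (subst avs_commute, subst avs_indep_mult) (auto simp: indep)
  also have "\<dots> = r * avs xs W \<eta> + avs xs (\<lambda>\<xi>. h \<xi> * W \<xi>) \<eta>"
    by (simp add: FW distrib_right avs_add avs_cmult)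
  finally have 1: "avs ys (\<lambda>\<xi>. (avs xs F \<xi>)\<^sup>2) \<eta> \<le> \<dots>" .
  have 2: "avs ys (\<lambda>\<xi>. (avs xs F \<xi>)\<^sup>2) \<eta>
      = avs ys (\<lambda>\<xi>. (avs xs f \<xi>)\<^sup>2) \<eta> - (avs xs (avs ys f) \<eta>)\<^sup>2"
  proof -
    define g where "g = avs xs f"
    define G where "G = avs ys g"
    have G: "avs xs (avs ys f) = G" unfolding G_def g_def by (rule avs_commute)
    have eqF: "avs xs F = (\<lambda>\<xi>. g \<xi> - G \<xi>)" unfolding F_def avs_diff G g_def ..
    have eq: "(\<lambda>\<xi>. (avs xs F \<xi>)\<^sup>2)
          = (\<lambda>\<xi>. ((g \<xi>)\<^sup>2 - 2 * (G \<xi> * g \<xi>)) + (G \<xi> * G \<xi>))"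
      unfolding eqF by (simp add: fun_eq_iff power2_eq_square algebra_simps)
    have "avs ys (\<lambda>\<xi>. G \<xi> * k \<xi>) = (\<lambda>\<xi>. G \<xi> * avs ys k \<xi>)" for k
      unfolding G_def by (rule avs_indep_mult) (rule avs_upd)
    then show ?thesis unfolding eq avs_add avs_diff avs_cmult G
      by (simp add: g_def[symmetric] G_def[symmetric] power2_eq_square)
         (simp add: G_def avs_idem)
  qed
  have 3: "avs xs W \<eta> \<le> var (xs @ ys) f \<eta>" unfolding W_def by (rule avs_var_le)
  have 4: "avs ys (var xs f) \<eta> = avs xs (avs ys (\<lambda>\<xi>. (f \<xi>)\<^sup>2)) \<eta> - avs ys (\<lambda>\<xi>. (avs xs f \<xi>)\<^sup>2) \<eta>"
    unfolding var_def avs_diff by (simp add: avs_commute)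
  have 5: "r * avs xs W \<eta> \<le> r * var (xs @ ys) f \<eta>" using 3 r by simp
  show ?thesis
    using 1 2 4 5 unfolding var_def[of "xs @ ys"] avs_append W_def[symmetric]
    by (simp add: algebra_simps)
qed

end

subsection \<open>Spectral gap of the East chain\<close>

context bernoulli_parameter
begin

text \<open>The left end is excluded because it hosts the driving zero; with this convention
  adjacent segments concatenate.\<close>

definition seg :: "nat \<Rightarrow> nat \<Rightarrow> nat list" where
  "seg i j = [Suc i..<Suc j]"

definition east_var :: "nat \<Rightarrow> ((nat \<Rightarrow> bool) \<Rightarrow> real) \<Rightarrow> (nat \<Rightarrow> bool) \<Rightarrow> real" where
  "east_var l f \<xi> = of_bool (\<not> \<xi> (l - 1)) * var [l] f \<xi>"

definition east_form :: "nat \<Rightarrow> nat \<Rightarrow> ((nat \<Rightarrow> bool) \<Rightarrow> real) \<Rightarrow> (nat \<Rightarrow> bool) \<Rightarrow> real" where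
  "east_form i j f \<xi> = (\<Sum>l\<in>{i<..j}. avs (seg i j) (east_var l f) \<xi>)"

text \<open>The zero at \<open>i\<close> is the frozen zero that drives the East chain on \<open>{i<..j}\<close>.\<close>

definition has_gap :: "real \<Rightarrow> nat \<Rightarrow> bool" where
  "has_gap \<gamma> n \<longleftrightarrow> (\<forall>i j f \<xi>. i \<le> j \<longrightarrow> j \<le> i + n \<longrightarrow> \<not> \<xi> i \<longrightarrow>
     var (seg i j) f \<xi> \<le> \<gamma> * east_form i j f \<xi>)"

lemma set_seg [simp]: "set (seg i j) = {i<..j}"
  by (auto simp: seg_def)

lemma length_seg [simp]: "length (seg i j) = j - i"
  unfolding seg_def by (simp del: upt_Suc)

lemma distinct_seg [simp]: "distinct (seg i j)"
  by (simp add: seg_def)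

lemma seg_split: "i \<le> m \<Longrightarrow> m \<le> j \<Longrightarrow> seg i j = seg i m @ seg m j"
  using upt_add_eq_append[of "Suc i" "Suc m" "j - m"] by (simp add: seg_def)

lemma seg_same [simp]: "seg i i = []"
  by (simp add: seg_def)

lemma seg_Suc [simp]: "seg i (Suc i) = [Suc i]"
  by (simp add: seg_def)

lemma east_var_nonneg: "0 \<le> east_var l f \<xi>"
  by (simp add: east_var_def var_nonneg)

lemma east_form_nonneg: "0 \<le> east_form i j f \<xi>"
  unfolding east_form_def by (intro sum_nonneg avs_nonneg east_var_nonneg)

lemma has_gap_mono:
  assumes "has_gap \<gamma> n" "\<gamma> \<le> \<gamma>'" "n' \<le> n"
  shows "has_gap \<gamma>' n'"
  unfolding has_gap_def
proof (intro allI impI)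
  fix i j :: nat and f and \<xi> :: "nat \<Rightarrow> bool" assume *: "i \<le> j" "j \<le> i + n'" "\<not> \<xi> i"
  then have "j \<le> i + n" using assms(3) by simp
  then have "var (seg i j) f \<xi> \<le> \<gamma> * east_form i j f \<xi>"
    using assms(1) * unfolding has_gap_def by blast
  also have "\<dots> \<le> \<gamma>' * east_form i j f \<xi>"
    by (rule mult_right_mono[OF assms(2) east_form_nonneg])
  finally show "var (seg i j) f \<xi> \<le> \<gamma>' * east_form i j f \<xi>" .
qed

lemma avs_all: "distinct zs \<Longrightarrow> avs zs (\<lambda>\<xi>. of_bool (\<forall>k\<in>set zs. \<xi> k)) = (\<lambda>_. p ^ length zs)"
proof (induction zs)
  case (Cons z zs)
  have "avs (z # zs) (\<lambda>\<xi>. of_bool (\<forall>k\<in>set (z # zs). \<xi> k))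
      = av z (avs zs (\<lambda>\<xi>. of_bool (\<xi> z) * of_bool (\<forall>k\<in>set zs. \<xi> k)))"
    by (simp flip: of_bool_conj)
  also have "\<dots> = av z (\<lambda>\<xi>. of_bool (\<xi> z) * avs zs (\<lambda>\<xi>. of_bool (\<forall>k\<in>set zs. \<xi> k)) \<xi>)"
    by (subst avs_indep_mult) (use Cons.prems in \<open>auto simp: fun_upd_def\<close>)
  also have "\<dots> = (\<lambda>_. p ^ length (z # zs))"
    using Cons by (simp add: av_def fun_eq_iff)
  finally show ?case .
qed simp

lemma sqrt_p: "0 < sqrt p" "sqrt p < 1" "(sqrt p)\<^sup>2 = p"
  using p_pos p_less_1 by auto

text \<open>The strip contains no zero with probability \<open>p ^ (m - a)\<close>, written as a
  square because \<open>two_block\<close> takes its root as \<open>r\<close>.\<close>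

lemma avs_strip:
  assumes "i \<le> a" "a \<le> m"
  shows "avs (seg i m) (\<lambda>\<xi>. 1 - of_bool (\<exists>k\<in>{a<..m}. \<not> \<xi> k)) \<eta> = (sqrt p ^ (m - a))\<^sup>2"
proof -
  have "(\<lambda>\<xi>. 1 - of_bool (\<exists>k\<in>{a<..m}. \<not> \<xi> k) :: real) = (\<lambda>\<xi>. of_bool (\<forall>k\<in>set (seg a m). \<xi> k))"
    by auto
  then show ?thesis
    unfolding seg_split[OF assms] avs_append
    by (simp only: avs_all distinct_seg avs_const length_seg)
      (metis power_mult mult.commute sqrt_p(3))
qed

lemma avs_form_sub:
  assumes "i \<le> m" "m \<le> j"
  shows "avs (seg m j) (east_form i m f) \<eta> = (\<Sum>l\<in>{i<..m}. avs (seg i j) (east_var l f) \<eta>)"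
  unfolding east_form_def avs_sum seg_split[OF assms] avs_append
  by (subst avs_commute) simp

text \<open>Averaging over the right block does not touch site \<open>i\<close>, whose zero
  therefore keeps driving the left block.\<close>

lemma avs_var_left:
  assumes "has_gap \<gamma> N" "i \<le> m" "m \<le> j" "m \<le> i + N" "\<not> \<eta> i"
  shows "avs (seg m j) (var (seg i m) f) \<eta> \<le> \<gamma> * (\<Sum>l\<in>{i<..m}. avs (seg i j) (east_var l f) \<eta>)"
proof -
  have "avs (seg m j) (var (seg i m) f) \<eta> \<le> avs (seg m j) (\<lambda>\<xi>. \<gamma> * east_form i m f \<xi>) \<eta>"
  proof (rule avs_mono)
    fix \<xi> assume "\<And>k. k \<notin> set (seg m j) \<Longrightarrow> \<xi> k = \<eta> k"
    then have "\<not> \<xi> i" using assms by auto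
    then show "var (seg i m) f \<xi> \<le> \<gamma> * east_form i m f \<xi>"
      using assms unfolding has_gap_def by blast
  qed
  then show ?thesis by (simp add: avs_cmult avs_form_sub assms)
qed

lemma has_gap_1: "has_gap 1 1"
  unfolding has_gap_def
proof (intro allI impI)
  fix i j :: nat and f and \<xi> :: "nat \<Rightarrow> bool" assume *: "i \<le> j" "j \<le> i + 1" "\<not> \<xi> i"
  show "var (seg i j) f \<xi> \<le> 1 * east_form i j f \<xi>"
  proof (cases "j = i")
    case False
    then have j: "j = Suc i" using * by auto
    have "avs [Suc i] (east_var (Suc i) f) = east_var (Suc i) f"
      by (rule avs_indep) (simp add: east_var_def var_upd)
    moreover have "{i<..Suc i} = {Suc i}" by auto
    ultimately show ?thesis using * by (simp add: east_form_def j east_var_def)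
  qed (simp add: var_def east_form_nonneg)
qed

text \<open>The last site forms a block of its own, free to move when its left neighbour is zero. A
  factor is lost for each added site, so this only provides a finite starting value for the doubling
  argument.\<close>

lemma has_gap_Suc:
  assumes "has_gap \<gamma> n" "1 \<le> \<gamma>" "0 < n"
  shows "has_gap (\<gamma> / (1 - sqrt p)) (Suc n)"
  unfolding has_gap_def
proof (intro allI impI)
  fix i j :: nat and f and \<eta> :: "nat \<Rightarrow> bool" assume *: "i \<le> j" "j \<le> i + Suc n" "\<not> \<eta> i"
  have g: "\<gamma> \<le> \<gamma> / (1 - sqrt p)" using assms(2) sqrt_p by (simp add: field_simps)
  show "var (seg i j) f \<eta> \<le> \<gamma> / (1 - sqrt p) * east_form i j f \<eta>"
  proof (cases "j \<le> i + n")
    case True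
    then show ?thesis using has_gap_mono[OF assms(1) g order_refl] * unfolding has_gap_def by blast
  next
    case False
    define m where "m = i + n"
    have j: "j = Suc m" and m: "i \<le> m - 1" "m - 1 \<le> m" "i \<le> m" "m \<le> j" "m - (m - 1) = 1"
      using False * assms(3) by (auto simp: m_def)
    let ?h = "\<lambda>\<xi>. of_bool (\<exists>k\<in>{m - 1<..m}. \<not> \<xi> k) :: real"
    have h: "?h \<xi> = of_bool (\<not> \<xi> m)" for \<xi>
    proof -
      have "{m - 1<..m} = {m}" using m assms(3) m_def by auto
      then show ?thesis by simp
    qed
    have "(1 - sqrt p) * var (seg i m @ seg m j) f \<eta>
        \<le> avs (seg m j) (var (seg i m) f) \<eta> + avs (seg i m) (\<lambda>\<xi>. ?h \<xi> * var (seg m j) f \<xi>) \<eta>"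
    proof (rule two_block)
      show "avs (seg i m) (\<lambda>\<xi>. 1 - ?h \<xi>) \<xi> = (sqrt p)\<^sup>2" for \<xi>
        using avs_strip[OF m(1,2), of \<xi>] m(5) by simp
    qed (use sqrt_p in \<open>auto simp: fun_upd_def\<close>)
    also have "avs (seg i m) (\<lambda>\<xi>. ?h \<xi> * var (seg m j) f \<xi>) \<eta> = avs (seg i j) (east_var j f) \<eta>"
    proof -
      have "avs (seg m j) (east_var j f) = east_var j f"
        by (rule avs_indep) (auto simp: j east_var_def var_upd)
      then show ?thesis unfolding seg_split[OF m(3,4)] avs_append
        by (simp only: h) (simp add: east_var_def[abs_def] j)
    qed
    also have "avs (seg m j) (var (seg i m) f) \<eta> \<le> \<gamma> * (\<Sum>l\<in>{i<..m}. avs (seg i j) (east_var l f) \<eta>)"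
      by (rule avs_var_left) (use * m assms m_def in auto)
    also have "avs (seg i j) (east_var j f) \<eta> \<le> \<gamma> * avs (seg i j) (east_var j f) \<eta>"
      using assms(2) avs_nonneg[of "east_var j f" "seg i j" \<eta>] east_var_nonneg
      by (simp add: mult_le_cancel_right1)
    also have "\<gamma> * (\<Sum>l\<in>{i<..m}. avs (seg i j) (east_var l f) \<eta>) + \<gamma> * avs (seg i j) (east_var j f) \<eta>
        = \<gamma> * east_form i j f \<eta>"
    proof -
      have "{i<..j} = insert j {i<..m}" using m j by auto
      then show ?thesis by (simp add: east_form_def j algebra_simps)
    qed
    finally show ?thesis using sqrt_p seg_split[OF m(3,4)] by (simp add: field_simps)
  qed
qed

lemma has_gap_finite: "\<exists>\<gamma>\<ge>1. has_gap \<gamma> (Suc n)"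
proof (induction n)
  case 0
  then show ?case using has_gap_1 by auto
next
  case (Suc n)
  then obtain \<gamma> where \<gamma>: "\<gamma> \<ge> 1" "has_gap \<gamma> (Suc n)" by auto
  have "1 - sqrt p \<le> \<gamma>" using \<gamma>(1) sqrt_p by linarith
  then have "1 \<le> \<gamma> / (1 - sqrt p)" using sqrt_p by (simp add: pos_le_divide_eq)
  then show ?case using has_gap_Suc[OF \<gamma>(2,1)] by blast
qed

section \<open>Bisection and doubling of the length\<close>

text \<open>
  Conditioning on the leftmost zero \<open>k\<close> of the overlap strip \<open>{a<..m}\<close> reveals no site to the right
  of \<open>k\<close>, so that \<open>k\<close> can drive the East chain on \<open>{k<..j}\<close>.
\<close>

lemma bisection:
  assumes gap: "has_gap \<gamma> N" and \<gamma>: "0 \<le> \<gamma>" and \<eta>: "\<not> \<eta> i"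
    and le: "i \<le> a" "a < m" "m \<le> j" "m \<le> i + N" "j \<le> a + N"
  shows "(1 - sqrt p ^ (m - a)) * var (seg i j) f \<eta>
    \<le> \<gamma> * (east_form i j f \<eta> + (\<Sum>l\<in>{a<..m}. avs (seg i j) (east_var l f) \<eta>))"
proof -
  let ?h = "\<lambda>\<xi>. of_bool (\<exists>k\<in>{a<..m}. \<not> \<xi> k) :: real"
  define \<zeta> :: "nat \<Rightarrow> (nat \<Rightarrow> bool) \<Rightarrow> real"
    where "\<zeta> = (\<lambda>k \<xi>. of_bool (\<not> \<xi> k \<and> (\<forall>l\<in>{a<..<k}. \<xi> l)))"
  let ?d = "\<lambda>l. avs (seg i j) (east_var l f) \<eta>"
  have im: "i \<le> m" using le by auto
  have d0: "0 \<le> avs (seg i j) (\<lambda>\<xi>. \<zeta> k \<xi> * east_var l f \<xi>) \<eta>" for k l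
    by (rule avs_nonneg) (simp add: \<zeta>_def east_var_nonneg)
  have h_le: "?h \<xi> \<le> (\<Sum>k\<in>{a<..m}. \<zeta> k \<xi>)" for \<xi>
  proof (cases "\<exists>k\<in>{a<..m}. \<not> \<xi> k")
    case True
    define k where "k = (LEAST k. k \<in> {a<..m} \<and> \<not> \<xi> k)"
    have k: "k \<in> {a<..m}" "\<not> \<xi> k"
      using True LeastI_ex[of "\<lambda>k. k \<in> {a<..m} \<and> \<not> \<xi> k"] unfolding k_def by blast+
    have "\<xi> l" if "l \<in> {a<..<k}" for l
    proof (rule ccontr)
      assume "\<not> \<xi> l"
      then have "k \<le> l" using that k unfolding k_def by (intro Least_le) auto
      then show False using that by auto
    qed
    then have "\<zeta> k \<xi> = 1" using k by (auto simp: \<zeta>_def)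
    moreover have "\<zeta> k \<xi> \<le> (\<Sum>k\<in>{a<..m}. \<zeta> k \<xi>)"
      by (rule member_le_sum) (use k in \<open>auto simp: \<zeta>_def\<close>)
    ultimately show ?thesis using True by simp
  qed (auto simp: \<zeta>_def intro!: sum_nonneg)
  have sum_le: "(\<Sum>k\<in>{a<..m}. \<zeta> k \<xi>) \<le> 1" for \<xi>
  proof (cases "\<exists>k\<in>{a<..m}. \<zeta> k \<xi> \<noteq> 0")
    case True
    then obtain k where k: "k \<in> {a<..m}" "\<zeta> k \<xi> \<noteq> 0" by blast
    have "\<zeta> l \<xi> = 0" if "l \<in> {a<..m} - {k}" for l
      using that k by (cases "l < k") (auto simp: \<zeta>_def split: if_splits)
    then have "(\<Sum>l\<in>{a<..m}. \<zeta> l \<xi>) = \<zeta> k \<xi>" using k by (simp add: sum.remove)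
    then show ?thesis by (simp add: \<zeta>_def)
  qed simp
  have right: "avs (seg i m) (\<lambda>\<xi>. \<zeta> k \<xi> * var (seg m j) f \<xi>) \<eta>
      \<le> \<gamma> * (\<Sum>l\<in>{k<..j}. avs (seg i j) (\<lambda>\<xi>. \<zeta> k \<xi> * east_var l f \<xi>) \<eta>)"
    if k: "k \<in> {a<..m}" for k
  proof -
    have ik: "i \<le> k" "k \<le> m" "k \<le> j" using k le by auto
    \<comment> \<open>\<open>\<zeta> k\<close> reads only sites up to \<open>k\<close>, so it passes
      through every average over sites to the right of \<open>k\<close>.\<close>
    have \<zeta>_pull: "avs (seg k n) (\<lambda>\<xi>. \<zeta> k \<xi> * g \<xi>) = (\<lambda>\<xi>. \<zeta> k \<xi> * avs (seg k n) g \<xi>)" for n g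
      by (rule avs_indep_mult) (auto simp: \<zeta>_def fun_upd_def)
    have "avs (seg i m) (\<lambda>\<xi>. \<zeta> k \<xi> * var (seg m j) f \<xi>) \<eta>
        = avs (seg i k) (\<lambda>\<xi>. \<zeta> k \<xi> * avs (seg k m) (var (seg m j) f) \<xi>) \<eta>"
      unfolding seg_split[OF ik(1,2)] avs_append \<zeta>_pull ..
    also have "\<dots> \<le> avs (seg i k) (\<lambda>\<xi>. \<zeta> k \<xi> * (\<gamma> * east_form k j f \<xi>)) \<eta>"
    proof (rule avs_mono)
      fix \<xi>
      \<comment> \<open>The block \<open>{m<..j}\<close> is enlarged to \<open>{k<..j}\<close>, the
        segment that the zero at \<open>k\<close> drives.\<close>
      have "avs (seg k m) (var (seg m j) f) \<xi> \<le> var (seg k j) f \<xi>"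
        unfolding seg_split[OF ik(2) le(3)] by (rule avs_var_le)
      moreover have "var (seg k j) f \<xi> \<le> \<gamma> * east_form k j f \<xi>" if "\<not> \<xi> k"
        using gap that ik le k unfolding has_gap_def by auto
      ultimately show "\<zeta> k \<xi> * avs (seg k m) (var (seg m j) f) \<xi> \<le> \<zeta> k \<xi> * (\<gamma> * east_form k j f \<xi>)"
        by (auto simp: \<zeta>_def)
    qed
    also have "\<dots> = \<gamma> * (\<Sum>l\<in>{k<..j}. avs (seg i k) (\<lambda>\<xi>. \<zeta> k \<xi> * avs (seg k j) (east_var l f) \<xi>) \<eta>)"
    proof -
      have "(\<lambda>\<xi>. \<zeta> k \<xi> * (\<gamma> * east_form k j f \<xi>))
          = (\<lambda>\<xi>. \<gamma> * (\<Sum>l\<in>{k<..j}. \<zeta> k \<xi> * avs (seg k j) (east_var l f) \<xi>))"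
        by (simp add: east_form_def sum_distrib_left fun_eq_iff mult.left_commute)
      then show ?thesis by (simp add: avs_cmult avs_sum)
    qed
    also have "\<dots> = \<gamma> * (\<Sum>l\<in>{k<..j}. avs (seg i j) (\<lambda>\<xi>. \<zeta> k \<xi> * east_var l f \<xi>) \<eta>)"
      unfolding seg_split[OF ik(1,3)] avs_append \<zeta>_pull ..
    finally show ?thesis .
  qed
  have "avs (seg i m) (\<lambda>\<xi>. ?h \<xi> * var (seg m j) f \<xi>) \<eta>
      \<le> avs (seg i m) (\<lambda>\<xi>. \<Sum>k\<in>{a<..m}. \<zeta> k \<xi> * var (seg m j) f \<xi>) \<eta>"
    by (rule avs_mono, subst sum_distrib_right[symmetric]) (intro mult_right_mono h_le var_nonneg)
  also have "\<dots> \<le> (\<Sum>k\<in>{a<..m}. \<gamma> * (\<Sum>l\<in>{k<..j}. avs (seg i j) (\<lambda>\<xi>. \<zeta> k \<xi> * east_var l f \<xi>) \<eta>))"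
    unfolding avs_sum by (intro sum_mono right)
  \<comment> \<open>The range of \<open>l\<close> is made the same for all \<open>k\<close>, so that
    the sum over \<open>k\<close> can be carried out and bounded by 1.\<close>
  also have "\<dots> \<le> (\<Sum>k\<in>{a<..m}. \<gamma> * (\<Sum>l\<in>{a<..j}. avs (seg i j) (\<lambda>\<xi>. \<zeta> k \<xi> * east_var l f \<xi>) \<eta>))"
    by (intro sum_mono mult_left_mono \<gamma> sum_mono2 d0) auto
  also have "\<dots> = \<gamma> * (\<Sum>l\<in>{a<..j}. avs (seg i j) (\<lambda>\<xi>. (\<Sum>k\<in>{a<..m}. \<zeta> k \<xi>) * east_var l f \<xi>) \<eta>)"
    unfolding sum_distrib_right avs_sum sum_distrib_left by (rule sum.swap)
  also have "\<dots> \<le> \<gamma> * (\<Sum>l\<in>{a<..j}. ?d l)"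
    by (intro mult_left_mono \<gamma> sum_mono avs_mono)
      (use sum_le east_var_nonneg in \<open>auto intro!: mult_left_le_one_le sum_nonneg simp: \<zeta>_def\<close>)
  finally have 2: "avs (seg i m) (\<lambda>\<xi>. ?h \<xi> * var (seg m j) f \<xi>) \<eta> \<le> \<gamma> * (\<Sum>l\<in>{a<..j}. ?d l)" .
  have 1: "avs (seg m j) (var (seg i m) f) \<eta> \<le> \<gamma> * (\<Sum>l\<in>{i<..m}. ?d l)"
    by (rule avs_var_left) (use gap le im \<eta> in auto)
  have "(1 - sqrt p ^ (m - a)) * var (seg i m @ seg m j) f \<eta>
      \<le> avs (seg m j) (var (seg i m) f) \<eta> + avs (seg i m) (\<lambda>\<xi>. ?h \<xi> * var (seg m j) f \<xi>) \<eta>"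
  proof (rule two_block)
    show "avs (seg i m) (\<lambda>\<xi>. 1 - ?h \<xi>) \<xi> = (sqrt p ^ (m - a))\<^sup>2" for \<xi>
      using avs_strip[of i a m \<xi>] le by simp
  qed (use sqrt_p in \<open>auto simp: fun_upd_def\<close>)
  also have "\<dots> \<le> \<gamma> * ((\<Sum>l\<in>{i<..m}. ?d l) + (\<Sum>l\<in>{a<..j}. ?d l))"
    using 1 2 by (simp add: distrib_left)
  \<comment> \<open>The energies of \<open>{i<..m}\<close> and \<open>{a<..j}\<close> count the
    strip twice.\<close>
  also have "(\<Sum>l\<in>{i<..m}. ?d l) + (\<Sum>l\<in>{a<..j}. ?d l) = east_form i j f \<eta> + (\<Sum>l\<in>{a<..m}. ?d l)"
  proof -
    have "(\<Sum>l\<in>{i<..m} \<union> {a<..j}. ?d l) + (\<Sum>l\<in>{i<..m} \<inter> {a<..j}. ?d l)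
        = (\<Sum>l\<in>{i<..m}. ?d l) + (\<Sum>l\<in>{a<..j}. ?d l)"
      by (rule sum.union_inter) auto
    moreover have "{i<..m} \<union> {a<..j} = {i<..j}" "{i<..m} \<inter> {a<..j} = {a<..m}"
      using le by auto
    ultimately show ?thesis by (simp add: east_form_def)
  qed
  finally show ?thesis by (simp add: seg_split[OF im le(3)])
qed

lemma sum_strips:
  fixes g :: "nat \<Rightarrow> real"
  shows "(\<Sum>r<s. \<Sum>k\<in>{b + l * r<..b + l * r + l}. g k) = (\<Sum>k\<in>{b<..b + l * s}. g k)"
proof (induction s)
  case (Suc s)
  have "{b<..b + l * Suc s} = {b<..b + l * s} \<union> {b + l * s<..b + l * s + l}" by auto
  then show ?case by (simp add: Suc sum.union_disjoint)
qed simp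

text \<open>Averaging over \<open>s\<close> disjoint positions of the overlap strip costs only a factor \<open>1 + 1 / s\<close>.\<close>

lemma has_gap_double:
  assumes gap: "has_gap \<gamma> N" and \<gamma>: "0 \<le> \<gamma>" and s: "0 < s" and l: "0 < l" and ls: "l * s \<le> N"
  shows "has_gap (\<gamma> * (1 + 1 / real s) / (1 - sqrt p ^ l)) (2 * N - l * s)"
  unfolding has_gap_def
proof (intro allI impI)
  fix i j :: nat and f and \<eta> :: "nat \<Rightarrow> bool" assume *: "i \<le> j" "j \<le> i + (2 * N - l * s)" "\<not> \<eta> i"
  let ?\<gamma>' = "\<gamma> * (1 + 1 / real s) / (1 - sqrt p ^ l)"
  let ?D = "east_form i j f \<eta>" and ?d = "\<lambda>l. avs (seg i j) (east_var l f) \<eta>"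
  have \<rho>: "0 < 1 - sqrt p ^ l" using sqrt_p l by (simp add: power_Suc_less_one power_less_one_iff)
  show "var (seg i j) f \<eta> \<le> ?\<gamma>' * ?D"
  proof (cases "j \<le> i + N")
    case True
    have "\<gamma> * (1 - sqrt p ^ l) \<le> \<gamma> * (1 + 1 / real s)"
      by (rule mult_left_mono[OF _ \<gamma>]) (use p_pos in \<open>simp add: add_increasing2\<close>)
    then have "\<gamma> \<le> ?\<gamma>'" using \<rho> by (simp add: pos_le_divide_eq)
    then show ?thesis
      using has_gap_mono[OF gap _ order_refl] True * unfolding has_gap_def by blast
  next
    case False
    \<comment> \<open>The leftmost point from which a segment of length \<open>N\<close> reaches
      \<open>j\<close>. The bound on \<open>j\<close> leaves \<open>b + l * s \<le> i + N\<close>,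
      room for \<open>s\<close> strips that also end within reach of \<open>i\<close>.\<close>
    define b where "b = j - N"
    have b: "i \<le> b" "j = b + N" using False by (auto simp: b_def)
    have strip: "(1 - sqrt p ^ l) * var (seg i j) f \<eta>
        \<le> \<gamma> * (?D + (\<Sum>k\<in>{b + l * r<..b + l * r + l}. ?d k))" if "r < s" for r
    proof -
      have "l * Suc r \<le> l * s" using that by (intro mult_le_mono2) simp
      then have "l * r + l \<le> l * s" by simp
      then show ?thesis
        using bisection[of \<gamma> N \<eta> i "b + l * r" "b + l * r + l" j f] gap \<gamma> l b * False ls by simp
    qed
    have "real s * ((1 - sqrt p ^ l) * var (seg i j) f \<eta>) = (\<Sum>r<s. (1 - sqrt p ^ l) * var (seg i j) f \<eta>)"
      by simp
    also have "\<dots> \<le> (\<Sum>r<s. \<gamma> * (?D + (\<Sum>k\<in>{b + l * r<..b + l * r + l}. ?d k)))"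
      by (intro sum_mono strip) auto
    also have "\<dots> = \<gamma> * (real s * ?D + (\<Sum>k\<in>{b<..b + l * s}. ?d k))"
      by (simp add: sum.distrib sum_strips flip: sum_distrib_left)
    also have "\<dots> \<le> \<gamma> * (real s * ?D + ?D)"
      unfolding east_form_def
      by (intro mult_left_mono \<gamma> add_left_mono sum_mono2 avs_nonneg east_var_nonneg)
        (use b ls in auto)
    finally have "(1 - sqrt p ^ l) * var (seg i j) f \<eta> \<le> \<gamma> * (1 + 1 / real s) * ?D"
      using s by (simp add: field_simps)
    then show ?thesis using \<rho> by (simp add: field_simps)
  qed
qed

text \<open>At length \<open>n ^ 4\<close>, use \<open>n\<^sup>2\<close> strips of length
  \<open>n\<close>. The new length \<open>2 * n ^ 4 - n ^ 3\<close> is at least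
  \<open>(n + 1) ^ 4\<close>, and the loss \<open>(1 + 1 / n\<^sup>2) / (1 - sqrt p ^ n)\<close> is
  so close to 1 that the product over all scales converges.\<close>

theorem east_gap: "\<exists>\<gamma>\<ge>1. \<forall>n. has_gap \<gamma> n"
proof -
  define \<rho> where "\<rho> = sqrt p"
  have \<rho>: "0 < \<rho>" "\<rho> < 1" using sqrt_p by (auto simp: \<rho>_def)
  \<comment> \<open>\<open>b k\<close> bounds the logarithm of the loss at scale
    \<open>n = k + 7\<close>, by \<open>1 + x \<le> exp x\<close>. The shift is 7 because this is
    the least positive \<open>n\<close> with
    \<open>(n + 1) ^ 4 + n ^ 3 \<le> 2 * n ^ 4\<close>.\<close>
  define b where "b = (\<lambda>k. 1 / real ((k + 7)\<^sup>2) + \<rho> ^ (k + 7) / (1 - \<rho>))"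
  have b0: "0 \<le> b k" for k using \<rho> by (simp add: b_def)
  have sb: "summable b"
    unfolding b_def
  proof (intro summable_add summable_divide)
    show "summable (\<lambda>k. 1 / real ((k + 7)\<^sup>2))"
      using summable_ignore_initial_segment[OF inverse_power_summable[of 2, where ?'a = real], of 7]
      by (simp add: inverse_eq_divide)
    show "summable (\<lambda>k. \<rho> ^ (k + 7))"
      by (rule summable_ignore_initial_segment) (use \<rho> in \<open>simp add: summable_geometric\<close>)
  qed
  obtain \<gamma>0 where \<gamma>0: "\<gamma>0 \<ge> 1" "has_gap \<gamma>0 (7 ^ 4)"
    using has_gap_finite[of "7 ^ 4 - 1"] by auto
  have step: "has_gap (\<gamma>0 * exp (\<Sum>j<k. b j)) ((k + 7) ^ 4)" for k
  proof (induction k)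
    case 0
    then show ?case using \<gamma>0 by simp
  next
    case (Suc k)
    let ?G = "\<gamma>0 * exp (\<Sum>j<k. b j)"
    define n where "n = k + 7"
    have n: "7 \<le> n" by (simp add: n_def)
    have "n * n\<^sup>2 \<le> n ^ 4" using n by (simp add: power_eq_if)
    then have "has_gap (?G * (1 + 1 / real (n\<^sup>2)) / (1 - sqrt p ^ n)) (2 * n ^ 4 - n * n\<^sup>2)"
      using has_gap_double[OF Suc, of "n\<^sup>2" n] \<gamma>0(1) n by (simp add: n_def)
    moreover have "?G * (1 + 1 / real (n\<^sup>2)) / (1 - sqrt p ^ n) \<le> \<gamma>0 * exp (\<Sum>j<Suc k. b j)"
    proof -
      have pw: "\<rho> ^ n \<le> \<rho>" using \<rho> n power_decreasing[of 1 n \<rho>] by simp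
      have "1 / (1 - \<rho> ^ n) = 1 + \<rho> ^ n / (1 - \<rho> ^ n)" using pw \<rho> by (simp add: field_simps)
      also have "\<dots> \<le> 1 + \<rho> ^ n / (1 - \<rho>)"
        using pw \<rho> by (intro add_left_mono divide_left_mono mult_pos_pos) auto
      also have "\<dots> \<le> exp (\<rho> ^ n / (1 - \<rho>))" by (rule exp_ge_add_one_self)
      finally have "(1 + 1 / real (n\<^sup>2)) * (1 / (1 - \<rho> ^ n)) \<le> exp (1 / real (n\<^sup>2)) * exp (\<rho> ^ n / (1 - \<rho>))"
        using pw \<rho> by (intro mult_mono exp_ge_add_one_self) auto
      also have "\<dots> = exp (b k)" by (simp add: b_def n_def exp_add)
      finally have "?G * ((1 + 1 / real (n\<^sup>2)) * (1 / (1 - \<rho> ^ n))) \<le> ?G * exp (b k)"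
        using \<gamma>0(1) by (intro mult_left_mono) auto
      then show ?thesis by (simp add: \<rho>_def exp_add mult.assoc)
    qed
    moreover have "(Suc k + 7) ^ 4 \<le> 2 * n ^ 4 - n * n\<^sup>2"
    proof -
      have "Suc n ^ 4 + n * n\<^sup>2 = n ^ 4 + (5 * n ^ 3 + 6 * n\<^sup>2 + 4 * n + 1)"
        by (simp add: power_eq_if algebra_simps)
      also have "5 * n ^ 3 + 6 * n\<^sup>2 + 4 * n + 1 \<le> n ^ 4"
      proof -
        have "6 * n\<^sup>2 + 4 * n + 1 \<le> 7 * n\<^sup>2"
        proof -
          have "4 * n + 1 \<le> 7 * n" using n by simp
          also have "\<dots> \<le> n * n" using n by simp
          finally show ?thesis by (simp add: power2_eq_square)
        qed
        also have "7 * n\<^sup>2 \<le> n ^ 3" using n by (simp add: power_eq_if)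
        finally have "5 * n ^ 3 + 6 * n\<^sup>2 + 4 * n + 1 \<le> 7 * n ^ 3" by simp
        also have "\<dots> \<le> n ^ 4" using n by (simp add: power_eq_if)
        finally show ?thesis .
      qed
      finally have "Suc n ^ 4 + n * n\<^sup>2 \<le> 2 * n ^ 4" by simp
      then show ?thesis by (simp add: n_def)
    qed
    ultimately show ?case by (rule has_gap_mono)
  qed
  have "has_gap (\<gamma>0 * exp (suminf b)) n" for n
  proof (rule has_gap_mono[OF step[of n]])
    show "\<gamma>0 * exp (\<Sum>j<n. b j) \<le> \<gamma>0 * exp (suminf b)"
      using \<gamma>0(1) by (intro mult_left_mono) (auto intro!: sum_le_suminf sb b0)
    have "n \<le> n + 7" by simp
    also have "\<dots> \<le> (n + 7) ^ 4" by (rule self_le_power) auto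
    finally show "n \<le> (n + 7) ^ 4" .
  qed
  moreover have "1 \<le> \<gamma>0 * exp (suminf b)"
  proof -
    have "1 * 1 \<le> \<gamma>0 * exp (suminf b)"
      by (rule mult_mono) (use \<gamma>0 b0 sb in \<open>auto intro!: suminf_nonneg\<close>)
    then show ?thesis by simp
  qed
  ultimately show ?thesis by blast
qed

end

subsection \<open>Dissipation along a line\<close>

text \<open>Half the killing rate gained at the base of a line from killing at rate
  \<open>\<theta>\<close> at its endpoint: \<open>1 / \<gamma>\<close> pays for the variance along
  the line, \<open>\<theta>\<close> for the event that the endpoint is zero, and
  \<open>1 - sqrt p\<close> comes from \<open>second_moment_le\<close>.\<close>

definition (in bernoulli_parameter) line_rate :: "real \<Rightarrow> real \<Rightarrow> real" where
  "line_rate \<gamma> \<theta> = (1 - sqrt p) * min (1 / \<gamma>) \<theta>"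

locale east_process = bernoulli_parameter p for p :: real +
  fixes \<Lambda> :: "('d::finite) site set" and \<sigma> :: "'d config"
  assumes finite_region: "finite \<Lambda>"
begin

definition zero_at :: "'d site \<Rightarrow> 'd config \<Rightarrow> real" where
  "zero_at y \<eta> = of_bool (\<not> glue \<Lambda> \<sigma> \<eta> y)"

definition killed_generator ::
  "real \<Rightarrow> 'd site \<Rightarrow> ('d config \<Rightarrow> real) \<Rightarrow> 'd config \<Rightarrow> real" where
  "killed_generator \<theta> y f \<eta> = generator (1 - p) \<Lambda> \<sigma> f \<eta> - \<theta> * zero_at y \<eta> * f \<eta>"

abbreviation rate :: "'d site \<Rightarrow> 'd config \<Rightarrow> real" where
  "rate \<equiv> constraint \<Lambda> \<sigma>"

definition indep_of :: "'d site set \<Rightarrow> ('d config \<Rightarrow> real) \<Rightarrow> bool" where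
  "indep_of S f \<longleftrightarrow> (\<forall>z\<in>S. \<forall>\<eta> b. f (\<eta>(z := b)) = f \<eta>)"

lemma indep_ofD: "indep_of S f \<Longrightarrow> z \<in> S \<Longrightarrow> f (\<eta>(z := b)) = f \<eta>"
  unfolding indep_of_def by blast

lemma indep_of_av: "indep_of S f \<Longrightarrow> z \<in> S \<Longrightarrow> av z f = f"
  by (rule av_indep) (rule indep_ofD)

lemma rate_bounds: "0 \<le> rate x \<eta>" "rate x \<eta> \<le> 1"
  by (simp_all add: constraint_def)

lemma zero_at_bounds: "0 \<le> zero_at x \<eta>" "zero_at x \<eta> \<le> 1"
  by (simp_all add: zero_at_def)

text \<open>Flipping at rate \<open>q\<close> from 1 and at rate \<open>p\<close> from 0 is
  resampling the spin at rate 1. This heat-bath form is the one used in all later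
  computations.\<close>

lemma generator_av:
  "generator (1 - p) \<Lambda> \<sigma> f \<eta> = (\<Sum>x\<in>\<Lambda>. rate x \<eta> * (av x f \<eta> - f \<eta>))"
  unfolding generator_def
proof (rule sum.cong[OF refl])
  fix x
  have "(of_bool (\<eta> x) * (1 - p) + (1 - of_bool (\<eta> x)) * (1 - (1 - p))) * (f (flip \<eta> x) - f \<eta>)
      = av x f \<eta> - f \<eta>"
  proof (cases "\<eta> x")
    case True
    then have "\<eta>(x := True) = \<eta>" "flip \<eta> x = \<eta>(x := False)"
      by (simp_all add: flip_def fun_upd_idem)
    then show ?thesis using True by (simp add: av_def algebra_simps)
  next
    case False
    then have "\<eta>(x := False) = \<eta>" "flip \<eta> x = \<eta>(x := True)"
      by (simp_all add: flip_def fun_upd_idem)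
    then show ?thesis using False by (simp add: av_def algebra_simps)
  qed
  then show "rate x \<eta> * (of_bool (\<eta> x) * (1 - p) + (1 - of_bool (\<eta> x)) * (1 - (1 - p)))
      * (f (flip \<eta> x) - f \<eta>) = rate x \<eta> * (av x f \<eta> - f \<eta>)"
    by (simp add: mult.assoc)
qed

lemma glue_upd: "z \<noteq> y \<Longrightarrow> glue \<Lambda> \<sigma> (\<eta>(z := b)) y = glue \<Lambda> \<sigma> \<eta> y"
  by (simp add: glue_def)

lemma rate_upd:
  assumes "\<And>e. e \<in> canonical_basis \<Longrightarrow> x - e \<noteq> z"
  shows "rate x (\<eta>(z := b)) = rate x \<eta>"
proof -
  have "glue \<Lambda> \<sigma> (\<eta>(z := b)) (x - e) = glue \<Lambda> \<sigma> \<eta> (x - e)" if "e \<in> canonical_basis" for e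
    by (rule glue_upd) (use assms that in metis)
  then have "(\<exists>e\<in>canonical_basis. \<not> glue \<Lambda> \<sigma> (\<eta>(z := b)) (x - e))
      \<longleftrightarrow> (\<exists>e\<in>canonical_basis. \<not> glue \<Lambda> \<sigma> \<eta> (x - e))" by blast
  then show ?thesis unfolding constraint_def by (simp only:)
qed

lemma canonical_basis_not_0: "e \<in> canonical_basis \<Longrightarrow> e \<noteq> (0 :: 'd site)"
  by (auto simp: canonical_basis_def axis_eq_0_iff)

lemma rate_upd_self: "rate x (\<eta>(x := b)) = rate x \<eta>"
  by (rule rate_upd) (use canonical_basis_not_0 in auto)

text \<open>The left side is \<open>(av w f)\<^sup>2 - f\<^sup>2\<close> minus the square of
  \<open>av w f - f\<close>, and Jensen's inequality bounds \<open>(av w f)\<^sup>2\<close>.\<close>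

lemma av_carre_du_champ: "2 * f \<eta> * (av w f \<eta> - f \<eta>) \<le> av w (\<lambda>\<xi>. (f \<xi>)\<^sup>2) \<eta> - (f \<eta>)\<^sup>2"
proof -
  have "(av w f \<eta>)\<^sup>2 \<le> av w (\<lambda>\<xi>. (f \<xi>)\<^sup>2) \<eta>" using avs_square_le[of "[w]" f \<eta>] by simp
  moreover have "0 \<le> (av w f \<eta> - f \<eta>)\<^sup>2" by simp
  ultimately show ?thesis by (simp add: power2_eq_square algebra_simps)
qed

text \<open>Transports averages from the chain indexed by natural numbers to lattice sites, through
  an embedding \<open>E\<close> of configurations.\<close>

lemma avs_map_emb:
  assumes "\<And>k \<xi> b. k \<in> set ks \<Longrightarrow> E (\<xi>(k := b)) = (E \<xi>)(z k := b)"
  shows "avs ks (\<lambda>\<xi>. f (E \<xi>)) = (\<lambda>\<xi>. avs (map z ks) f (E \<xi>))"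
  using assms
proof (induction ks)
  case (Cons k ks)
  then have IH: "avs ks (\<lambda>\<xi>. f (E \<xi>)) = (\<lambda>\<xi>. avs (map z ks) f (E \<xi>))" by simp
  have "E (\<xi>(k := b)) = (E \<xi>)(z k := b)" for \<xi> b by (rule Cons.prems) simp
  then show ?case by (simp only: avs_simps list.map IH av_def)
qed simp

definition line :: "'d site \<Rightarrow> 'd \<Rightarrow> nat \<Rightarrow> 'd site" where
  "line y i k = (\<chi> j. y $ j + (if j = i then int k else 0))"

lemma line_nth: "line y i k $ j = y $ j + (if j = i then int k else 0)"
  by (simp add: line_def)

lemma line_0 [simp]: "line y i 0 = y"
  by (simp add: line_def vec_eq_iff)

lemma line_inj: "inj (line y i)"
proof (rule injI)
  fix k l assume "line y i k = line y i l"
  then have "line y i k $ i = line y i l $ i" by simp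
  then show "k = l" by (simp add: line_nth)
qed

lemma line_Suc: "line y i (Suc k) - axis i 1 = line y i k"
  by (auto simp: vec_eq_iff line_nth axis_def)

abbreviation line_sites :: "'d site \<Rightarrow> 'd \<Rightarrow> nat \<Rightarrow> 'd site list" where
  "line_sites y i n \<equiv> map (line y i) (seg 0 n)"

text \<open>A zero at the preceding site of the line already satisfies the lattice constraint, so
  the lattice rates dominate those of the East chain, and so does the Dirichlet form.\<close>

lemma line_poincare:
  assumes gap: "has_gap \<gamma> n" and \<gamma>: "0 \<le> \<gamma>" and \<eta>: "\<not> glue \<Lambda> \<sigma> \<eta> y"
    and in\<Lambda>: "\<And>k. k \<in> {0<..n} \<Longrightarrow> line y i k \<in> \<Lambda>"
  shows "var (line_sites y i n) f \<eta>
    \<le> \<gamma> * (\<Sum>w\<in>set (line_sites y i n). avs (line_sites y i n) (\<lambda>\<xi>. rate w \<xi> * var [w] f \<xi>) \<eta>)"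
proof -
  let ?z = "line y i" and ?zs = "line_sites y i n"
  \<comment> \<open>Spins on the line are taken from the chain, all others are frozen at their
    values in \<open>\<eta>\<close>.\<close>
  define E where "E = (\<lambda>\<xi> s. if s \<in> ?z ` {0<..n} then \<xi> (inv ?z s) else \<eta> s)"
  have E_upd: "E (\<xi>(k := b)) = (E \<xi>)(?z k := b)" if "k \<in> set (seg 0 n)" for k \<xi> b
    using that line_inj[of y i] by (auto simp: E_def fun_eq_iff inv_f_f dest: injD)
  have E_line: "E \<xi> (?z k) = \<xi> k" if "k \<in> {0<..n}" for \<xi> k
    using that line_inj[of y i] by (simp add: E_def inv_f_f)
  have E_y: "E \<xi> y = \<eta> y" for \<xi>
  proof -
    have "y \<notin> ?z ` {0<..n}" using injD[OF line_inj[of y i], of 0] by fastforce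
    then show ?thesis by (simp add: E_def)
  qed
  \<comment> \<open>Index 0 stands for \<open>y\<close>, which may be a boundary site; reading the
    glued configuration provides the driving zero in both cases.\<close>
  define \<xi>\<^sub>0 where "\<xi>\<^sub>0 = (\<lambda>k. glue \<Lambda> \<sigma> \<eta> (?z k))"
  have E0: "E \<xi>\<^sub>0 = \<eta>"
    using line_inj[of y i] in\<Lambda> by (auto simp: E_def \<xi>\<^sub>0_def fun_eq_iff inv_f_f glue_def)
  have \<xi>\<^sub>0: "\<not> \<xi>\<^sub>0 0" using \<eta> by (simp add: \<xi>\<^sub>0_def)
  let ?F = "\<lambda>\<xi>. f (E \<xi>)"
  have tr: "avs (seg 0 n) (\<lambda>\<xi>. g (E \<xi>)) \<xi> = avs ?zs g (E \<xi>)" for g \<xi>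
    using avs_map_emb[of "seg 0 n" E ?z g, OF E_upd] by (simp add: fun_eq_iff)
  have var_l: "var [l] ?F \<xi> = var [?z l] f (E \<xi>)" if "l \<in> {0<..n}" for l \<xi>
  proof -
    have "avs [l] (\<lambda>\<xi>. g (E \<xi>)) = (\<lambda>\<xi>. avs (map ?z [l]) g (E \<xi>))" for g
      by (rule avs_map_emb) (use E_upd that in auto)
    from fun_cong[OF this] show ?thesis unfolding var_def by simp
  qed
  have "avs (seg 0 n) (east_var l ?F) \<xi>\<^sub>0 \<le> avs ?zs (\<lambda>\<xi>. rate (?z l) \<xi> * var [?z l] f \<xi>) \<eta>"
    if l: "l \<in> {0<..n}" for l
  proof -
    have "avs (seg 0 n) (east_var l ?F) \<xi>\<^sub>0
        \<le> avs (seg 0 n) (\<lambda>\<xi>. rate (?z l) (E \<xi>) * var [?z l] f (E \<xi>)) \<xi>\<^sub>0"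
    proof (rule avs_mono)
      fix \<xi> assume "\<And>k. k \<notin> set (seg 0 n) \<Longrightarrow> \<xi> k = \<xi>\<^sub>0 k"
      then have \<xi>0: "\<not> \<xi> 0" using \<xi>\<^sub>0 by simp
      have "of_bool (\<not> \<xi> (l - 1)) \<le> rate (?z l) (E \<xi>)"
      proof (cases "\<xi> (l - 1)")
        case False
        obtain m where m: "l = Suc m" using l by (cases l) auto
        have "\<not> glue \<Lambda> \<sigma> (E \<xi>) (?z m)"
        proof (cases "m = 0")
          case True
          then show ?thesis using \<eta> E_y by (auto simp: glue_def split: if_splits)
        next
          case nz: False
          then show ?thesis using False m l in\<Lambda>[of m] E_line[of m \<xi>] by (simp add: glue_def)
        qed
        then have "\<not> glue \<Lambda> \<sigma> (E \<xi>) (?z l - axis i 1)" unfolding m line_Suc .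
        then have "rate (?z l) (E \<xi>) = 1" by (auto simp: constraint_def canonical_basis_def)
        then show ?thesis by simp
      qed (simp add: rate_bounds)
      then show "east_var l ?F \<xi> \<le> rate (?z l) (E \<xi>) * var [?z l] f (E \<xi>)"
        unfolding east_var_def var_l[OF l] by (rule mult_right_mono) (rule var_nonneg)
    qed
    then show ?thesis unfolding tr[of "\<lambda>\<xi>. rate (?z l) \<xi> * var [?z l] f \<xi>"] E0 .
  qed
  then have "east_form 0 n ?F \<xi>\<^sub>0 \<le> (\<Sum>l\<in>{0<..n}. avs ?zs (\<lambda>\<xi>. rate (?z l) \<xi> * var [?z l] f \<xi>) \<eta>)"
    unfolding east_form_def by (rule sum_mono)
  also have "\<dots> = (\<Sum>w\<in>set ?zs. avs ?zs (\<lambda>\<xi>. rate w \<xi> * var [w] f \<xi>) \<eta>)"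
    by (simp add: sum.reindex inj_on_subset[OF line_inj])
  finally have *: "east_form 0 n ?F \<xi>\<^sub>0 \<le> \<dots>" .
  have "var ?zs f \<eta> = var (seg 0 n) ?F \<xi>\<^sub>0" 
    unfolding var_def using tr[of f \<xi>\<^sub>0] tr[of "\<lambda>\<xi>. (f \<xi>)\<^sup>2" \<xi>\<^sub>0] by (simp only: E0)
  also have "\<dots> \<le> \<gamma> * east_form 0 n ?F \<xi>\<^sub>0" using gap \<xi>\<^sub>0 unfolding has_gap_def by auto
  also have "\<dots> \<le> \<gamma> * (\<Sum>w\<in>set ?zs. avs ?zs (\<lambda>\<xi>. rate w \<xi> * var [w] f \<xi>) \<eta>)"
    by (rule mult_left_mono[OF * \<gamma>])
  finally show ?thesis .
qed

definition below :: "'d site \<Rightarrow> 'd site set" where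
  "below x = {w \<in> \<Lambda>. \<forall>j. w $ j \<le> x $ j}"

text \<open>
  No site of \<open>below x\<close> off the line feels the spins on the line, hence averaging over the line
  turns the square of a solution of the killed equation into a subsolution, killed at rate
  \<open>2 * line_rate \<gamma> \<theta>\<close> whenever the base point \<open>y\<close> is in state 0.
\<close>

lemma line_inequality:
  assumes gap: "has_gap \<gamma> n" and \<gamma>: "1 \<le> \<gamma>" and \<theta>: "0 \<le> \<theta>" and n: "0 < n"
    and in\<Lambda>: "\<And>k. k \<in> {0<..n} \<Longrightarrow> line y i k \<in> \<Lambda>"
    and f: "indep_of (\<Lambda> - below (line y i n)) f"
  shows "avs (line_sites y i n) (\<lambda>\<xi>. 2 * f \<xi> * killed_generator \<theta> (line y i n) f \<xi>) \<eta>
    \<le> killed_generator (2 * line_rate \<gamma> \<theta>) y (avs (line_sites y i n) (\<lambda>\<xi>. (f \<xi>)\<^sup>2)) \<eta>"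
proof -
  let ?z = "line y i" and ?zs = "line_sites y i n" and ?x = "line y i n"
  let ?f2 = "\<lambda>\<xi>. (f \<xi>)\<^sup>2"
  let ?M = "avs ?zs ?f2"
  define T where "T = (\<lambda>w. avs ?zs (\<lambda>\<xi>. rate w \<xi> * (2 * f \<xi> * (av w f \<xi> - f \<xi>))) \<eta>)"
  define B where "B = avs ?zs (\<lambda>\<xi>. zero_at ?x \<xi> * ?f2 \<xi>) \<eta>"
  define S where "S = set ?zs"
  have S: "S = ?z ` {0<..n}" by (simp add: S_def)
  have S\<Lambda>: "S \<subseteq> \<Lambda>" using in\<Lambda> by (auto simp: S)
  have M0: "0 \<le> ?M \<eta>" by (rule avs_nonneg) simp
  have lhs: "avs ?zs (\<lambda>\<xi>. 2 * f \<xi> * killed_generator \<theta> ?x f \<xi>) \<eta> = (\<Sum>w\<in>\<Lambda>. T w) - 2 * \<theta> * B"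
  proof -
    have "(\<lambda>\<xi>. 2 * f \<xi> * killed_generator \<theta> ?x f \<xi>)
        = (\<lambda>\<xi>. (\<Sum>w\<in>\<Lambda>. rate w \<xi> * (2 * f \<xi> * (av w f \<xi> - f \<xi>))) - (2 * \<theta>) * (zero_at ?x \<xi> * ?f2 \<xi>))"
      unfolding killed_generator_def generator_av
      by (simp add: fun_eq_iff right_diff_distrib sum_distrib_left power2_eq_square mult_ac)
    then show ?thesis by (simp add: avs_diff avs_sum avs_cmult T_def B_def)
  qed
  have off: "T w \<le> rate w \<eta> * (av w ?M \<eta> - ?M \<eta>)" if w: "w \<in> \<Lambda> - S" for w
  proof (cases "w \<in> below ?x")
    case False
    have "av w f = f" using indep_of_av[OF f] w False by blast
    moreover have "av w ?M = ?M"
    proof (rule av_indep)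
      show "?M (\<xi>(w := b)) = ?M \<xi>" for \<xi> b
        by (rule avs_indep_other) (use indep_ofD[OF f] w False in simp)
    qed
    ultimately show ?thesis by (simp add: T_def)
  next
    case True
    \<comment> \<open>A step in direction \<open>i\<close> from a site of the line leads to the next
      site of the line or beyond \<open>x\<close>; a step in another direction exceeds a coordinate
      of \<open>x\<close>. So no constraint of a site of \<open>below x\<close> off the line reads
      the line.\<close>
    have far: "w - e \<noteq> v" if e: "e \<in> canonical_basis" and v: "v \<in> S" for e v
    proof
      assume eq: "w - e = v"
      obtain j where j: "e = axis j 1" using e by (auto simp: canonical_basis_def)
      obtain k where k: "k \<in> {0<..n}" "v = ?z k" using v by (auto simp: S)
      have w_eq: "w = ?z k + axis j 1" using eq k j by (simp add: algebra_simps)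
      have le: "w $ m \<le> ?x $ m" for m using True by (simp add: below_def)
      show False
      proof (cases "j = i")
        case True
        then have "w = ?z (Suc k)" using w_eq line_Suc[of y i k] by (simp add: algebra_simps)
        moreover have "Suc k \<le> n"
          using le[of i] unfolding \<open>w = ?z (Suc k)\<close> by (simp add: line_nth)
        ultimately show False using w by (auto simp: S)
      next
        case False
        then show False using le[of j] by (simp add: w_eq line_nth axis_def)
      qed
    qed
    have "T w \<le> avs ?zs (\<lambda>\<xi>. rate w \<xi> * (av w ?f2 \<xi> - ?f2 \<xi>)) \<eta>"
      unfolding T_def by (intro avs_mono mult_left_mono av_carre_du_champ rate_bounds)
    also have "\<dots> = rate w \<eta> * (av w ?M \<eta> - ?M \<eta>)"
    proof -
      have "avs ?zs (\<lambda>\<xi>. rate w \<xi> * g \<xi>) = (\<lambda>\<xi>. rate w \<xi> * avs ?zs g \<xi>)" for g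
        by (rule avs_indep_mult, rule rate_upd) (use far S_def in blast)
      then show ?thesis by (simp add: avs_diff avs_av_commute)
    qed
    finally show ?thesis .
  qed
  have on: "T w = - 2 * avs ?zs (\<lambda>\<xi>. rate w \<xi> * var [w] f \<xi>) \<eta>"
    and on_M: "av w ?M \<eta> = ?M \<eta>" if w: "w \<in> S" for w
  proof -
    have wz: "w \<in> set ?zs" using w by (simp add: S_def)
    have "av w ?M = ?M" by (rule av_indep) (rule avs_upd[OF wz])
    then show "av w ?M \<eta> = ?M \<eta>" by simp
    \<comment> \<open>The bound used off the line would give only 0 here, since \<open>?M\<close>
      does not depend on this spin. Averaging the product over \<open>w\<close> first keeps the
      dissipation.\<close>
    have "av w (\<lambda>\<xi>. rate w \<xi> * (2 * f \<xi> * (av w f \<xi> - f \<xi>)))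
        = (\<lambda>\<xi>. (- 2) * (rate w \<xi> * var [w] f \<xi>))"
    proof -
      have "av w (\<lambda>\<xi>. rate w \<xi> * g \<xi>) = (\<lambda>\<xi>. rate w \<xi> * av w g \<xi>)" for g
        by (rule av_indep_mult) (rule rate_upd_self)
      moreover have "av w (\<lambda>\<xi>. 2 * f \<xi> * (av w f \<xi> - f \<xi>)) = (\<lambda>\<xi>. (- 2) * var [w] f \<xi>)"
      proof -
        have "av w (\<lambda>\<xi>. av w f \<xi> * f \<xi>) = (\<lambda>\<xi>. av w f \<xi> * av w f \<xi>)"
          by (rule av_indep_mult) (rule av_upd)
        moreover have "(\<lambda>\<xi>. 2 * f \<xi> * (av w f \<xi> - f \<xi>))
            = (\<lambda>\<xi>. 2 * (av w f \<xi> * f \<xi>) + (- 2) * ?f2 \<xi>)"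
          by (simp add: fun_eq_iff power2_eq_square algebra_simps)
        ultimately show ?thesis
          by (simp only: av_add av_cmult) (simp add: fun_eq_iff var_def power2_eq_square)
      qed
      ultimately show ?thesis by (simp add: mult.left_commute)
    qed
    then show "T w = - 2 * avs ?zs (\<lambda>\<xi>. rate w \<xi> * var [w] f \<xi>) \<eta>"
      unfolding T_def by (subst avs_absorb[OF wz, symmetric]) (simp only: avs_cmult)
  qed
  define D where "D = (\<Sum>w\<in>S. avs ?zs (\<lambda>\<xi>. rate w \<xi> * var [w] f \<xi>) \<eta>)"
  have D0: "0 \<le> D" unfolding D_def
    by (intro sum_nonneg avs_nonneg mult_nonneg_nonneg rate_bounds var_nonneg)
  have B0: "0 \<le> B" unfolding B_def
    by (intro avs_nonneg mult_nonneg_nonneg zero_at_bounds) simp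
  \<comment> \<open>If \<open>y\<close> is in state 1 the left side vanishes. Otherwise
    \<open>line_poincare\<close> bounds the variance and \<open>second_moment_le\<close>, with
    \<open>h\<close> the indicator of a zero at the endpoint, recovers the full second
    moment.\<close>
  have coercive: "line_rate \<gamma> \<theta> * zero_at y \<eta> * ?M \<eta> \<le> D + \<theta> * B"
  proof (cases "glue \<Lambda> \<sigma> \<eta> y")
    case True
    then show ?thesis using D0 B0 \<theta> by (simp add: zero_at_def)
  next
    case False
    let ?m = "min (1 / \<gamma>) \<theta>"
    have x\<Lambda>: "?x \<in> \<Lambda>" using in\<Lambda>[of n] n by simp
    have "var ?zs f \<eta> \<le> \<gamma> * D"
      unfolding D_def S_def by (rule line_poincare[OF gap _ False in\<Lambda>]) (use \<gamma> in auto)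
    then have "1 / \<gamma> * var ?zs f \<eta> \<le> D" using \<gamma> by (simp add: field_simps)
    moreover have "?m * var ?zs f \<eta> \<le> 1 / \<gamma> * var ?zs f \<eta>"
      by (intro mult_right_mono var_nonneg) simp
    ultimately have 1: "?m * var ?zs f \<eta> \<le> D" by linarith
    have 2: "?m * B \<le> \<theta> * B" by (intro mult_right_mono B0) simp
    have "(1 - sqrt p) * ?M \<eta> \<le> var ?zs f \<eta> + B"
      unfolding B_def
    proof (rule second_moment_le)
      have "seg 0 n = seg 0 (n - 1) @ [n]" using n seg_split[of 0 "n - 1" n] seg_Suc[of "n - 1"] by simp
      then have zs: "?zs = line_sites y i (n - 1) @ [?x]" by simp
      have "avs [?x] (\<lambda>\<xi>. 1 - zero_at ?x \<xi>) = (\<lambda>_. p)"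
        using x\<Lambda> by (simp add: zero_at_def glue_def av_def fun_eq_iff)
      then show "avs ?zs (\<lambda>\<xi>. 1 - zero_at ?x \<xi>) \<eta> = (sqrt p)\<^sup>2"
        unfolding zs avs_append sqrt_p by simp
    qed (auto simp: zero_at_def sqrt_p p_pos)
    then have "?m * ((1 - sqrt p) * ?M \<eta>) \<le> ?m * (var ?zs f \<eta> + B)"
      by (rule mult_left_mono) (use \<theta> \<gamma> in simp)
    also have "\<dots> \<le> D + \<theta> * B" using 1 2 by (simp add: distrib_left)
    finally show ?thesis using False by (simp add: line_rate_def zero_at_def mult_ac)
  qed
  have "(\<Sum>w\<in>\<Lambda>. T w) = (\<Sum>w\<in>\<Lambda> - S. T w) + (\<Sum>w\<in>S. T w)"
    by (rule sum.subset_diff[OF S\<Lambda> finite_region])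
  also have "(\<Sum>w\<in>S. T w) = - 2 * D"
    unfolding D_def sum_distrib_left by (rule sum.cong[OF refl]) (rule on)
  also have "(\<Sum>w\<in>\<Lambda> - S. T w) \<le> (\<Sum>w\<in>\<Lambda> - S. rate w \<eta> * (av w ?M \<eta> - ?M \<eta>))"
    by (intro sum_mono off)
  also have "\<dots> = generator (1 - p) \<Lambda> \<sigma> ?M \<eta>"
    unfolding generator_av by (rule sum.mono_neutral_left) (use finite_region on_M in auto)
  finally show ?thesis
    unfolding lhs unfolding killed_generator_def using coercive by (simp add: algebra_simps)
qed

end

subsection \<open>Killed semigroups and the maximum principle\<close>

context east_process
begin

text \<open>Applied to the constant 1, this is the Laplace transform at \<open>\<theta>\<close> of
  the time that \<open>y\<close> spends in state 0.\<close>

definition killed_semigroup ::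
  "real \<Rightarrow> 'd site \<Rightarrow> real \<Rightarrow> ('d config \<Rightarrow> real) \<Rightarrow> 'd config \<Rightarrow> real" where
  "killed_semigroup \<theta> y t f \<eta> = (\<Sum>n. t ^ n / fact n * (killed_generator \<theta> y ^^ n) f \<eta>)"

lemma killed_generator_0: "killed_generator 0 y = generator (1 - p) \<Lambda> \<sigma>"
  by (simp add: killed_generator_def fun_eq_iff)

lemma semigroup_at_killed: "semigroup_at (1 - p) \<Lambda> \<sigma> = killed_semigroup 0 y"
  by (simp add: fun_eq_iff killed_semigroup_def semigroup_at_def killed_generator_0)

lemma configs_upd: "\<eta> \<in> configs \<Lambda> \<Longrightarrow> z \<in> \<Lambda> \<Longrightarrow> \<eta>(z := b) \<in> configs \<Lambda>"
  by (auto simp: configs_def PiE_def extensional_def)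

text \<open>The type of all configurations is infinite; suprema, series and the maximum principle
  are confined to this finite set, which is stable under resampling sites of
  \<open>\<Lambda>\<close>.\<close>

lemma finite_configs: "finite (configs \<Lambda>)"
  unfolding configs_def by (rule finite_PiE[OF finite_region]) simp

lemma av_sums:
  assumes "\<And>\<eta>. \<eta> \<in> configs \<Lambda> \<Longrightarrow> (\<lambda>n. g n \<eta>) sums G \<eta>" "\<eta> \<in> configs \<Lambda>" "z \<in> \<Lambda>"
  shows "(\<lambda>n. av z (g n) \<eta>) sums av z G \<eta>"
  unfolding av_def using assms configs_upd by (intro sums_add sums_mult) auto

lemma killed_generator_sums:
  assumes "\<And>\<eta>. \<eta> \<in> configs \<Lambda> \<Longrightarrow> (\<lambda>n. g n \<eta>) sums G \<eta>" "\<eta> \<in> configs \<Lambda>"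
  shows "(\<lambda>n. killed_generator \<theta> y (g n) \<eta>) sums killed_generator \<theta> y G \<eta>"
  unfolding killed_generator_def generator_av
  by (intro sums_diff sums_sum sums_mult av_sums[OF assms(1)] assms)

lemma killed_generator_cmult:
  "killed_generator \<theta> y (\<lambda>\<xi>. c * f \<xi>) = (\<lambda>\<eta>. c * killed_generator \<theta> y f \<eta>)"
  unfolding killed_generator_def generator_av av_cmult
  by (simp add: fun_eq_iff sum_distrib_left right_diff_distrib mult_ac)

lemma killed_generator_diff:
  "killed_generator \<theta> y (\<lambda>\<xi>. f \<xi> - g \<xi>) = (\<lambda>\<eta>. killed_generator \<theta> y f \<eta> - killed_generator \<theta> y g \<eta>)"
proof -
  have "av x (\<lambda>\<xi>. f \<xi> - g \<xi>) = (\<lambda>\<xi>. av x f \<xi> - av x g \<xi>)" for x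
    using avs_diff[of "[x]" f g] by simp
  show ?thesis
    unfolding killed_generator_def generator_av \<open>\<And>x. av x (\<lambda>\<xi>. f \<xi> - g \<xi>) = _\<close>
    by (simp add: fun_eq_iff algebra_simps sum_subtractf sum.distrib)
qed

lemma av_bound:
  fixes B :: real
  assumes "\<And>\<eta>. \<eta> \<in> configs \<Lambda> \<Longrightarrow> \<bar>f \<eta>\<bar> \<le> B" "\<eta> \<in> configs \<Lambda>" "z \<in> \<Lambda>"
  shows "\<bar>av z f \<eta>\<bar> \<le> B"
proof -
  have "\<bar>av z f \<eta>\<bar> \<le> \<bar>p * f (\<eta>(z := True))\<bar> + \<bar>(1 - p) * f (\<eta>(z := False))\<bar>"
    unfolding av_def by (rule abs_triangle_ineq)
  also have "\<dots> \<le> p * B + (1 - p) * B"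
    unfolding abs_mult using assms configs_upd p_pos p_less_1
    by (intro add_mono mult_mono) auto
  finally show ?thesis by (simp add: algebra_simps)
qed

lemma killed_generator_bound:
  fixes B :: real
  assumes f: "\<And>\<eta>. \<eta> \<in> configs \<Lambda> \<Longrightarrow> \<bar>f \<eta>\<bar> \<le> B" and \<eta>: "\<eta> \<in> configs \<Lambda>"
  shows "\<bar>killed_generator \<theta> y f \<eta>\<bar> \<le> (2 * real (card \<Lambda>) + \<bar>\<theta>\<bar>) * B"
proof -
  have B: "0 \<le> B" using f[OF \<eta>] by linarith
  have "\<bar>rate x \<eta> * (av x f \<eta> - f \<eta>)\<bar> \<le> 2 * B" if "x \<in> \<Lambda>" for x
  proof -
    have "\<bar>av x f \<eta> - f \<eta>\<bar> \<le> 2 * B" using av_bound[of f B \<eta> x] f \<eta> that by force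
    moreover have "\<bar>rate x \<eta>\<bar> \<le> 1" using rate_bounds[of x \<eta>] by linarith
    ultimately show ?thesis
      unfolding abs_mult using mult_mono[of "\<bar>rate x \<eta>\<bar>" 1 "\<bar>av x f \<eta> - f \<eta>\<bar>" "2 * B"] by simp
  qed
  then have "\<bar>generator (1 - p) \<Lambda> \<sigma> f \<eta>\<bar> \<le> (\<Sum>x\<in>\<Lambda>. 2 * B)"
    unfolding generator_av by (intro order_trans[OF sum_abs] sum_mono)
  moreover have "\<bar>\<theta> * zero_at y \<eta> * f \<eta>\<bar> \<le> \<bar>\<theta>\<bar> * 1 * B"
    unfolding abs_mult using f[OF \<eta>] zero_at_bounds[of y \<eta>] B
    by (intro mult_mono) auto
  ultimately show ?thesis
    unfolding killed_generator_def by (simp add: algebra_simps)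
qed

lemma killed_generator_pow_bound:
  fixes B :: real
  assumes "\<And>\<eta>. \<eta> \<in> configs \<Lambda> \<Longrightarrow> \<bar>f \<eta>\<bar> \<le> B" "\<eta> \<in> configs \<Lambda>"
  shows "\<bar>(killed_generator \<theta> y ^^ n) f \<eta>\<bar> \<le> (2 * real (card \<Lambda>) + \<bar>\<theta>\<bar>) ^ n * B"
  using assms(2)
proof (induction n arbitrary: \<eta>)
  case (Suc n)
  have "\<bar>killed_generator \<theta> y ((killed_generator \<theta> y ^^ n) f) \<eta>\<bar>
      \<le> (2 * real (card \<Lambda>) + \<bar>\<theta>\<bar>) * ((2 * real (card \<Lambda>) + \<bar>\<theta>\<bar>) ^ n * B)"
    by (rule killed_generator_bound[OF Suc.IH Suc.prems])
  then show ?case by (simp add: mult.assoc)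
qed (use assms(1) in simp)

lemma killed_semigroup_summable:
  assumes "\<eta> \<in> configs \<Lambda>"
  shows "summable (\<lambda>n. t ^ n / fact n * (killed_generator \<theta> y ^^ n) f \<eta>)"
proof -
  define B where "B = Max ((\<lambda>\<eta>. \<bar>f \<eta>\<bar>) ` configs \<Lambda>)"
  have B: "\<bar>f \<eta>\<bar> \<le> B" if "\<eta> \<in> configs \<Lambda>" for \<eta>
    unfolding B_def using finite_configs that by (intro Max_ge) auto
  let ?R = "2 * real (card \<Lambda>) + \<bar>\<theta>\<bar>"
  have "summable (\<lambda>n. inverse (fact n) * (\<bar>t\<bar> * ?R) ^ n * B)"
    by (intro summable_mult2 summable_exp)
  then show ?thesis
  proof (rule summable_comparison_test'[where N = 0])
    fix n
    have "norm (t ^ n / fact n * (killed_generator \<theta> y ^^ n) f \<eta>)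
        = \<bar>t\<bar> ^ n / fact n * \<bar>(killed_generator \<theta> y ^^ n) f \<eta>\<bar>"
      by (simp add: abs_mult power_abs)
    also have "\<dots> \<le> \<bar>t\<bar> ^ n / fact n * (?R ^ n * B)"
      by (rule mult_left_mono[OF killed_generator_pow_bound[OF B assms]]) simp_all
    finally show "norm (t ^ n / fact n * (killed_generator \<theta> y ^^ n) f \<eta>)
        \<le> inverse (fact n) * (\<bar>t\<bar> * ?R) ^ n * B"
      by (simp add: power_mult_distrib divide_inverse mult_ac)
  qed
qed

lemma killed_semigroup_sums:
  "\<eta> \<in> configs \<Lambda> \<Longrightarrow>
    (\<lambda>n. t ^ n / fact n * (killed_generator \<theta> y ^^ n) f \<eta>) sums killed_semigroup \<theta> y t f \<eta>"
  unfolding killed_semigroup_def by (rule summable_sums) (rule killed_semigroup_summable)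

lemma killed_semigroup_0: "killed_semigroup \<theta> y 0 f \<eta> = f \<eta>"
  unfolding killed_semigroup_def
  using powser_zero[of "\<lambda>n. (killed_generator \<theta> y ^^ n) f \<eta> / fact n"] by (simp add: mult_ac)

lemma killed_semigroup_commute:
  assumes "\<eta> \<in> configs \<Lambda>"
  shows "killed_semigroup \<theta> y t (killed_generator \<theta> y f) \<eta>
    = killed_generator \<theta> y (killed_semigroup \<theta> y t f) \<eta>"
proof -
  have "(\<lambda>n. killed_generator \<theta> y (\<lambda>\<xi>. t ^ n / fact n * (killed_generator \<theta> y ^^ n) f \<xi>) \<eta>)
      sums killed_generator \<theta> y (killed_semigroup \<theta> y t f) \<eta>"
    by (rule killed_generator_sums[OF killed_semigroup_sums assms])
  then have "(\<lambda>n. t ^ n / fact n * (killed_generator \<theta> y ^^ n) (killed_generator \<theta> y f) \<eta>)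
      sums killed_generator \<theta> y (killed_semigroup \<theta> y t f) \<eta>"
    unfolding killed_generator_cmult by (simp add: funpow_swap1)
  then show ?thesis using killed_semigroup_sums[OF assms] sums_unique2 by blast
qed

lemma killed_semigroup_deriv':
  assumes "\<eta> \<in> configs \<Lambda>"
  shows "((\<lambda>t. killed_semigroup \<theta> y t f \<eta>) has_real_derivative
    killed_semigroup \<theta> y t (killed_generator \<theta> y f) \<eta>) (at t)"
proof -
  define a where "a = (\<lambda>n. (killed_generator \<theta> y ^^ n) f \<eta> / fact n)"
  have ks: "killed_semigroup \<theta> y t f \<eta> = (\<Sum>n. a n * t ^ n)" for t
    by (simp add: killed_semigroup_def a_def mult_ac)
  have "diffs a n = (killed_generator \<theta> y ^^ n) (killed_generator \<theta> y f) \<eta> / fact n" for n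
    by (simp add: diffs_def a_def funpow_swap1 del: of_nat_Suc)
  then have ks': "killed_semigroup \<theta> y t (killed_generator \<theta> y f) \<eta> = (\<Sum>n. diffs a n * t ^ n)"
    by (simp add: killed_semigroup_def mult_ac)
  show ?thesis
    unfolding ks ks'
  proof (rule termdiffs_strong_converges_everywhere)
    show "summable (\<lambda>n. a n * s ^ n)" for s
      using killed_semigroup_summable[OF assms, of s \<theta> y f] by (simp add: a_def mult_ac)
  qed
qed

lemma killed_semigroup_deriv:
  assumes "\<eta> \<in> configs \<Lambda>"
  shows "((\<lambda>t. killed_semigroup \<theta> y t f \<eta>) has_real_derivative
    killed_generator \<theta> y (killed_semigroup \<theta> y t f) \<eta>) (at t)"
  using killed_semigroup_deriv'[OF assms] killed_semigroup_commute[OF assms] by simp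

lemma killed_semigroup_cmult:
  assumes "\<eta> \<in> configs \<Lambda>"
  shows "killed_semigroup \<theta> y t (\<lambda>\<xi>. c * f \<xi>) \<eta> = c * killed_semigroup \<theta> y t f \<eta>"
proof -
  have "(killed_generator \<theta> y ^^ n) (\<lambda>\<xi>. c * f \<xi>) = (\<lambda>\<xi>. c * (killed_generator \<theta> y ^^ n) f \<xi>)" for n
    by (induction n) (simp_all add: killed_generator_cmult)
  then have "killed_semigroup \<theta> y t (\<lambda>\<xi>. c * f \<xi>) \<eta>
      = (\<Sum>n. c * (t ^ n / fact n * (killed_generator \<theta> y ^^ n) f \<eta>))"
    by (simp add: killed_semigroup_def mult_ac)
  then show ?thesis
    by (simp only: suminf_mult[OF killed_semigroup_summable[OF assms]] killed_semigroup_def)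
qed

lemma killed_semigroup_diff:
  assumes "\<eta> \<in> configs \<Lambda>"
  shows "killed_semigroup \<theta> y t (\<lambda>\<xi>. f \<xi> - g \<xi>) \<eta>
    = killed_semigroup \<theta> y t f \<eta> - killed_semigroup \<theta> y t g \<eta>"
proof -
  have "(killed_generator \<theta> y ^^ n) (\<lambda>\<xi>. f \<xi> - g \<xi>)
      = (\<lambda>\<xi>. (killed_generator \<theta> y ^^ n) f \<xi> - (killed_generator \<theta> y ^^ n) g \<xi>)" for n
    by (induction n) (simp_all add: killed_generator_diff)
  then have "killed_semigroup \<theta> y t (\<lambda>\<xi>. f \<xi> - g \<xi>) \<eta>
      = (\<Sum>n. t ^ n / fact n * (killed_generator \<theta> y ^^ n) f \<eta>
            - t ^ n / fact n * (killed_generator \<theta> y ^^ n) g \<eta>)"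
    by (simp add: killed_semigroup_def right_diff_distrib)
  then show ?thesis
    using suminf_diff[OF killed_semigroup_summable[OF assms] killed_semigroup_summable[OF assms]]
    by (simp add: killed_semigroup_def)
qed

lemma killed_semigroup_eigen:
  assumes "killed_generator \<theta> y f = (\<lambda>\<eta>. c * f \<eta>)"
  shows "killed_semigroup \<theta> y t f \<eta> = exp (c * t) * f \<eta>"
proof -
  have "(killed_generator \<theta> y ^^ n) f = (\<lambda>\<xi>. c ^ n * f \<xi>)" for n
  proof (induction n)
    case (Suc n)
    have "killed_generator \<theta> y (\<lambda>\<xi>. c ^ n * f \<xi>) = (\<lambda>\<eta>. c ^ n * (c * f \<eta>))"
      unfolding killed_generator_cmult assms ..
    then show ?case by (simp add: Suc mult.assoc mult.left_commute)
  qed simp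
  then have "killed_semigroup \<theta> y t f \<eta> = (\<Sum>n. inverse (fact n) * (c * t) ^ n * f \<eta>)"
    by (simp add: killed_semigroup_def power_mult_distrib divide_inverse mult_ac)
  also have "\<dots> = (\<Sum>n. inverse (fact n) * (c * t) ^ n) * f \<eta>"
    by (rule suminf_mult2[symmetric]) (rule summable_exp)
  finally show ?thesis by (simp add: exp_def)
qed

lemma killed_semigroup_invariant:
  assumes "P f" "\<And>g. P g \<Longrightarrow> P (killed_generator \<theta> y g)"
  shows "P ((killed_generator \<theta> y ^^ n) f)"
  using assms by (induction n) auto

section \<open>Maximum principle and comparison\<close>

lemma generator_le_0_at_max:
  assumes "\<eta> \<in> configs \<Lambda>" "\<And>\<xi>. \<xi> \<in> configs \<Lambda> \<Longrightarrow> f \<xi> \<le> f \<eta>"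
  shows "generator (1 - p) \<Lambda> \<sigma> f \<eta> \<le> 0"
  unfolding generator_av
proof (rule sum_nonpos)
  fix x assume x: "x \<in> \<Lambda>"
  have "av x f \<eta> \<le> p * f \<eta> + (1 - p) * f \<eta>"
    unfolding av_def using assms configs_upd[OF assms(1) x] p_pos p_less_1
    by (intro add_mono mult_left_mono) auto
  then have "av x f \<eta> - f \<eta> \<le> 0" by (simp add: algebra_simps)
  then show "rate x \<eta> * (av x f \<eta> - f \<eta>) \<le> 0" by (rule mult_nonneg_nonpos[OF rate_bounds(1)])
qed

text \<open>First-time argument for \<open>u - \<epsilon> * (1 + t)\<close>. When some configuration
  first reaches the value 0, \<open>u t\<close> is maximal and nonnegative there, so that neither
  generator nor killing can increase it, and the perturbation makes the derivative strictly
  negative. Hence the value was positive shortly before, a contradiction.\<close>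

theorem maximum_principle:
  fixes u u' :: "real \<Rightarrow> 'd config \<Rightarrow> real"
  assumes \<theta>: "0 \<le> \<theta>"
    and deriv: "\<And>t \<eta>. \<eta> \<in> configs \<Lambda> \<Longrightarrow> ((\<lambda>t. u t \<eta>) has_real_derivative u' t \<eta>) (at t)"
    and sub: "\<And>t \<eta>. 0 \<le> t \<Longrightarrow> \<eta> \<in> configs \<Lambda> \<Longrightarrow> u' t \<eta> \<le> killed_generator \<theta> y (u t) \<eta>"
    and init: "\<And>\<eta>. \<eta> \<in> configs \<Lambda> \<Longrightarrow> u 0 \<eta> \<le> 0"
    and T: "0 \<le> T" and \<eta>: "\<eta> \<in> configs \<Lambda>"
  shows "u T \<eta> \<le> 0"
proof (rule ccontr)
  assume "\<not> u T \<eta> \<le> 0"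
  \<comment> \<open>Chosen so that half of \<open>u T \<eta>\<close> survives the perturbation at
    time \<open>T\<close>.\<close>
  define \<epsilon> where "\<epsilon> = u T \<eta> / (2 * (1 + T))"
  have \<epsilon>: "0 < \<epsilon>" using \<open>\<not> u T \<eta> \<le> 0\<close> T by (simp add: \<epsilon>_def)
  define w where "w = (\<lambda>t \<eta>. u t \<eta> - \<epsilon> * (1 + t))"
  have w_deriv: "((\<lambda>t. w t \<eta>) has_real_derivative u' t \<eta> - \<epsilon>) (at t)" if "\<eta> \<in> configs \<Lambda>" for t \<eta>
    unfolding w_def using deriv[OF that, of t] by (auto intro!: derivative_eq_intros)
  have w_cont: "isCont (\<lambda>t. w t \<eta>) t" if "\<eta> \<in> configs \<Lambda>" for t \<eta>
    by (rule DERIV_isCont[OF w_deriv[OF that]])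
  define Z where "Z = (\<Union>\<eta>\<in>configs \<Lambda>. {0..T} \<inter> {t. 0 \<le> w t \<eta>})"
  have "closed Z"
    unfolding Z_def
  proof (intro closed_UN ballI finite_configs closed_Int closed_atLeastAtMost)
    fix \<eta> assume "\<eta> \<in> configs \<Lambda>"
    then show "closed {t. 0 \<le> w t \<eta>}"
      by (intro closed_Collect_le continuous_on_const continuous_at_imp_continuous_on ballI w_cont)
  qed
  have "w T \<eta> = u T \<eta> / 2" using T by (simp add: w_def \<epsilon>_def field_simps)
  then have "0 \<le> w T \<eta>" using \<open>\<not> u T \<eta> \<le> 0\<close> by simp
  then have "T \<in> Z" using \<eta> T by (auto simp: Z_def)
  have "bdd_below Z" by (rule bdd_belowI[of _ 0]) (auto simp: Z_def)
  define t where "t = Inf Z"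
  have "t \<in> Z" unfolding t_def
    by (rule closed_contains_Inf) (use \<open>closed Z\<close> \<open>T \<in> Z\<close> \<open>bdd_below Z\<close> in auto)
  then obtain \<zeta> where \<zeta>: "\<zeta> \<in> configs \<Lambda>" "0 \<le> w t \<zeta>" "0 \<le> t" "t \<le> T"
    by (auto simp: Z_def)
  have before: "w s \<xi> < 0" if "0 \<le> s" "s < t" "\<xi> \<in> configs \<Lambda>" for s \<xi>
  proof (rule ccontr)
    assume "\<not> w s \<xi> < 0"
    then have "0 \<le> w s \<xi>" by simp
    then have "s \<in> Z" using that \<zeta>(4) by (auto simp: Z_def)
    then show False using that(2) cInf_lower[OF _ \<open>bdd_below Z\<close>, of s] by (simp add: t_def)
  qed
  have "w 0 \<zeta> < 0" using init[OF \<zeta>(1)] \<epsilon> by (simp add: w_def)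
  then have "0 < t" using \<zeta> by (cases "t = 0") auto
  \<comment> \<open>All values are negative before \<open>t\<close>, so by continuity none is
    positive at \<open>t\<close>, and \<open>\<zeta>\<close> is a maximum.\<close>
  have w_le: "w t \<xi> \<le> 0" if \<xi>: "\<xi> \<in> configs \<Lambda>" for \<xi>
  proof (rule ccontr)
    assume "\<not> w t \<xi> \<le> 0"
    then have "0 < w t \<xi>" by simp
    have "\<forall>\<^sub>F s in at_left t. 0 < w s \<xi>"
    proof (rule order_tendstoD)
      show "((\<lambda>s. w s \<xi>) \<longlongrightarrow> w t \<xi>) (at_left t)"
        using w_cont[OF \<xi>, of t] by (simp add: isCont_def filterlim_at_split)
    qed fact
    moreover have "\<forall>\<^sub>F s in at_left t. s \<in> {0<..<t}"
      by (rule eventually_at_left_real) fact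
    ultimately have "\<forall>\<^sub>F s in at_left t. False"
      by eventually_elim (use before[OF _ _ \<xi>] in \<open>auto simp: less_le_not_le\<close>)
    then show False by simp
  qed
  have "u t \<xi> \<le> u t \<zeta>" if "\<xi> \<in> configs \<Lambda>" for \<xi>
    using w_le[OF that] \<zeta>(2) by (simp add: w_def)
  then have "generator (1 - p) \<Lambda> \<sigma> (u t) \<zeta> \<le> 0"
    by (rule generator_le_0_at_max[OF \<zeta>(1)])
  moreover have "0 \<le> u t \<zeta>"
  proof -
    have "0 \<le> \<epsilon> * (1 + t)" using \<epsilon> \<zeta>(3) by simp
    then show ?thesis using \<zeta>(2) by (simp add: w_def)
  qed
  then have "0 \<le> \<theta> * zero_at y \<zeta> * u t \<zeta>" using \<theta> zero_at_bounds by simp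
  ultimately have "u' t \<zeta> - \<epsilon> < 0"
    using sub[OF \<zeta>(3,1)] \<epsilon> by (simp add: killed_generator_def)
  from DERIV_neg_dec_left[OF w_deriv[OF \<zeta>(1)] this]
  obtain d where d: "0 < d" "\<And>h. 0 < h \<Longrightarrow> h < d \<Longrightarrow> w t \<zeta> < w (t - h) \<zeta>" by blast
  define h where "h = min (d / 2) (t / 2)"
  have "0 < h" "h < d" "h < t" using d \<open>0 < t\<close> by (auto simp: h_def)
  then show False using d(2)[of h] before[of "t - h" \<zeta>] \<zeta> by auto
qed

lemma subsolution_le:
  assumes \<theta>: "0 \<le> \<theta>"
    and deriv: "\<And>t \<eta>. \<eta> \<in> configs \<Lambda> \<Longrightarrow> ((\<lambda>t. u t \<eta>) has_real_derivative u' t \<eta>) (at t)"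
    and sub: "\<And>t \<eta>. 0 \<le> t \<Longrightarrow> \<eta> \<in> configs \<Lambda> \<Longrightarrow> u' t \<eta> \<le> killed_generator \<theta> y (u t) \<eta>"
    and init: "\<And>\<eta>. \<eta> \<in> configs \<Lambda> \<Longrightarrow> u 0 \<eta> \<le> f \<eta>"
    and "0 \<le> t" "\<eta> \<in> configs \<Lambda>"
  shows "u t \<eta> \<le> killed_semigroup \<theta> y t f \<eta>"
proof -
  have "u t \<eta> - killed_semigroup \<theta> y t f \<eta> \<le> 0"
  proof (rule maximum_principle[of \<theta>
        "\<lambda>t \<eta>. u t \<eta> - killed_semigroup \<theta> y t f \<eta>"
        "\<lambda>t \<eta>. u' t \<eta> - killed_generator \<theta> y (killed_semigroup \<theta> y t f) \<eta>" y])
    fix t :: real and \<eta> assume \<eta>: "\<eta> \<in> configs \<Lambda>"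
    show "((\<lambda>t. u t \<eta> - killed_semigroup \<theta> y t f \<eta>) has_real_derivative
        u' t \<eta> - killed_generator \<theta> y (killed_semigroup \<theta> y t f) \<eta>) (at t)"
      by (intro DERIV_diff deriv killed_semigroup_deriv \<eta>)
  next
    fix t :: real and \<eta> assume "0 \<le> t" "\<eta> \<in> configs \<Lambda>"
    then show "u' t \<eta> - killed_generator \<theta> y (killed_semigroup \<theta> y t f) \<eta>
        \<le> killed_generator \<theta> y (\<lambda>\<eta>. u t \<eta> - killed_semigroup \<theta> y t f \<eta>) \<eta>"
      using sub by (simp add: killed_generator_diff)
  qed (use assms in \<open>auto simp: killed_semigroup_0\<close>)
  then show ?thesis by simp
qed

lemma killed_semigroup_mono:
  assumes "\<And>\<eta>. \<eta> \<in> configs \<Lambda> \<Longrightarrow> f \<eta> \<le> g \<eta>" "0 \<le> \<theta>" "0 \<le> t" "\<eta> \<in> configs \<Lambda>"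
  shows "killed_semigroup \<theta> y t f \<eta> \<le> killed_semigroup \<theta> y t g \<eta>"
  by (rule subsolution_le[OF assms(2) killed_semigroup_deriv order_refl])
    (use assms in \<open>auto simp: killed_semigroup_0\<close>)

lemma semigroup_const: "killed_semigroup 0 y t (\<lambda>_. c) \<eta> = c"
proof -
  have "killed_generator 0 y (\<lambda>_. c) = (\<lambda>\<eta>. 0 * c)"
    by (simp add: killed_generator_def generator_av fun_eq_iff)
  from killed_semigroup_eigen[OF this] show ?thesis by simp
qed

section \<open>Locality of the oriented dynamics\<close>

definition down_closed :: "'d site set \<Rightarrow> bool" where
  "down_closed A \<longleftrightarrow> A \<subseteq> \<Lambda> \<and> (\<forall>w\<in>A. \<forall>e\<in>canonical_basis. w - e \<in> \<Lambda> \<longrightarrow> w - e \<in> A)"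

text \<open>The constraints of sites in \<open>A\<close> read only \<open>A\<close> and sites
  outside \<open>\<Lambda>\<close>, and resampling a site of \<open>\<Lambda> - A\<close> leaves
  \<open>f\<close> unchanged. The condition on \<open>y\<close> ensures the same for the killing
  term.\<close>

lemma indep_of_killed_generator:
  assumes A: "down_closed A" and y: "y \<notin> \<Lambda> - A \<or> \<theta> = 0" and f: "indep_of (\<Lambda> - A) f"
  shows "indep_of (\<Lambda> - A) (killed_generator \<theta> y f)"
  unfolding indep_of_def
proof (intro ballI allI)
  fix z \<eta> b assume z: "z \<in> \<Lambda> - A"
  note fz = indep_ofD[OF f z]
  have "rate x (\<eta>(z := b)) * (av x f (\<eta>(z := b)) - f (\<eta>(z := b))) = rate x \<eta> * (av x f \<eta> - f \<eta>)"
    if x: "x \<in> \<Lambda>" for x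
  proof (cases "x \<in> A")
    case True
    have "rate x (\<eta>(z := b)) = rate x \<eta>"
      by (rule rate_upd) (use A True z in \<open>auto simp: down_closed_def\<close>)
    moreover have "av x f (\<eta>(z := b)) = av x f \<eta>"
      using avs_indep_other[of f z "[x]" \<eta> b] fz by simp
    ultimately show ?thesis by (simp only: fz)
  next
    case False
    then have "av x f = f" using indep_of_av[OF f] x by blast
    then show ?thesis by simp
  qed
  then have "generator (1 - p) \<Lambda> \<sigma> f (\<eta>(z := b)) = generator (1 - p) \<Lambda> \<sigma> f \<eta>"
    unfolding generator_av by (rule sum.cong[OF refl])
  moreover have "\<theta> * zero_at y (\<eta>(z := b)) = \<theta> * zero_at y \<eta>"
  proof (cases "\<theta> = 0")
    case False
    then have "z \<noteq> y" using y z by auto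
    then show ?thesis unfolding zero_at_def by (subst glue_upd) simp_all
  qed simp
  ultimately show "killed_generator \<theta> y f (\<eta>(z := b)) = killed_generator \<theta> y f \<eta>"
    unfolding killed_generator_def fz by (simp only:)
qed

lemma indep_of_killed_semigroup:
  assumes A: "down_closed A" and y: "y \<notin> \<Lambda> - A \<or> \<theta> = 0" and f: "indep_of (\<Lambda> - A) f"
  shows "indep_of (\<Lambda> - A) (killed_semigroup \<theta> y t f)"
proof -
  have "indep_of (\<Lambda> - A) ((killed_generator \<theta> y ^^ n) f)" for n
    by (rule killed_semigroup_invariant[where P = "indep_of (\<Lambda> - A)", OF f
          indep_of_killed_generator[OF A y]])
  then have "(killed_generator \<theta> y ^^ n) f (\<eta>(z := b)) = (killed_generator \<theta> y ^^ n) f \<eta>"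
    if "z \<in> \<Lambda> - A" for z \<eta> b n
    using indep_ofD that by blast
  then show ?thesis unfolding indep_of_def killed_semigroup_def by (intro ballI allI) (simp only:)
qed

lemma down_closed_below: "down_closed (below x)"
proof -
  have "(w - e) $ j \<le> x $ j"
    if "e \<in> canonical_basis" "w \<in> below x" for w e :: "'d site" and j
  proof -
    have "0 \<le> e $ j" using that(1) by (auto simp: canonical_basis_def axis_def)
    moreover have "w $ j \<le> x $ j" using that(2) by (simp add: below_def)
    ultimately show ?thesis by simp
  qed
  then show ?thesis unfolding down_closed_def by (auto simp: below_def)
qed

lemma avs_deriv:
  assumes "\<And>\<eta>. \<eta> \<in> configs \<Lambda> \<Longrightarrow> ((\<lambda>t. g t \<eta>) has_real_derivative g' \<eta>) (at t)"
    and "set zs \<subseteq> \<Lambda>" "\<eta> \<in> configs \<Lambda>"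
  shows "((\<lambda>t. avs zs (g t) \<eta>) has_real_derivative avs zs g' \<eta>) (at t)"
  using assms(2,3)
proof (induction zs arbitrary: \<eta>)
  case (Cons z zs)
  have "((\<lambda>t. avs zs (g t) (\<eta>(z := b))) has_real_derivative avs zs g' (\<eta>(z := b))) (at t)" for b
  proof (rule Cons.IH)
    show "\<eta>(z := b) \<in> configs \<Lambda>" by (rule configs_upd) (use Cons.prems in simp_all)
  qed (use Cons.prems in simp)
  then show ?case unfolding avs_simps av_def by (intro DERIV_add DERIV_cmult)
qed (use assms(1) in simp)

lemma line_step:
  assumes gap: "has_gap \<gamma> n" and \<gamma>: "1 \<le> \<gamma>" and \<theta>: "0 \<le> \<theta>" and n: "0 < n"
    and in\<Lambda>: "\<And>k. k \<in> {0<..n} \<Longrightarrow> line y i k \<in> \<Lambda>"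
    and t: "0 \<le> t" and \<eta>: "\<eta> \<in> configs \<Lambda>"
  shows "min p (1 - p) ^ n * (killed_semigroup \<theta> (line y i n) t (\<lambda>_. 1) \<eta>)\<^sup>2
    \<le> killed_semigroup (2 * line_rate \<gamma> \<theta>) y t (\<lambda>_. 1) \<eta>"
proof -
  let ?zs = "line_sites y i n" and ?x = "line y i n"
  let ?f = "\<lambda>t. killed_semigroup \<theta> ?x t (\<lambda>_. 1)"
  have x: "?x \<in> \<Lambda>" using in\<Lambda>[of n] n by simp
  have "min p (1 - p) ^ n * (?f t \<eta>)\<^sup>2 \<le> avs ?zs (\<lambda>\<xi>. (?f t \<xi>)\<^sup>2) \<eta>"
    using avs_ge_point[of "\<lambda>\<xi>. (?f t \<xi>)\<^sup>2" ?zs \<eta>] by simp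
  also have "\<dots> \<le> killed_semigroup (2 * line_rate \<gamma> \<theta>) y t (\<lambda>_. 1) \<eta>"
  proof (rule subsolution_le[where u = "\<lambda>t. avs ?zs (\<lambda>\<xi>. (?f t \<xi>)\<^sup>2)"])
    show "0 \<le> 2 * line_rate \<gamma> \<theta>"
      unfolding line_rate_def using \<gamma> \<theta> sqrt_p by (intro mult_nonneg_nonneg) auto
  next
    fix t \<eta> assume "\<eta> \<in> configs \<Lambda>"
    then show "((\<lambda>t. avs ?zs (\<lambda>\<xi>. (?f t \<xi>)\<^sup>2) \<eta>) has_real_derivative
        avs ?zs (\<lambda>\<xi>. 2 * ?f t \<xi> * killed_generator \<theta> ?x (?f t) \<xi>) \<eta>) (at t)"
    proof (intro avs_deriv)
      fix \<xi> assume "\<xi> \<in> configs \<Lambda>"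
      then show "((\<lambda>t. (?f t \<xi>)\<^sup>2) has_real_derivative
          2 * ?f t \<xi> * killed_generator \<theta> ?x (?f t) \<xi>) (at t)"
        using DERIV_power[OF killed_semigroup_deriv[of \<xi> \<theta> ?x "\<lambda>_. 1" t], of 2]
        by (simp add: mult_ac)
    qed (use in\<Lambda> in auto)
  next
    fix t \<eta>
    \<comment> \<open>The killing term reads the spin at \<open>?x\<close>, itself an element of
      \<open>below ?x\<close>.\<close>
    have "indep_of (\<Lambda> - below ?x) (?f t)"
      by (rule indep_of_killed_semigroup[OF down_closed_below])
        (use x in \<open>auto simp: below_def indep_of_def\<close>)
    then show "avs ?zs (\<lambda>\<xi>. 2 * ?f t \<xi> * killed_generator \<theta> ?x (?f t) \<xi>) \<eta>
        \<le> killed_generator (2 * line_rate \<gamma> \<theta>) y (avs ?zs (\<lambda>\<xi>. (?f t \<xi>)\<^sup>2)) \<eta>"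
      by (intro line_inequality gap \<gamma> \<theta> n in\<Lambda>)
  qed (use t \<eta> in \<open>auto simp: killed_semigroup_0\<close>)
  finally show ?thesis .
qed

text \<open>At a frozen zero the killing acts all the time at constant rate. This starts the chain
  of lines.\<close>

lemma killed_semigroup_boundary:
  assumes "y \<notin> \<Lambda>" "\<not> \<sigma> y"
  shows "killed_semigroup \<theta> y t (\<lambda>_. 1) \<eta> = exp (- \<theta> * t)"
proof -
  have "killed_generator \<theta> y (\<lambda>_. 1) = (\<lambda>\<eta>. - \<theta> * 1)"
    using assms by (simp add: killed_generator_def generator_av zero_at_def glue_def fun_eq_iff)
  from killed_semigroup_eigen[OF this] show ?thesis by simp
qed

end

subsection \<open>Distance to equilibrium\<close>

context east_process
begin

text \<open>That \<open>A - {x}\<close> is down-closed means that no constraint within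
  \<open>A\<close> reads \<open>x\<close>. Hence \<open>av x\<close> passes through all rates and
  commutes with the resampling of the other sites.\<close>

lemma av_killed_generator_0:
  assumes A: "down_closed A" "x \<in> A" "down_closed (A - {x})"
    and g: "indep_of (\<Lambda> - A) g" "av x g = (\<lambda>_. 0)"
  shows "av x (killed_generator 0 y g) = (\<lambda>_. 0)"
proof -
  have "av x (\<lambda>\<xi>. rate w \<xi> * (av w g \<xi> - g \<xi>)) = (\<lambda>_. 0)" if w: "w \<in> \<Lambda>" for w
  proof (cases "w \<in> A")
    case False
    then have "av w g = g" using indep_of_av[OF g(1)] w by blast
    then show ?thesis by simp
  next
    case True
    have "rate w (\<xi>(x := b)) = rate w \<xi>" for \<xi> b
    proof (cases "w = x")
      case False
      then have "w - e \<noteq> x" if "e \<in> canonical_basis" for e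
        using True A that unfolding down_closed_def by blast
      then show ?thesis by (rule rate_upd)
    qed (simp only: rate_upd_self)
    then have "av x (\<lambda>\<xi>. rate w \<xi> * (av w g \<xi> - g \<xi>))
        = (\<lambda>\<xi>. rate w \<xi> * av x (\<lambda>\<xi>. av w g \<xi> - g \<xi>) \<xi>)"
      by (rule av_indep_mult)
    also have "av x (\<lambda>\<xi>. av w g \<xi> - g \<xi>) = (\<lambda>\<xi>. av x (av w g) \<xi> - av x g \<xi>)"
      using avs_diff[of "[x]" "av w g" g] by simp
    also have "av x (av w g) = (\<lambda>_. 0)" by (simp add: av_commute[of x w] g(2))
    finally show ?thesis by (simp add: g(2))
  qed
  moreover have "av x (\<lambda>\<xi>. \<Sum>w\<in>\<Lambda>. h w \<xi>) = (\<lambda>\<xi>. \<Sum>w\<in>\<Lambda>. av x (h w) \<xi>)" for h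
    using avs_sum[of "[x]" h \<Lambda>] by simp
  ultimately show ?thesis unfolding killed_generator_0 generator_av[abs_def] by simp
qed

text \<open>
  A function with vanishing average over a maximal site \<open>x\<close> decays like the probability that \<open>x\<close>
  has not been updated, which is at most the killed semigroup at any neighbour \<open>x - e\<close>.
\<close>

lemma site_decay:
  assumes A: "down_closed A" "x \<in> A" "down_closed (A - {x})"
    and g: "indep_of (\<Lambda> - A) g" "av x g = (\<lambda>_. 0)" "\<And>\<eta>. \<bar>g \<eta>\<bar> \<le> 1"
    and e: "e \<in> canonical_basis" and t: "0 \<le> t" and \<eta>: "\<eta> \<in> configs \<Lambda>"
  shows "(killed_semigroup 0 z t g \<eta>)\<^sup>2 \<le> killed_semigroup 1 (x - e) t (\<lambda>_. 1) \<eta>"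
proof -
  let ?F = "\<lambda>t. killed_semigroup 0 z t g"
  have x: "x \<in> \<Lambda>" using A by (auto simp: down_closed_def)
  have "indep_of (\<Lambda> - A) ((killed_generator 0 z ^^ n) g) \<and> av x ((killed_generator 0 z ^^ n) g) = (\<lambda>_. 0)" for n
    by (rule killed_semigroup_invariant[where P = "\<lambda>g. indep_of (\<Lambda> - A) g \<and> av x g = (\<lambda>_. 0)"])
      (use g A av_killed_generator_0 indep_of_killed_generator in auto)
  then have av0: "av x (\<lambda>\<xi>. t ^ n / fact n * (killed_generator 0 z ^^ n) g \<xi>) = (\<lambda>_. 0)" for n t
    unfolding av_cmult by simp
  have avF: "av x (?F t) \<eta> = 0" if "\<eta> \<in> configs \<Lambda>" for t \<eta>
  proof -
    have "(\<lambda>n. av x (\<lambda>\<xi>. t ^ n / fact n * (killed_generator 0 z ^^ n) g \<xi>) \<eta>) sums av x (?F t) \<eta>"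
      by (rule av_sums[OF killed_semigroup_sums that x])
    then show ?thesis unfolding av0 using sums_0 sums_unique2 by blast
  qed
  show ?thesis
  proof (rule subsolution_le[where u = "\<lambda>t \<xi>. (?F t \<xi>)\<^sup>2"])
    fix t \<xi> assume "\<xi> \<in> configs \<Lambda>"
    then show "((\<lambda>t. (?F t \<xi>)\<^sup>2) has_real_derivative
        2 * ?F t \<xi> * killed_generator 0 z (?F t) \<xi>) (at t)"
      using DERIV_power[OF killed_semigroup_deriv[of \<xi> 0 z g t], of 2] by (simp add: mult_ac)
  next
    fix t \<xi> assume \<xi>: "\<xi> \<in> configs \<Lambda>"
    let ?f = "?F t" and ?f2 = "\<lambda>\<xi>. (?F t \<xi>)\<^sup>2"
    have nz: "rate w \<xi> * (2 * ?f \<xi> * (av w ?f \<xi> - ?f \<xi>)) \<le> rate w \<xi> * (av w ?f2 \<xi> - ?f2 \<xi>)" for w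
      by (intro mult_left_mono av_carre_du_champ rate_bounds)
    have "zero_at (x - e) \<xi> \<le> rate x \<xi>"
      using e by (auto simp: zero_at_def constraint_def)
    then have "zero_at (x - e) \<xi> * ?f2 \<xi> \<le> rate x \<xi> * ?f2 \<xi>" by (rule mult_right_mono) simp
    moreover have "0 \<le> rate x \<xi> * av x ?f2 \<xi>"
      using avs_nonneg[of ?f2 "[x]" \<xi>] rate_bounds by simp
    \<comment> \<open>With vanishing average, resampling \<open>x\<close> contributes
      \<open>- 2 * rate x \<xi> * ?f2 \<xi>\<close>. One half belongs to the generator applied to
      the square, the other half is the killing.\<close>
    ultimately have at_x: "rate x \<xi> * (2 * ?f \<xi> * (av x ?f \<xi> - ?f \<xi>))
        \<le> rate x \<xi> * (av x ?f2 \<xi> - ?f2 \<xi>) - zero_at (x - e) \<xi> * ?f2 \<xi>"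
      unfolding avF[OF \<xi>] by (simp add: power2_eq_square algebra_simps)
    have "2 * ?f \<xi> * killed_generator 0 z ?f \<xi>
        = (\<Sum>w\<in>\<Lambda>. rate w \<xi> * (2 * ?f \<xi> * (av w ?f \<xi> - ?f \<xi>)))"
      unfolding killed_generator_0 generator_av by (simp add: sum_distrib_left mult_ac)
    also have "\<dots> = rate x \<xi> * (2 * ?f \<xi> * (av x ?f \<xi> - ?f \<xi>))
        + (\<Sum>w\<in>\<Lambda> - {x}. rate w \<xi> * (2 * ?f \<xi> * (av w ?f \<xi> - ?f \<xi>)))"
      by (rule sum.remove[OF finite_region x])
    also have "\<dots> \<le> rate x \<xi> * (av x ?f2 \<xi> - ?f2 \<xi>) - zero_at (x - e) \<xi> * ?f2 \<xi>
        + (\<Sum>w\<in>\<Lambda> - {x}. rate w \<xi> * (av w ?f2 \<xi> - ?f2 \<xi>))"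
      by (intro add_mono at_x sum_mono nz)
    also have "\<dots> = killed_generator 1 (x - e) ?f2 \<xi>"
      unfolding killed_generator_def generator_av by (simp add: sum.remove[OF finite_region x])
    finally show "2 * ?f \<xi> * killed_generator 0 z ?f \<xi> \<le> killed_generator 1 (x - e) ?f2 \<xi>" .
  qed (use g(3) t \<eta> in \<open>auto simp: killed_semigroup_0 abs_square_le_1\<close>)
qed

text \<open>Replacing \<open>f\<close> by its average over a maximal site \<open>x\<close> of
  \<open>A\<close> keeps the equilibrium average and leaves a function of \<open>A - {x}\<close>;
  the difference averages to zero over \<open>x\<close>, so \<open>site_decay\<close> bounds its
  contribution by \<open>b\<close>.\<close>

lemma average_approximation:
  assumes b: "\<And>x. x \<in> \<Lambda> \<Longrightarrow> \<exists>e\<in>canonical_basis. killed_semigroup 1 (x - e) t (\<lambda>_. 1) \<eta> \<le> b\<^sup>2"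
    and b0: "0 \<le> b" and xs: "set xs = \<Lambda>" and t: "0 \<le> t" and \<eta>: "\<eta> \<in> configs \<Lambda>"
    and A: "down_closed A" and f: "indep_of (\<Lambda> - A) f" "\<And>\<xi>. 0 \<le> f \<xi>" "\<And>\<xi>. f \<xi> \<le> 1"
  shows "\<bar>killed_semigroup 0 z t f \<eta> - avs xs f \<eta>\<bar> \<le> real (card A) * b"
  using A f
proof (induction "card A" arbitrary: A f)
  case 0
  then have "A = {}" using finite_region by (auto simp: down_closed_def dest: finite_subset)
  then have f: "indep_of \<Lambda> f" using 0 by simp
  have "killed_generator 0 z f = (\<lambda>\<eta>. 0 * f \<eta>)"
    unfolding killed_generator_0 generator_av[abs_def]
    by (rule ext, simp, rule sum.neutral) (simp add: indep_of_av[OF f])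
  from killed_semigroup_eigen[OF this] have "killed_semigroup 0 z t f \<eta> = f \<eta>" by simp
  moreover have "avs xs f = f" by (rule avs_indep) (use indep_ofD[OF f] xs in blast)
  ultimately show ?case by (simp add: b0)
next
  case (Suc n)
  have fin: "finite A" using Suc.prems finite_region by (auto simp: down_closed_def dest: finite_subset)
  have "A \<noteq> {}" using Suc.hyps by auto
  \<comment> \<open>A site of largest coordinate sum has no successor in \<open>A\<close>, which
    keeps \<open>A - {x}\<close> down-closed.\<close>
  define height :: "'d site \<Rightarrow> int" where "height = (\<lambda>w. \<Sum>j\<in>UNIV. w $ j)"
  obtain x where x: "x \<in> A" "\<And>w. w \<in> A \<Longrightarrow> height w \<le> height x"
  proof -
    have "finite (height ` A)" "height ` A \<noteq> {}" using fin \<open>A \<noteq> {}\<close> by auto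
    then obtain x where "x \<in> A" "height x = Max (height ` A)" by (metis Max_in imageE)
    then show ?thesis using that[of x] fin by (simp add: Max_ge)
  qed
  have x\<Lambda>: "x \<in> \<Lambda>" using x Suc.prems by (auto simp: down_closed_def)
  have A': "down_closed (A - {x})"
  proof -
    have "w - e \<noteq> x" if w: "w \<in> A" and e: "e \<in> canonical_basis" for w e
    proof
      assume "w - e = x"
      then have "w = x + e" by (simp add: algebra_simps)
      moreover have "height (x + e) = height x + 1"
        using e by (auto simp: height_def canonical_basis_def axis_def sum.distrib)
      ultimately show False using x(2)[OF w] by simp
    qed
    then show ?thesis using Suc.prems(1) by (auto simp: down_closed_def)
  qed
  define f' where "f' = av x f"
  have ind': "indep_of (\<Lambda> - (A - {x})) f'"
    unfolding indep_of_def f'_def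
  proof (intro ballI allI)
    fix z \<eta> b assume z: "z \<in> \<Lambda> - (A - {x})"
    show "av x f (\<eta>(z := b)) = av x f \<eta>"
    proof (cases "z = x")
      case False
      then have "f (\<xi>(z := b)) = f \<xi>" for \<xi> b using indep_ofD[OF Suc.prems(2), of z] z by blast
      from avs_indep_other[of f z "[x]" \<eta> b, OF this] show ?thesis by simp
    qed (simp only: av_upd)
  qed
  have f'0: "0 \<le> f' \<xi>" and f'1: "f' \<xi> \<le> 1" for \<xi>
    using avs_mono[of "[x]" \<xi> "\<lambda>_. 0" f] avs_mono[of "[x]" \<xi> f "\<lambda>_. 1"] Suc.prems
    by (simp_all add: f'_def)
  have card: "card (A - {x}) = n" using Suc.hyps x fin by simp
  have IH: "\<bar>killed_semigroup 0 z t f' \<eta> - avs xs f' \<eta>\<bar> \<le> real n * b"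
    using Suc.hyps(1)[OF card[symmetric] A' ind' f'0 f'1] card by simp
  have avs': "avs xs f' = avs xs f" unfolding f'_def by (rule avs_absorb) (simp add: xs x\<Lambda>)
  let ?g = "\<lambda>\<xi>. f \<xi> - f' \<xi>"
  obtain e where e: "e \<in> canonical_basis" "killed_semigroup 1 (x - e) t (\<lambda>_. 1) \<eta> \<le> b\<^sup>2"
    using b[OF x\<Lambda>] by blast
  have "(killed_semigroup 0 z t ?g \<eta>)\<^sup>2 \<le> killed_semigroup 1 (x - e) t (\<lambda>_. 1) \<eta>"
  proof (rule site_decay[OF Suc.prems(1) x(1) A'])
    show "indep_of (\<Lambda> - A) ?g"
      unfolding indep_of_def using indep_ofD[OF Suc.prems(2)] indep_ofD[OF ind'] by simp
    show "av x ?g = (\<lambda>_. 0)"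
      using avs_diff[of "[x]" f f'] by (simp add: f'_def)
    show "\<bar>?g \<xi>\<bar> \<le> 1" for \<xi>
      using Suc.prems(3,4)[of \<xi>] f'0[of \<xi>] f'1[of \<xi>] by linarith
  qed (use e t \<eta> in auto)
  then have "(killed_semigroup 0 z t ?g \<eta>)\<^sup>2 \<le> b\<^sup>2" using e by linarith
  then have "\<bar>killed_semigroup 0 z t ?g \<eta>\<bar> \<le> b" using abs_le_square_iff[of _ b] b0 by simp
  then have "\<bar>killed_semigroup 0 z t f \<eta> - killed_semigroup 0 z t f' \<eta>\<bar> \<le> b"
    using killed_semigroup_diff[OF \<eta>] by simp
  then have "\<bar>killed_semigroup 0 z t f \<eta> - avs xs f \<eta>\<bar> \<le> real n * b + b"
    using IH unfolding avs' by linarith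
  then show ?case using Suc.hyps(2)[symmetric] by (simp add: distrib_right)
qed

end

section \<open>The reversible measure as an iterated average\<close>

context bernoulli_parameter
begin

lemma expectation_Pi_pmf:
  fixes f :: "('a \<Rightarrow> bool) \<Rightarrow> real"
  assumes "distinct xs"
  shows "measure_pmf.expectation (Pi_pmf (set xs) undefined (\<lambda>_. bernoulli_pmf p)) f
    = avs xs f (\<lambda>_. undefined)"
  using assms
proof (induction xs arbitrary: f)
  case (Cons x xs)
  let ?P = "Pi_pmf (set xs) (undefined :: bool) (\<lambda>_. bernoulli_pmf p)"
  have P: "Pi_pmf (set (x # xs)) undefined (\<lambda>_. bernoulli_pmf p)
      = bernoulli_pmf p \<bind> (\<lambda>b. map_pmf (\<lambda>\<eta>. \<eta>(x := b)) ?P)"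
    using Cons.prems by (simp add: Pi_pmf_insert' map_pmf_def)
  have fin: "finite (set_pmf ?P)"
    by (rule finite_subset[OF set_Pi_pmf_subset']) (auto intro: finite_PiE_dflt)
  have "measure_pmf.expectation (Pi_pmf (set (x # xs)) undefined (\<lambda>_. bernoulli_pmf p)) f
      = (\<Sum>b\<in>UNIV. pmf (bernoulli_pmf p) b *\<^sub>R measure_pmf.expectation (map_pmf (\<lambda>\<eta>. \<eta>(x := b)) ?P) f)"
    unfolding P by (rule pmf_expectation_bind) (use fin in auto)
  also have "\<dots> = p * avs xs (\<lambda>\<eta>. f (\<eta>(x := True))) (\<lambda>_. undefined)
      + (1 - p) * avs xs (\<lambda>\<eta>. f (\<eta>(x := False))) (\<lambda>_. undefined)"
    using Cons p_pos p_less_1 by (simp add: UNIV_bool)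
  also have "\<dots> = avs xs (av x f) (\<lambda>_. undefined)"
    unfolding av_def[abs_def] avs_add avs_cmult ..
  also have "\<dots> = avs (x # xs) f (\<lambda>_. undefined)" by (simp add: avs_av_commute)
  finally show ?case .
qed simp

lemma avs_outside:
  assumes "\<And>k. k \<notin> set xs \<Longrightarrow> \<eta> k = \<xi> k"
  shows "avs xs f \<eta> = avs xs f \<xi>"
  using assms
proof (induction xs arbitrary: \<eta> \<xi>)
  case Nil
  then have "\<eta> = \<xi>" by auto
  then show ?case by simp
next
  case (Cons x xs)
  have "avs xs f (\<eta>(x := b)) = avs xs f (\<xi>(x := b))" for b
    by (rule Cons.IH) (use Cons.prems in auto)
  then show ?case by (simp only: avs_simps av_def)
qed

end

context east_process
begin

text \<open>Averaging over all of \<open>\<Lambda>\<close> forgets the start there, and off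
  \<open>\<Lambda>\<close> members of \<open>configs \<Lambda>\<close> agree with the default value
  \<open>undefined\<close> of \<open>Pi_pmf\<close>.\<close>

lemma reversible_measure_avs:
  assumes "\<eta> \<in> configs \<Lambda>" "set xs = \<Lambda>" "distinct xs"
  shows "measure_pmf.prob (reversible_measure (1 - p) \<Lambda>) A = avs xs (indicator A) \<eta>"
proof -
  have "measure_pmf.prob (reversible_measure (1 - p) \<Lambda>) A
      = measure_pmf.expectation (reversible_measure (1 - p) \<Lambda>) (indicator A)"
    by simp
  also have "\<dots> = avs xs (indicator A) (\<lambda>_. undefined)"
    using expectation_Pi_pmf[OF assms(3), of "indicator A"]
    by (simp only: reversible_measure_def assms(2) minus_diff_eq diff_diff_eq2 add_diff_cancel_left')
  also have "\<dots> = avs xs (indicator A) \<eta>"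
    by (rule avs_outside) (use assms in \<open>auto simp: configs_def PiE_def extensional_def\<close>)
  finally show ?thesis .
qed

lemma tv_dist_le:
  assumes b: "\<And>x. x \<in> \<Lambda> \<Longrightarrow> \<exists>e\<in>canonical_basis. killed_semigroup 1 (x - e) t (\<lambda>_. 1) \<eta> \<le> b\<^sup>2"
    and b0: "0 \<le> b" and t: "0 \<le> t" and \<eta>: "\<eta> \<in> configs \<Lambda>"
  shows "tv_dist (configs \<Lambda>) (law (1 - p) \<Lambda> \<sigma> t \<eta>)
    (measure_pmf.prob (reversible_measure (1 - p) \<Lambda>)) \<le> real (card \<Lambda>) * b"
proof -
  obtain xs where xs: "set xs = \<Lambda>" "distinct xs"
    using finite_distinct_list[OF finite_region] by blast
  have "\<bar>law (1 - p) \<Lambda> \<sigma> t \<eta> A - measure_pmf.prob (reversible_measure (1 - p) \<Lambda>) A\<bar>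
      \<le> real (card \<Lambda>) * b" for A
    unfolding reversible_measure_avs[OF \<eta> xs] law_def semigroup_at_killed[of undefined]
    by (rule average_approximation[OF b b0 xs(1) t \<eta>])
      (auto simp: down_closed_def indep_of_def indicator_def)
  then show ?thesis
    unfolding tv_dist_def using finite_configs by (subst Max_le_iff) auto
qed

end

subsection \<open>Lower bounds on the distance to equilibrium\<close>

definition box_corner :: "('d::finite) site" where
  "box_corner = (\<chi> i. 1)"

lemma finite_lattice_box: "finite (lattice_box L :: ('d::finite) site set)"
  and card_lattice_box: "card (lattice_box L :: ('d::finite) site set) \<le> L ^ CARD('d)"
proof -
  let ?P = "PiE (UNIV :: 'd set) (\<lambda>_. {1..int L})"
  have sub: "(lattice_box L :: 'd site set) \<subseteq> (\<lambda>f. \<chi> i. f i) ` ?P"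
  proof
    fix x :: "'d site" assume "x \<in> lattice_box L"
    then have "(\<lambda>i. x $ i) \<in> ?P" by (auto simp: lattice_box_def)
    moreover have "x = (\<chi> i. x $ i)" by simp
    ultimately show "x \<in> (\<lambda>f. \<chi> i. f i) ` ?P" by blast
  qed
  have fin: "finite ?P" by (rule finite_PiE) auto
  show "finite (lattice_box L :: 'd site set)"
    by (rule finite_subset[OF sub]) (use fin in simp)
  have "card (lattice_box L :: 'd site set) \<le> card ((\<lambda>f. (\<chi> i. f i) :: 'd site) ` ?P)"
    by (rule card_mono[OF _ sub]) (use fin in simp)
  also have "\<dots> \<le> card ?P" by (rule card_image_le[OF fin])
  also have "\<dots> = L ^ CARD('d)" by (simp add: card_PiE)
  finally show "card (lattice_box L :: 'd site set) \<le> L ^ CARD('d)" .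
qed

lemma box_corner_mem: "1 \<le> L \<Longrightarrow> box_corner \<in> lattice_box L"
  by (simp add: box_corner_def lattice_box_def)

lemma box_corner_pred: "box_corner - axis i 1 \<notin> lattice_box L"
proof
  assume "box_corner - axis i 1 \<in> lattice_box L"
  then have "1 \<le> (box_corner - axis i 1) $ i" unfolding lattice_box_def by blast
  then show False by (simp add: box_corner_def axis_def)
qed

context east_process
begin

text \<open>The generator preserves the functions that vanish wherever the spin at \<open>x\<close>
  differs from \<open>\<xi> x\<close>, so every term of the series is zero. At the corner this turns
  ergodicity into the presence of a boundary zero.\<close>

lemma frozen_site:
  assumes x: "x \<in> \<Lambda>" and frozen: "\<And>\<eta>. rate x \<eta> = 0" and ne: "\<eta> x \<noteq> \<xi> x"
  shows "law (1 - p) \<Lambda> \<sigma> t \<eta> {\<xi>} = 0"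
proof -
  let ?P = "\<lambda>g :: 'd config \<Rightarrow> real. \<forall>\<eta>. \<eta> x \<noteq> \<xi> x \<longrightarrow> g \<eta> = 0"
  have "?P ((killed_generator 0 undefined ^^ n) (indicator {\<xi>}))" for n
  proof (rule killed_semigroup_invariant[where P = ?P])
    fix g assume g: "?P g"
    show "?P (killed_generator 0 undefined g)"
    proof (intro allI impI)
      fix \<eta> assume \<eta>: "\<eta> x \<noteq> \<xi> x"
      have "rate w \<eta> * (av w g \<eta> - g \<eta>) = 0" for w
      proof (cases "w = x")
        case False
        then have "g (\<eta>(w := b)) = 0" for b using g \<eta> by (auto simp: fun_upd_def)
        then show ?thesis using g \<eta> unfolding av_def by simp
      qed (simp add: frozen)
      then show "killed_generator 0 undefined g \<eta> = 0"
        unfolding killed_generator_0 generator_av by (intro sum.neutral ballI)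
    qed
  qed (auto simp: indicator_def)
  then show ?thesis
    using ne by (simp add: law_def semigroup_at_killed[of undefined] killed_semigroup_def)
qed

lemma tv_dist_ge:
  assumes "A \<subseteq> configs \<Lambda>"
  shows "\<bar>\<mu> A - \<nu> A\<bar> \<le> tv_dist (configs \<Lambda>) \<mu> \<nu>"
  unfolding tv_dist_def using finite_configs assms by (intro Max_ge) auto

lemma killed_semigroup_cong:
  assumes "\<And>\<eta>. \<eta> \<in> configs \<Lambda> \<Longrightarrow> f \<eta> = g \<eta>" "0 \<le> \<theta>" "0 \<le> t" "\<eta> \<in> configs \<Lambda>"
  shows "killed_semigroup \<theta> y t f \<eta> = killed_semigroup \<theta> y t g \<eta>"
  by (rule antisym; rule killed_semigroup_mono) (use assms in auto)

lemma killed_semigroup_sum: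
  assumes "\<eta> \<in> configs \<Lambda>"
  shows "killed_semigroup \<theta> y t (\<lambda>\<xi>. \<Sum>i\<in>I. f i \<xi>) \<eta> = (\<Sum>i\<in>I. killed_semigroup \<theta> y t (f i) \<eta>)"
proof -
  have zero: "killed_semigroup \<theta> y t (\<lambda>_. 0) \<eta> = 0"
    using killed_semigroup_cmult[OF assms, of \<theta> y t 0 "\<lambda>_. 0"] by simp
  have add: "killed_semigroup \<theta> y t (\<lambda>\<xi>. f \<xi> + g \<xi>) \<eta>
      = killed_semigroup \<theta> y t f \<eta> + killed_semigroup \<theta> y t g \<eta>" for f g
    using killed_semigroup_diff[OF assms, of \<theta> y t f "\<lambda>\<xi>. (- 1) * g \<xi>"]
    unfolding killed_semigroup_cmult[OF assms] by simp
  show ?thesis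
    by (induction I rule: infinite_finite_induct) (simp_all add: zero add)
qed

lemma configs_outside:
  "\<eta> \<in> configs \<Lambda> \<Longrightarrow> (\<And>k. k \<notin> \<Lambda> \<Longrightarrow> \<xi> k = \<eta> k) \<Longrightarrow> \<xi> \<in> configs \<Lambda>"
  by (auto simp: configs_def PiE_def extensional_def)

text \<open>When the constraint always holds, the centred spin at \<open>x\<close> is an
  eigenfunction of the generator with eigenvalue -1.\<close>

lemma free_site:
  assumes x: "x \<in> \<Lambda>" and free: "\<And>\<eta>. rate x \<eta> = 1" and t: "0 \<le> t"
  shows "\<exists>\<eta>\<in>configs \<Lambda>. exp (- t) / 2 \<le> tv_dist (configs \<Lambda>) (law (1 - p) \<Lambda> \<sigma> t \<eta>)
    (measure_pmf.prob (reversible_measure (1 - p) \<Lambda>))"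
proof
  \<comment> \<open>The start takes the less likely value at every site, hence the centred spin is
    at least 1/2 in absolute value.\<close>
  define \<eta> where "\<eta> = (\<lambda>y. if y \<in> \<Lambda> then p \<le> 1 / 2 else undefined)"
  show \<eta>: "\<eta> \<in> configs \<Lambda>" by (auto simp: configs_def \<eta>_def)
  let ?h = "\<lambda>\<xi> :: 'd config. of_bool (\<xi> x) :: real"
  let ?g = "\<lambda>\<xi>. ?h \<xi> - p"
  let ?A = "{\<xi> \<in> configs \<Lambda>. \<xi> x}"
  obtain xs where xs: "set xs = \<Lambda>" "distinct xs"
    using finite_distinct_list[OF finite_region] by blast
  have "killed_generator 0 undefined ?g = (\<lambda>\<xi>. (- 1) * ?g \<xi>)"
  proof
    fix \<xi>
    have "rate w \<xi> * (av w ?g \<xi> - ?g \<xi>) = 0" if "w \<in> \<Lambda> - {x}" for w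
      using that by (auto simp: av_def algebra_simps)
    then have "(\<Sum>w\<in>\<Lambda> - {x}. rate w \<xi> * (av w ?g \<xi> - ?g \<xi>)) = 0" by (rule sum.neutral[OF ballI])
    moreover have "av x ?g \<xi> = 0" by (simp add: av_def algebra_simps)
    ultimately show "killed_generator 0 undefined ?g \<xi> = (- 1) * ?g \<xi>"
      unfolding killed_generator_0 generator_av sum.remove[OF finite_region x] by (simp add: free)
  qed
  from killed_semigroup_eigen[OF this] have "killed_semigroup 0 undefined t ?g \<eta> = exp (- t) * ?g \<eta>" by simp
  then have "killed_semigroup 0 undefined t ?h \<eta> = exp (- t) * ?g \<eta> + p"
    using killed_semigroup_diff[OF \<eta>, of 0 undefined t ?h "\<lambda>_. p"] by (simp add: semigroup_const)
  moreover have "law (1 - p) \<Lambda> \<sigma> t \<eta> ?A = killed_semigroup 0 undefined t ?h \<eta>"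
    unfolding law_def semigroup_at_killed[of undefined]
    by (rule killed_semigroup_cong) (use t \<eta> in \<open>auto simp: indicator_def\<close>)
  moreover have "measure_pmf.prob (reversible_measure (1 - p) \<Lambda>) ?A = p"
  proof -
    have "avs xs (indicator ?A) \<eta> = avs xs ?h \<eta>"
      by (rule avs_cong) (use configs_outside[OF \<eta>] xs in \<open>auto simp: indicator_def\<close>)
    also have "\<dots> = avs xs (av x ?h) \<eta>" using x xs by (simp add: avs_absorb)
    also have "av x ?h = (\<lambda>_. p)" by (rule ext) (simp add: av_def)
    finally show ?thesis using reversible_measure_avs[OF \<eta> xs] by simp
  qed
  ultimately have "\<bar>law (1 - p) \<Lambda> \<sigma> t \<eta> ?A - measure_pmf.prob (reversible_measure (1 - p) \<Lambda>) ?A\<bar>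
      = exp (- t) * \<bar>?g \<eta>\<bar>" by (simp add: abs_mult)
  moreover have "exp (- t) * (1 / 2) \<le> exp (- t) * \<bar>?g \<eta>\<bar>"
    by (rule mult_left_mono) (use x in \<open>auto simp: \<eta>_def\<close>)
  moreover have "?A \<subseteq> configs \<Lambda>" by blast
  ultimately show "exp (- t) / 2 \<le> tv_dist (configs \<Lambda>) (law (1 - p) \<Lambda> \<sigma> t \<eta>)
    (measure_pmf.prob (reversible_measure (1 - p) \<Lambda>))"
    using tv_dist_ge[of ?A "law (1 - p) \<Lambda> \<sigma> t \<eta>"
        "measure_pmf.prob (reversible_measure (1 - p) \<Lambda>)"] by linarith
qed

section \<open>Propagation of zeros into the box\<close>

definition all_ones :: "'d config" where
  "all_ones = (\<lambda>y. if y \<in> \<Lambda> then True else undefined)"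

lemma all_ones_mem: "all_ones \<in> configs \<Lambda>"
  by (auto simp: configs_def all_ones_def)

text \<open>
  Zeros invade the box from its boundary at bounded speed: the weight \<open>exp 2\<close> per layer makes the
  right-hand side a supersolution of the linear system satisfied by the one-site probabilities.
\<close>

lemma finite_speed:
  assumes \<Lambda>: "\<Lambda> = lattice_box L" and "\<And>i. int m \<le> y $ i \<and> y $ i \<le> int L" and "0 \<le> t"
  shows "killed_semigroup 0 z t (zero_at y) all_ones \<le> exp (real CARD('d) * exp 2 * t - 2 * real m)"
  using assms(2,3)
proof (induction m arbitrary: y t)
  \<comment> \<open>This layer includes boundary sites of arbitrary spin; the claimed bound is at
    least 1.\<close>
  case 0
  have "killed_semigroup 0 z t (zero_at y) all_ones \<le> killed_semigroup 0 z t (\<lambda>_. 1) all_ones"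
    by (rule killed_semigroup_mono) (use zero_at_bounds 0 all_ones_mem in auto)
  also have "\<dots> \<le> exp (real CARD('d) * exp 2 * t - 2 * real 0)"
    using 0 by (simp add: semigroup_const)
  finally show ?case .
next
  case (Suc m)
  let ?l = "real CARD('d) * exp 2"
  let ?u = "\<lambda>t. killed_semigroup 0 z t (zero_at y) all_ones"
  let ?u' = "\<lambda>t. killed_semigroup 0 z t (killed_generator 0 z (zero_at y)) all_ones"
  let ?\<phi> = "\<lambda>t. exp (?l * t - 2 * real (Suc m))"
  have y: "y \<in> \<Lambda>"
  proof -
    have "1 \<le> y $ i \<and> y $ i \<le> int L" for i using Suc.prems(1)[of i] by simp
    then show ?thesis by (simp add: \<Lambda> lattice_box_def)
  qed
  \<comment> \<open>A zero at \<open>y\<close> is created at rate at most 1, and only in the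
    presence of a zero at a predecessor; the sum is a union bound over the d predecessors.\<close>
  have gen: "killed_generator 0 z (zero_at y) \<xi> \<le> (\<Sum>i\<in>UNIV. zero_at (y - axis i 1) \<xi>)" for \<xi>
  proof -
    have "rate w \<xi> * (av w (zero_at y) \<xi> - zero_at y \<xi>) = 0" if "w \<in> \<Lambda> - {y}" for w
    proof -
      have "av w (zero_at y) = zero_at y"
        by (rule av_indep) (use that in \<open>simp add: zero_at_def glue_upd\<close>)
      then show ?thesis by simp
    qed
    then have "(\<Sum>w\<in>\<Lambda> - {y}. rate w \<xi> * (av w (zero_at y) \<xi> - zero_at y \<xi>)) = 0"
      by (rule sum.neutral[OF ballI])
    then have "killed_generator 0 z (zero_at y) \<xi> = rate y \<xi> * (av y (zero_at y) \<xi> - zero_at y \<xi>)"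
      unfolding killed_generator_0 generator_av sum.remove[OF finite_region y] by simp
    also have "\<dots> \<le> rate y \<xi> * 1"
    proof (rule mult_left_mono[OF _ rate_bounds(1)])
      have "av y (zero_at y) \<xi> \<le> 1"
        using avs_mono[of "[y]" \<xi> "zero_at y" "\<lambda>_. 1"] zero_at_bounds by simp
      then show "av y (zero_at y) \<xi> - zero_at y \<xi> \<le> 1" using zero_at_bounds[of y \<xi>] by linarith
    qed
    also have "\<dots> \<le> (\<Sum>i\<in>UNIV. zero_at (y - axis i 1) \<xi>)"
    proof (cases "\<exists>i. \<not> glue \<Lambda> \<sigma> \<xi> (y - axis i 1)")
      case True
      then obtain i where "zero_at (y - axis i 1) \<xi> = 1" by (auto simp: zero_at_def)
      moreover have "zero_at (y - axis i 1) \<xi> \<le> (\<Sum>i\<in>UNIV. zero_at (y - axis i 1) \<xi>)"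
        by (rule member_le_sum) (use zero_at_bounds in auto)
      ultimately show ?thesis using rate_bounds[of y \<xi>] by linarith
    next
      case False
      then have "rate y \<xi> = 0" by (auto simp: constraint_def canonical_basis_def)
      then show ?thesis using zero_at_bounds by (simp add: sum_nonneg)
    qed
    finally show ?thesis .
  qed
  have u': "?u' s \<le> ?l * ?\<phi> s" if s: "0 \<le> s" for s
  proof -
    have "?u' s \<le> killed_semigroup 0 z s (\<lambda>\<xi>. \<Sum>i\<in>UNIV. zero_at (y - axis i 1) \<xi>) all_ones"
      by (rule killed_semigroup_mono) (use gen s all_ones_mem in auto)
    also have "\<dots> = (\<Sum>i\<in>UNIV. killed_semigroup 0 z s (zero_at (y - axis i 1)) all_ones)"
      by (rule killed_semigroup_sum[OF all_ones_mem])
    also have "\<dots> \<le> (\<Sum>i\<in>(UNIV :: 'd set). exp (?l * s - 2 * real m))"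
    proof (rule sum_mono, rule Suc.IH[OF _ s])
      fix i j :: 'd
      have "0 \<le> axis i (1 :: int) $ j \<and> axis i (1 :: int) $ j \<le> 1" by (simp add: axis_def)
      then show "int m \<le> (y - axis i 1) $ j \<and> (y - axis i 1) $ j \<le> int L"
        using Suc.prems(1)[of j] by simp
    qed
    \<comment> \<open>Going down one layer costs \<open>exp 2\<close>, and there are d predecessors:
      this fixes the growth rate \<open>?l\<close>, and the right side is the derivative of
      \<open>?\<phi>\<close>.\<close>
    also have "\<dots> = ?l * ?\<phi> s" by (simp add: exp_diff exp_add field_simps)
    finally show ?thesis .
  qed
  have "?u t - ?\<phi> t \<le> ?u 0 - ?\<phi> 0"
  proof (rule DERIV_nonpos_imp_nonincreasing[OF Suc.prems(2)])
    fix s assume "0 \<le> s" "s \<le> t"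
    have "((\<lambda>t. ?u t - ?\<phi> t) has_real_derivative (?u' s - ?l * ?\<phi> s)) (at s)"
      by (intro DERIV_diff killed_semigroup_deriv' all_ones_mem)
        (auto intro!: derivative_eq_intros)
    then show "\<exists>d. ((\<lambda>t. ?u t - ?\<phi> t) has_real_derivative d) (at s) \<and> d \<le> 0"
      using u'[OF \<open>0 \<le> s\<close>] by fastforce
  qed
  moreover have "?u 0 = 0" using y by (simp add: killed_semigroup_0 zero_at_def glue_def all_ones_def)
  moreover have "0 \<le> ?\<phi> 0" by (rule exp_ge_zero)
  ultimately show ?case by linarith
qed

text \<open>The test event is that a segment far from the boundary consists of ones. It persists
  until zeros can arrive, but is exponentially unlikely in equilibrium.\<close>

lemma all_ones_tv_dist:
  assumes \<Lambda>: "\<Lambda> = lattice_box L" and L: "1 \<le> L" and t: "0 \<le> t"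
  shows "1 - real L * exp (real CARD('d) * exp 2 * t - real L) - p ^ (L div 2)
    \<le> tv_dist (configs \<Lambda>) (law (1 - p) \<Lambda> \<sigma> t all_ones)
        (measure_pmf.prob (reversible_measure (1 - p) \<Lambda>))"
proof -
  define i :: 'd where "i = undefined"
  \<comment> \<open>Rounding up gives \<open>2 * m \<ge> L\<close>, while at least
    \<open>L div 2\<close> sites remain between \<open>m\<close> and \<open>L\<close>.\<close>
  define m where "m = (L + 1) div 2"
  have m: "1 \<le> m" "m \<le> L" "real L \<le> 2 * real m" "L div 2 \<le> L + 1 - m" using L by (auto simp: m_def)
  \<comment> \<open>The base has coordinate 0 in direction \<open>i\<close> and \<open>L\<close>
    elsewhere, so the index on the line equals the coordinate and every coordinate is at least
    \<open>m\<close>.\<close>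
  define ys where "ys = map (line (\<chi> j. if j = i then 0 else int L) i) [m..<Suc L]"
  define B where "B = set ys"
  have B_nth: "int m \<le> y $ j \<and> y $ j \<le> int L" if "y \<in> B" for y j
    using that m by (auto simp: B_def ys_def line_nth)
  have B\<Lambda>: "B \<subseteq> \<Lambda>"
  proof
    fix y assume y: "y \<in> B"
    have "1 \<le> y $ j \<and> y $ j \<le> int L" for j using B_nth[OF y, of j] m by simp
    then show "y \<in> \<Lambda>" by (simp add: \<Lambda> lattice_box_def)
  qed
  have ys: "distinct ys" "length ys = L + 1 - m"
    by (simp_all add: ys_def distinct_map inj_on_subset[OF line_inj] del: upt_Suc)
  have card_B: "card B \<le> L" unfolding B_def using distinct_card[OF ys(1)] ys(2) m by simp
  let ?A = "{\<xi> \<in> configs \<Lambda>. \<forall>y\<in>B. \<xi> y}"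
  let ?S = "\<lambda>\<xi>. \<Sum>y\<in>B. zero_at y \<xi>"
  let ?b = "exp (real CARD('d) * exp 2 * t - real L)"
  have ind: "1 - ?S \<xi> \<le> indicator ?A \<xi>" if "\<xi> \<in> configs \<Lambda>" for \<xi>
  proof (cases "\<forall>y\<in>B. \<xi> y")
    case True
    then show ?thesis using that zero_at_bounds by (simp add: sum_nonneg)
  next
    case False
    then obtain y where y: "y \<in> B" "zero_at y \<xi> = 1"
      using B\<Lambda> by (auto simp: zero_at_def glue_def)
    moreover have "zero_at y \<xi> \<le> ?S \<xi>"
      by (rule member_le_sum) (use y zero_at_bounds in \<open>auto simp: B_def\<close>)
    ultimately have "1 \<le> ?S \<xi>" by linarith
    then show ?thesis by (simp add: indicator_def)
  qed
  have "killed_semigroup 0 undefined t ?S all_ones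
      = (\<Sum>y\<in>B. killed_semigroup 0 undefined t (zero_at y) all_ones)"
    by (rule killed_semigroup_sum[OF all_ones_mem])
  also have "\<dots> \<le> (\<Sum>y\<in>B. ?b)"
  proof (rule sum_mono)
    fix y assume y: "y \<in> B"
    have "killed_semigroup 0 undefined t (zero_at y) all_ones
        \<le> exp (real CARD('d) * exp 2 * t - 2 * real m)"
      by (rule finite_speed[OF \<Lambda> B_nth[OF y] t])
    also have "\<dots> \<le> ?b" using m(3) by simp
    finally show "killed_semigroup 0 undefined t (zero_at y) all_ones \<le> ?b" .
  qed
  also have "\<dots> \<le> real L * ?b" using card_B by simp
  finally have "1 - real L * ?b \<le> killed_semigroup 0 undefined t (\<lambda>\<xi>. 1 - ?S \<xi>) all_ones"
    using killed_semigroup_diff[OF all_ones_mem, of 0 undefined t "\<lambda>_. 1" ?S]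
    by (simp add: semigroup_const)
  also have "\<dots> \<le> law (1 - p) \<Lambda> \<sigma> t all_ones ?A"
    unfolding law_def semigroup_at_killed[of undefined]
    by (rule killed_semigroup_mono) (use ind t all_ones_mem in auto)
  finally have 1: "1 - real L * ?b \<le> law (1 - p) \<Lambda> \<sigma> t all_ones ?A" .
  have 2: "measure_pmf.prob (reversible_measure (1 - p) \<Lambda>) ?A \<le> p ^ (L div 2)"
  proof -
    obtain zs where zs: "set zs = \<Lambda> - B" "distinct zs"
      using finite_distinct_list[of "\<Lambda> - B"] finite_region by blast
    have xs: "set (zs @ ys) = \<Lambda>" "distinct (zs @ ys)"
      using zs ys B\<Lambda> by (auto simp: B_def)
    have "avs (zs @ ys) (indicator ?A) all_ones
        = avs (zs @ ys) (\<lambda>\<xi>. of_bool (\<forall>y\<in>set ys. \<xi> y)) all_ones"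
    proof (rule avs_cong)
      fix \<xi> assume "\<And>k. k \<notin> set (zs @ ys) \<Longrightarrow> \<xi> k = all_ones k"
      then have "\<xi> \<in> configs \<Lambda>" unfolding xs by (rule configs_outside[OF all_ones_mem])
      then show "indicator ?A \<xi> = of_bool (\<forall>y\<in>set ys. \<xi> y)" by (simp add: indicator_def B_def)
    qed
    also have "\<dots> = p ^ (L + 1 - m)" by (simp only: avs_append avs_all[OF ys(1)] avs_const ys(2))
    also have "\<dots> \<le> p ^ (L div 2)"
      by (rule power_decreasing[OF m(4)]) (use p_pos p_less_1 in auto)
    finally show ?thesis using reversible_measure_avs[OF all_ones_mem xs] by simp
  qed
  have "?A \<subseteq> configs \<Lambda>" by blast
  from tv_dist_ge[OF this, of "law (1 - p) \<Lambda> \<sigma> t all_ones"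
      "measure_pmf.prob (reversible_measure (1 - p) \<Lambda>)"] 1 2
  show ?thesis by linarith
qed

end

subsection \<open>Linear mixing time\<close>

context east_process
begin

text \<open>The killed semigroup is nonnegative on 1, so stronger killing gives a subsolution of the
  equation with weaker killing.\<close>

lemma killed_semigroup_antimono:
  assumes "0 \<le> \<theta>'" "\<theta>' \<le> \<theta>" "0 \<le> t" "\<eta> \<in> configs \<Lambda>"
  shows "killed_semigroup \<theta> y t (\<lambda>_. 1) \<eta> \<le> killed_semigroup \<theta>' y t (\<lambda>_. 1) \<eta>"
proof (rule subsolution_le[OF assms(1) killed_semigroup_deriv])
  fix t :: real and \<eta> assume *: "0 \<le> t" "\<eta> \<in> configs \<Lambda>"
  have "killed_semigroup \<theta> y t (\<lambda>_. 0) \<eta> \<le> killed_semigroup \<theta> y t (\<lambda>_. 1) \<eta>"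
    by (rule killed_semigroup_mono) (use assms * in auto)
  then have "0 \<le> killed_semigroup \<theta> y t (\<lambda>_. 1) \<eta>"
    using killed_semigroup_cmult[OF *(2), of \<theta> y t 0 "\<lambda>_. 0"] by simp
  then have "\<theta>' * zero_at y \<eta> * killed_semigroup \<theta> y t (\<lambda>_. 1) \<eta>
      \<le> \<theta> * zero_at y \<eta> * killed_semigroup \<theta> y t (\<lambda>_. 1) \<eta>"
    by (intro mult_right_mono assms zero_at_bounds)
  then show "killed_generator \<theta> y (killed_semigroup \<theta> y t (\<lambda>_. 1)) \<eta>
      \<le> killed_generator \<theta>' y (killed_semigroup \<theta> y t (\<lambda>_. 1)) \<eta>"
    by (simp add: killed_generator_def)
qed (use assms in \<open>auto simp: killed_semigroup_0\<close>)

end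

context bernoulli_parameter
begin

lemma east_process_box: "east_process p (lattice_box L)"
  by unfold_locales (rule finite_lattice_box)

text \<open>The root halves the rate. The generous treatment of the prefactor returns a bound of the
  shape \<open>K ^ L * exp (- c * t)\<close>, ready for the next line.\<close>

lemma sqrt_decay:
  fixes s K c t :: real
  assumes "min p (1 - p) ^ n * s\<^sup>2 \<le> K ^ L * exp (- c * t)" "n \<le> L" "1 \<le> K"
  shows "s \<le> (K / min p (1 - p)) ^ L * exp (- (c / 2) * t)"
proof (rule power2_le_imp_le)
  let ?k = "min p (1 - p)"
  have k: "0 < ?k" "?k \<le> 1" using p_pos p_less_1 by auto
  have "?k ^ L * s\<^sup>2 \<le> ?k ^ n * s\<^sup>2"
    by (intro mult_right_mono power_decreasing assms) (use k in auto)
  also have "\<dots> \<le> K ^ L * exp (- c * t)" by (rule assms(1))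
  finally have "s\<^sup>2 \<le> (K / ?k) ^ L * exp (- c * t)"
    using k by (simp add: power_divide field_simps)
  also have "(K / ?k) ^ L \<le> ((K / ?k) ^ L)\<^sup>2"
  proof -
    have "1 \<le> (K / ?k) ^ L" using k assms(3) by (intro one_le_power) (simp add: field_simps)
    then show ?thesis by (simp add: self_le_power)
  qed
  also have "exp (- c * t) = (exp (- (c / 2) * t))\<^sup>2"
    by (simp flip: exp_double)
  finally show "s\<^sup>2 \<le> ((K / ?k) ^ L * exp (- (c / 2) * t))\<^sup>2"
    by (simp add: power_mult_distrib)
  show "0 \<le> (K / ?k) ^ L * exp (- (c / 2) * t)" using k assms(3) by simp
qed

text \<open>
  The site \<open>x\<close> is reached from the zero on the boundary through at most \<open>m + 1\<close> straight lines, one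
  for each coordinate direction.
\<close>

lemma killed_semigroup_decay:
  fixes i0 :: "'d::finite"
  assumes "0 < \<theta>"
  shows "\<exists>K\<ge>1. \<exists>c>0. \<forall>L (\<sigma> :: 'd config) x t \<eta>. \<not> \<sigma> (box_corner - axis i0 1) \<longrightarrow>
    x \<in> lattice_box L \<longrightarrow> card {i. i \<noteq> i0 \<and> x $ i \<noteq> 1} \<le> m \<longrightarrow> 0 \<le> t \<longrightarrow>
    \<eta> \<in> configs (lattice_box L) \<longrightarrow>
    east_process.killed_semigroup p (lattice_box L) \<sigma> \<theta> x t (\<lambda>_. 1) \<eta> \<le> K ^ L * exp (- c * t)"
  using assms
proof (induction m arbitrary: \<theta>)
  case 0
  obtain \<gamma> where \<gamma>: "1 \<le> \<gamma>" "\<And>n. has_gap \<gamma> n" using east_gap by blast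
  define c where "c = line_rate \<gamma> \<theta>"
  show ?case
  proof (intro exI conjI allI impI)
    show "1 \<le> 1 / min p (1 - p)" using p_pos p_less_1 by simp
    show "0 < c" using \<gamma> 0 sqrt_p by (simp add: c_def line_rate_def)
    fix L :: nat and t :: real and \<sigma> :: "'d config" and x :: "'d site" and \<eta> :: "'d config"
    assume *: "\<not> \<sigma> (box_corner - axis i0 1)" "x \<in> lattice_box L"
      "card {i. i \<noteq> i0 \<and> x $ i \<noteq> 1} \<le> 0" "0 \<le> t" "\<eta> \<in> configs (lattice_box L)"
    interpret east_process p "lattice_box L" \<sigma> by (rule east_process_box)
    let ?y = "box_corner - axis i0 1"
    \<comment> \<open>The base point, just outside the box, has coordinate 0 in direction
      \<open>i0\<close>.\<close>
    define n where "n = nat (x $ i0)"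
    have box: "1 \<le> x $ j \<and> x $ j \<le> int L" for j using *(2) by (simp add: lattice_box_def)
    have n: "0 < n" "n \<le> L" "int n = x $ i0" using box[of i0] by (auto simp: n_def)
    have "x $ j = 1" if "j \<noteq> i0" for j using *(3) that by auto
    then have x: "x = line ?y i0 n"
      using n by (auto simp: vec_eq_iff line_nth box_corner_def axis_def)
    have "min p (1 - p) ^ n * (killed_semigroup \<theta> x t (\<lambda>_. 1) \<eta>)\<^sup>2
        \<le> killed_semigroup (2 * c) ?y t (\<lambda>_. 1) \<eta>"
      unfolding x c_def
    proof (rule line_step[OF \<gamma>(2,1) _ n(1) _ *(4,5)])
      fix k assume "k \<in> {0<..n}"
      then show "line ?y i0 k \<in> lattice_box L"
        using n by (auto simp: lattice_box_def line_nth box_corner_def axis_def)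
    qed (use 0 in simp)
    also have "\<dots> = exp (- (2 * c) * t)"
      by (rule killed_semigroup_boundary[OF box_corner_pred *(1)])
    finally have "min p (1 - p) ^ n * (killed_semigroup \<theta> x t (\<lambda>_. 1) \<eta>)\<^sup>2 \<le> 1 ^ L * exp (- (2 * c) * t)"
      by simp
    from sqrt_decay[OF this n(2)]
    show "killed_semigroup \<theta> x t (\<lambda>_. 1) \<eta> \<le> (1 / min p (1 - p)) ^ L * exp (- c * t)" by simp
  qed
next
  case (Suc m)
  obtain \<gamma> where \<gamma>: "1 \<le> \<gamma>" "\<And>n. has_gap \<gamma> n" using east_gap by blast
  \<comment> \<open>The minimum lets one induction hypothesis serve two cases: a line of positive
    length needs the rate \<open>2 * line_rate \<gamma> \<theta>\<close> at its base, an empty one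
    needs \<open>\<theta>\<close> itself.\<close>
  define \<theta>' where "\<theta>' = min \<theta> (2 * line_rate \<gamma> \<theta>)"
  have \<theta>': "0 < \<theta>'" "\<theta>' \<le> \<theta>" "\<theta>' \<le> 2 * line_rate \<gamma> \<theta>"
    using \<gamma> Suc.prems sqrt_p by (auto simp: \<theta>'_def line_rate_def)
  from Suc.IH[OF \<theta>'(1)] obtain K c where K: "1 \<le> K" and c: "0 < c"
    and IH: "\<And>L (\<sigma> :: 'd config) x t \<eta>. \<not> \<sigma> (box_corner - axis i0 1) \<Longrightarrow>
    x \<in> lattice_box L \<Longrightarrow> card {i. i \<noteq> i0 \<and> x $ i \<noteq> 1} \<le> m \<Longrightarrow> 0 \<le> t \<Longrightarrow>
    \<eta> \<in> configs (lattice_box L) \<Longrightarrow>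
    east_process.killed_semigroup p (lattice_box L) \<sigma> \<theta>' x t (\<lambda>_. 1) \<eta>
      \<le> K ^ L * exp (- c * t)" by blast
  show ?case
  proof (intro exI conjI allI impI)
    have k: "0 < min p (1 - p)" "min p (1 - p) \<le> 1" using p_pos p_less_1 by auto
    show K': "1 \<le> K / min p (1 - p)" using k K by (simp add: field_simps)
    show "0 < c / 2" using c by simp
    fix L :: nat and t :: real and \<sigma> :: "'d config" and x :: "'d site" and \<eta> :: "'d config"
    assume *: "\<not> \<sigma> (box_corner - axis i0 1)" "x \<in> lattice_box L"
      "card {i. i \<noteq> i0 \<and> x $ i \<noteq> 1} \<le> Suc m" "0 \<le> t" "\<eta> \<in> configs (lattice_box L)"
    interpret east_process p "lattice_box L" \<sigma> by (rule east_process_box)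
    have box: "1 \<le> x $ j \<and> x $ j \<le> int L" for j using *(2) by (simp add: lattice_box_def)
    \<comment> \<open>One coordinate other than \<open>i0\<close> is reset to 1; if all of them are
      1 already, the line is empty.\<close>
    obtain i y n where y: "y \<in> lattice_box L" "card {j. j \<noteq> i0 \<and> y $ j \<noteq> 1} \<le> m"
      and n: "n \<le> L" "x = line y i n"
      and in_box: "\<And>k. k \<in> {0<..n} \<Longrightarrow> line y i k \<in> lattice_box L"
    proof (cases "{i. i \<noteq> i0 \<and> x $ i \<noteq> 1} = {}")
      case True
      have "x = line x i0 0" by simp
      then show ?thesis using that[of x 0 i0] *(2) True by simp
    next
      case False
      then obtain i where i: "i \<noteq> i0" "x $ i \<noteq> 1" by blast
      define y :: "'d site" where "y = (\<chi> j. if j = i then 1 else x $ j)"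
      define n where "n = nat (x $ i - 1)"
      have n: "int n = x $ i - 1" using box[of i] by (simp add: n_def)
      have "{j. j \<noteq> i0 \<and> y $ j \<noteq> 1} = {j. j \<noteq> i0 \<and> x $ j \<noteq> 1} - {i}" by (auto simp: y_def)
      then have "card {j. j \<noteq> i0 \<and> y $ j \<noteq> 1} \<le> m"
        using *(3) i by (simp add: card_Diff_singleton)
      moreover have "line y i k \<in> lattice_box L" if "k \<le> n" for k
      proof -
        have "1 + int k \<le> int L" using that n box[of i] by linarith
        then show ?thesis using box by (auto simp: lattice_box_def line_nth y_def)
      qed
      moreover from this[of 0] have "y \<in> lattice_box L" by simp
      moreover have "x = line y i n" using n by (auto simp: vec_eq_iff line_nth y_def)
      moreover have "n \<le> L" using n box[of i] by simp
      ultimately show ?thesis using that[of y n i] by simp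
    qed
    have "killed_semigroup \<theta>' y t (\<lambda>_. 1) \<eta> \<le> K ^ L * exp (- c * t)"
      using IH[of \<sigma> y L t \<eta>] * y by blast
    then have bound: "killed_semigroup \<theta>'' y t (\<lambda>_. 1) \<eta> \<le> K ^ L * exp (- c * t)"
      if "\<theta>' \<le> \<theta>''" for \<theta>''
      using killed_semigroup_antimono[OF less_imp_le[OF \<theta>'(1)] that *(4,5), of y] by linarith
    show "killed_semigroup \<theta> x t (\<lambda>_. 1) \<eta> \<le> (K / min p (1 - p)) ^ L * exp (- (c / 2) * t)"
    proof (cases "n = 0")
      case False
      have "min p (1 - p) ^ n * (killed_semigroup \<theta> x t (\<lambda>_. 1) \<eta>)\<^sup>2 \<le> K ^ L * exp (- c * t)"
        unfolding n(2)
        by (rule order_trans[OF line_step[OF \<gamma>(2,1) _ _ in_box *(4,5)] bound[OF \<theta>'(3)]])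
          (use False Suc.prems in auto)
      then show ?thesis by (rule sqrt_decay[OF _ n(1) K])
    next
      case True
      then have "killed_semigroup \<theta> x t (\<lambda>_. 1) \<eta> \<le> K ^ L * exp (- c * t)"
        using bound[OF \<theta>'(2)] n(2) by simp
      also have "\<dots> \<le> (K / min p (1 - p)) ^ L * exp (- (c / 2) * t)"
      proof (intro mult_mono power_mono)
        show "K \<le> K / min p (1 - p)" using k K by (simp add: field_simps)
        show "exp (- c * t) \<le> exp (- (c / 2) * t)" using c *(4) by simp
      qed (use K K' in auto)
      finally show ?thesis .
    qed
  qed
qed

lemma mixing_upper:
  fixes i0 :: "'d::finite"
  shows "\<exists>C>0. \<forall>L (\<sigma> :: 'd config). 1 \<le> L \<longrightarrow> \<not> \<sigma> (box_corner - axis i0 1) \<longrightarrow>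
    (\<forall>\<eta>\<in>configs (lattice_box L). tv_dist (configs (lattice_box L))
      (law (1 - p) (lattice_box L) \<sigma> (C * real L) \<eta>)
      (measure_pmf.prob (reversible_measure (1 - p) (lattice_box L))) \<le> 1 / 4)"
proof -
  obtain K c where K: "1 \<le> K" and c: "0 < c"
    and decay: "\<And>L (\<sigma> :: 'd config) x t \<eta>. \<not> \<sigma> (box_corner - axis i0 1) \<Longrightarrow>
      x \<in> lattice_box L \<Longrightarrow> card {i. i \<noteq> i0 \<and> x $ i \<noteq> 1} \<le> CARD('d) \<Longrightarrow> 0 \<le> t \<Longrightarrow>
      \<eta> \<in> configs (lattice_box L) \<Longrightarrow>
      east_process.killed_semigroup p (lattice_box L) \<sigma> 1 x t (\<lambda>_. 1) \<eta> \<le> K ^ L * exp (- c * t)"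
    using killed_semigroup_decay[OF zero_less_one, of i0 "CARD('d)"] by blast
  \<comment> \<open>\<open>b\<close> is a rate valid both for predecessors in the box
    (\<open>c\<close>) and for the boundary zero (1). At time \<open>C * real L\<close>, the factors
    \<open>exp (d L)\<close> for the number of sites, \<open>K ^ L\<close> and
    \<open>exp (- (b / 2) * t)\<close> multiply to \<open>exp (- 2 * real L)\<close>, which is at
    most 1/4.\<close>
  define b where "b = min c 1"
  define a where "a = real CARD('d) + ln K + 2"
  define C where "C = 2 * a / b"
  have b: "0 < b" "b \<le> c" "b \<le> 1" using c by (auto simp: b_def)
  have a: "0 < a" unfolding a_def using K by (intro add_nonneg_pos add_nonneg_nonneg) auto
  have C: "0 < C" using a b by (simp add: C_def)
  have "tv_dist (configs (lattice_box L)) (law (1 - p) (lattice_box L) \<sigma> (C * real L) \<eta>)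
      (measure_pmf.prob (reversible_measure (1 - p) (lattice_box L))) \<le> 1 / 4"
    if L: "1 \<le> L" and \<sigma>: "\<not> \<sigma> (box_corner - axis i0 1)" and \<eta>: "\<eta> \<in> configs (lattice_box L)"
    for L and \<sigma> \<eta> :: "'d config"
  proof -
    interpret east_process p "lattice_box L" \<sigma> by (rule east_process_box)
    define t where "t = C * real L"
    have t: "0 \<le> t" using C by (simp add: t_def)
    define s where "s = K ^ L * exp (- (b / 2) * t)"
    have KL: "1 \<le> K ^ L" by (rule one_le_power[OF K])
    have s0: "0 \<le> s" unfolding s_def using KL by (intro mult_nonneg_nonneg) auto
    have s2: "K ^ L * exp (- b * t) \<le> s\<^sup>2"
    proof -
      have "K ^ L * exp (- b * t) \<le> (K ^ L)\<^sup>2 * exp (- b * t)"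
        by (rule mult_right_mono) (use KL in \<open>simp_all add: self_le_power\<close>)
      also have "\<dots> = s\<^sup>2" by (simp add: s_def power_mult_distrib flip: exp_double)
      finally show ?thesis .
    qed
    have "\<exists>e\<in>canonical_basis. killed_semigroup 1 (x - e) t (\<lambda>_. 1) \<eta> \<le> s\<^sup>2"
      if x: "x \<in> lattice_box L" for x
    \<comment> \<open>The corner is driven by the boundary zero; any other site has a predecessor
      inside the box, to which \<open>decay\<close> applies.\<close>
    proof (cases "x = box_corner")
      case True
      have "killed_semigroup 1 (x - axis i0 1) t (\<lambda>_. 1) \<eta> = exp (- 1 * t)"
        unfolding True by (rule killed_semigroup_boundary[OF box_corner_pred \<sigma>])
      also have "\<dots> \<le> 1 * exp (- b * t)" using b t by (simp add: mult_left_le_one_le)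
      also have "\<dots> \<le> K ^ L * exp (- b * t)" by (rule mult_right_mono[OF KL]) simp
      also note s2
      finally show ?thesis by (intro bexI[of _ "axis i0 1"]) (simp_all add: canonical_basis_def)
    next
      case False
      then obtain i where i: "x $ i \<noteq> 1" by (auto simp: vec_eq_iff box_corner_def)
      have "x - axis i 1 \<in> lattice_box L"
        unfolding lattice_box_def
      proof (intro CollectI allI)
        fix j
        have "1 \<le> x $ j \<and> x $ j \<le> int L" using x by (simp add: lattice_box_def)
        then show "1 \<le> (x - axis i 1) $ j \<and> (x - axis i 1) $ j \<le> int L"
          using i by (cases "j = i") (auto simp: axis_def)
      qed
      then have "killed_semigroup 1 (x - axis i 1) t (\<lambda>_. 1) \<eta> \<le> K ^ L * exp (- c * t)"
        using decay[of \<sigma> "x - axis i 1" L t \<eta>] \<sigma> t \<eta>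
          card_mono[of "UNIV :: 'd set" "{j. j \<noteq> i0 \<and> (x - axis i 1) $ j \<noteq> 1}"] by simp
      also have "\<dots> \<le> K ^ L * exp (- b * t)"
        by (rule mult_left_mono) (use KL b t in \<open>auto intro: mult_right_mono\<close>)
      also note s2
      finally show ?thesis by (intro bexI[of _ "axis i 1"]) (simp_all add: canonical_basis_def)
    qed
    then have "tv_dist (configs (lattice_box L)) (law (1 - p) (lattice_box L) \<sigma> t \<eta>)
        (measure_pmf.prob (reversible_measure (1 - p) (lattice_box L)))
        \<le> real (card (lattice_box L :: 'd site set)) * s"
      by (rule tv_dist_le[OF _ s0 t \<eta>])
    also have "\<dots> \<le> real (L ^ CARD('d)) * s"
      by (intro mult_right_mono of_nat_mono card_lattice_box) (rule s0)
    also have "\<dots> \<le> exp (real CARD('d) * real L) * s"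
    proof (rule mult_right_mono)
      have "real L \<le> exp (real L)" using exp_ge_add_one_self[of "real L"] by linarith
      then have "real L ^ CARD('d) \<le> exp (real L) ^ CARD('d)" by (rule power_mono) simp
      then show "real (L ^ CARD('d)) \<le> exp (real CARD('d) * real L)"
        by (simp only: exp_of_nat_mult of_nat_power)
    qed (rule s0)
    also have "\<dots> = exp (- 2 * real L)"
    proof -
      have "K ^ L = exp (real L * ln K)" using K by (simp only: exp_of_nat_mult exp_ln)
      then have "exp (real CARD('d) * real L) * s
          = exp (real CARD('d) * real L + real L * ln K - (b / 2) * t)"
        unfolding s_def by (simp only: mult_exp_exp add_diff_eq mult_minus_left add_uminus_conv_diff)
      also have "(b / 2) * t = a * real L" using b by (simp add: t_def C_def)
      also have "real CARD('d) * real L + real L * ln K - a * real L = - 2 * real L"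
        by (simp add: a_def algebra_simps)
      finally show ?thesis .
    qed
    also have "\<dots> \<le> exp (- 2)" using L by simp
    also have "\<dots> \<le> 1 / 4"
    proof -
      have "2 \<le> exp (1 :: real)" using exp_ge_add_one_self[of 1] by simp
      then have "2\<^sup>2 \<le> (exp (1 :: real))\<^sup>2" by (rule power_mono) simp
      also have "(exp (1 :: real))\<^sup>2 = exp 2" using exp_double[of "1 :: real"] by simp
      finally have "1 / exp 2 \<le> 1 / (4 :: real)" by (intro divide_left_mono) simp_all
      then show ?thesis by (simp add: exp_minus inverse_eq_divide)
    qed
    finally show ?thesis by (simp add: t_def)
  qed
  then show ?thesis using C by blast
qed

lemma ergodic_boundary_zero:
  fixes \<sigma> :: "'d::finite config"
  assumes "ergodic_boundary (1 - p) (lattice_box L) \<sigma>" "1 \<le> L"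
  shows "\<exists>i. \<not> \<sigma> (box_corner - axis i 1)"
proof (rule ccontr)
  assume no_zero: "\<nexists>i. \<not> \<sigma> (box_corner - axis i 1)"
  interpret east_process p "lattice_box L" \<sigma> by (rule east_process_box)
  define \<xi> where "\<xi> = all_ones(box_corner := False)"
  have \<xi>: "\<xi> \<in> configs (lattice_box L)"
    unfolding \<xi>_def by (rule configs_upd[OF all_ones_mem box_corner_mem[OF assms(2)]])
  have "law (1 - p) (lattice_box L) \<sigma> t all_ones {\<xi>} = 0" for t
  proof (rule frozen_site[OF box_corner_mem[OF assms(2)]])
    show "rate box_corner \<eta> = 0" for \<eta>
      using no_zero by (auto simp: constraint_def canonical_basis_def glue_def box_corner_pred)
    show "all_ones box_corner \<noteq> \<xi> box_corner"
    proof -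
      have "(box_corner :: 'd site) \<in> lattice_box L" by (rule box_corner_mem[OF assms(2)])
      then show ?thesis by (simp add: \<xi>_def all_ones_def)
    qed
  qed
  then show False using assms(1) all_ones_mem \<xi> unfolding ergodic_boundary_def by force
qed

text \<open>For large \<open>L\<close> and \<open>l * t < L / 2\<close> the test event of
  \<open>all_ones_tv_dist\<close> gives a distance above 1/2. The finitely many smaller
  \<open>L\<close> only need a positive lower bound, namely \<open>ln 2\<close> from the corner
  spin.\<close>

lemma mixing_lower:
  "\<exists>c>0. \<forall>L (\<sigma> :: 'd::finite config) t. 1 \<le> L \<longrightarrow> (\<exists>i. \<not> \<sigma> (box_corner - axis i 1)) \<longrightarrow> 0 \<le> t \<longrightarrow>
    (\<forall>\<eta>\<in>configs (lattice_box L). tv_dist (configs (lattice_box L))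
      (law (1 - p) (lattice_box L) \<sigma> t \<eta>)
      (measure_pmf.prob (reversible_measure (1 - p) (lattice_box L))) \<le> 1 / 4) \<longrightarrow>
    c * real L \<le> t"
proof -
  have "(\<lambda>L. real L * exp (- (real L / 2))) \<longlonglongrightarrow> 0" by real_asymp
  then have "\<forall>\<^sub>F L in sequentially. real L * exp (- (real L / 2)) < 1 / 4"
    by (rule order_tendstoD) simp
  moreover have "(\<lambda>L. p ^ (L div 2)) \<longlonglongrightarrow> 0"
  proof (rule filterlim_compose[of "\<lambda>n. p ^ n"])
    show "(\<lambda>n. p ^ n) \<longlonglongrightarrow> 0" by (rule LIMSEQ_realpow_zero) (use p_pos p_less_1 in auto)
    show "filterlim (\<lambda>L :: nat. L div 2) sequentially sequentially"
      unfolding filterlim_at_top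
    proof
      fix n :: nat show "\<forall>\<^sub>F L in sequentially. n \<le> L div 2"
        using eventually_ge_at_top[of "2 * n"] by eventually_elim simp
    qed
  qed
  then have "\<forall>\<^sub>F L in sequentially. p ^ (L div 2) < 1 / 4"
    by (rule order_tendstoD) simp
  ultimately have "\<forall>\<^sub>F L in sequentially. real L * exp (- (real L / 2)) < 1 / 4 \<and> p ^ (L div 2) < 1 / 4"
    by (rule eventually_conj)
  then obtain L0 where L0: "\<And>L. L0 \<le> L \<Longrightarrow> real L * exp (- (real L / 2)) < 1 / 4 \<and> p ^ (L div 2) < 1 / 4"
    unfolding eventually_sequentially by blast
  define l where "l = real CARD('d) * exp 2"
  have l: "0 < l" by (simp add: l_def)
  \<comment> \<open>The second term makes \<open>c * L \<le> ln 2\<close> for \<open>L < L0\<close>;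
    \<open>Suc\<close> keeps the denominator positive.\<close>
  define c where "c = min (1 / (2 * l)) (ln 2 / real (Suc L0))"
  have c: "0 < c" using l by (simp add: c_def)
  have "c * real L \<le> t"
    if L: "1 \<le> L" and \<sigma>: "\<exists>i. \<not> \<sigma> (box_corner - axis i 1)" and t: "0 \<le> t"
      and tv: "\<And>\<eta>. \<eta> \<in> configs (lattice_box L) \<Longrightarrow> tv_dist (configs (lattice_box L))
        (law (1 - p) (lattice_box L) \<sigma> t \<eta>)
        (measure_pmf.prob (reversible_measure (1 - p) (lattice_box L))) \<le> 1 / 4"
    for L t and \<sigma> :: "'d config"
  proof -
    interpret east_process p "lattice_box L" \<sigma> by (rule east_process_box)
    show ?thesis
    proof (cases "L0 \<le> L")
      case True
      have "real L / (2 * l) \<le> t"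
      proof (rule ccontr)
        assume "\<not> real L / (2 * l) \<le> t"
        then have "l * t - real L \<le> - (real L / 2)" using l by (simp add: field_simps)
        then have "real L * exp (l * t - real L) \<le> real L * exp (- (real L / 2))"
          by (intro mult_left_mono) auto
        then show False
          using all_ones_tv_dist[OF refl L t] tv[OF all_ones_mem] L0[OF True] unfolding l_def by linarith
      qed
      moreover have "c * real L \<le> 1 / (2 * l) * real L" by (rule mult_right_mono) (simp_all add: c_def)
      ultimately show ?thesis by simp
    next
      case False
      have "rate box_corner \<eta> = 1" for \<eta>
        using \<sigma> by (auto simp: constraint_def canonical_basis_def glue_def box_corner_pred)
      from free_site[OF box_corner_mem[OF L] this t]
      obtain \<eta> where "\<eta> \<in> configs (lattice_box L)" "exp (- t) / 2 \<le> tv_dist (configs (lattice_box L))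
        (law (1 - p) (lattice_box L) \<sigma> t \<eta>)
        (measure_pmf.prob (reversible_measure (1 - p) (lattice_box L)))" by blast
      with tv[of \<eta>] have "exp (- t) \<le> 1 / 2" by linarith
      then have "2 \<le> exp t" by (simp add: exp_minus field_simps)
      then have "ln 2 \<le> t" by (metis exp_gt_zero ln_exp ln_le_cancel_iff zero_less_numeral)
      have "c * real L \<le> ln 2 / real (Suc L0) * real (Suc L0)"
        by (rule mult_mono) (use False l in \<open>auto simp: c_def\<close>)
      also have "\<dots> = ln 2" by simp
      finally show ?thesis using \<open>ln 2 \<le> t\<close> by linarith
    qed
  qed
  then show ?thesis using c by blast
qed

end

theorem theorem5p1:
  fixes p q :: real
  assumes "p = 1 - q" and "0 < p" and "p < 1"
  shows "\<exists>C>0. \<forall>L::nat. L \<ge> 1 \<longrightarrow>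
           (\<forall>\<sigma>\<in>configs (east_boundary (lattice_box L :: ('d::finite) site set)).
              ergodic_boundary q (lattice_box L) \<sigma> \<longrightarrow>
                inverse C * real L \<le> mixing_time q (lattice_box L) \<sigma> \<and>
                mixing_time q (lattice_box L) \<sigma> \<le> C * real L)"
proof -
  interpret bernoulli_parameter p by unfold_locales (use assms in auto)
  have q: "q = 1 - p" using assms by simp
  obtain U :: "'d \<Rightarrow> real" where U: "\<And>i. 0 < U i"
    and upper: "\<And>i L (\<sigma> :: 'd config) \<eta>. 1 \<le> L \<Longrightarrow> \<not> \<sigma> (box_corner - axis i 1) \<Longrightarrow>
      \<eta> \<in> configs (lattice_box L) \<Longrightarrow> tv_dist (configs (lattice_box L))
      (law q (lattice_box L) \<sigma> (U i * real L) \<eta>)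
      (measure_pmf.prob (reversible_measure q (lattice_box L))) \<le> 1 / 4"
    using mixing_upper[where ?'d = 'd] unfolding q by metis
  obtain c where c: "0 < c"
    and lower: "\<And>L (\<sigma> :: 'd config) t. 1 \<le> L \<Longrightarrow> (\<exists>i. \<not> \<sigma> (box_corner - axis i 1)) \<Longrightarrow> 0 \<le> t \<Longrightarrow>
      (\<And>\<eta>. \<eta> \<in> configs (lattice_box L) \<Longrightarrow> tv_dist (configs (lattice_box L))
        (law q (lattice_box L) \<sigma> t \<eta>)
        (measure_pmf.prob (reversible_measure q (lattice_box L))) \<le> 1 / 4) \<Longrightarrow>
      c * real L \<le> t"
    using mixing_lower[where ?'d = 'd] unfolding q by metis
  \<comment> \<open>The upper constant depends on the direction of the boundary zero; the maximum
    over the d directions serves every boundary condition.\<close>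
  define C where "C = max (1 / c) (Max (range U))"
  have C0: "1 / c \<le> C" by (simp add: C_def)
  have CU: "U i \<le> C" for i unfolding C_def by (intro max.coboundedI2 Max_ge) auto
  have C: "0 < C" using C0 c by (meson divide_pos_pos less_le_trans zero_less_one)
  have "inverse C * real L \<le> mixing_time q (lattice_box L) \<sigma>
      \<and> mixing_time q (lattice_box L) \<sigma> \<le> C * real L"
    if L: "1 \<le> L" and erg: "ergodic_boundary q (lattice_box L) \<sigma>" for L and \<sigma> :: "'d config"
  proof -
    interpret east_process p "lattice_box L" \<sigma> by (rule east_process_box)
    obtain i where i: "\<not> \<sigma> (box_corner - axis i 1)"
      using ergodic_boundary_zero[OF erg[unfolded q] L] by blast
    let ?tv = "\<lambda>t \<eta>. tv_dist (configs (lattice_box L)) (law q (lattice_box L) \<sigma> t \<eta>)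
        (measure_pmf.prob (reversible_measure q (lattice_box L)))"
    define T where "T = {t. t > 0 \<and> (MAX \<eta>\<in>configs (lattice_box L). ?tv t \<eta>) \<le> 1 / 4}"
    have T: "t \<in> T \<longleftrightarrow> 0 < t \<and> (\<forall>\<eta>\<in>configs (lattice_box L). ?tv t \<eta> \<le> 1 / 4)" for t
      unfolding T_def using finite_configs all_ones_mem by (subst mem_Collect_eq, subst Max_le_iff) auto
    have mix: "mixing_time q (lattice_box L) \<sigma> = Inf T" by (simp add: mixing_time_def T_def)
    have UT: "U i * real L \<in> T" unfolding T using U[of i] L upper[of L \<sigma> i] i by auto
    have "bdd_below T" by (rule bdd_belowI[of _ 0]) (simp add: T)
    then have "Inf T \<le> U i * real L" by (rule cInf_lower[OF UT])
    also have "\<dots> \<le> C * real L" by (rule mult_right_mono[OF CU]) simp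
    finally have "Inf T \<le> C * real L" .
    moreover have "inverse C * real L \<le> Inf T"
    proof (rule cInf_greatest)
      show "T \<noteq> {}" using UT by blast
      fix t assume "t \<in> T"
      then have "c * real L \<le> t" using lower[OF L, of \<sigma> t] i unfolding T by auto
      moreover have "inverse C * real L \<le> c * real L"
        by (rule mult_right_mono) (use C0 C c in \<open>auto simp: field_simps\<close>)
      ultimately show "inverse C * real L \<le> t" by linarith
    qed
    ultimately show ?thesis unfolding mix by blast
  qed
  then show ?thesis using C by blast
qed

end
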